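(* For each sample size $n$, let $\mathcal M_n$ be a finite and non-empty family of models $m$, each satisfying $|m|<n-1$, let $r_n=\sup_{m\in\mathcal M_n}|m|/n$, and define $$a_n=\sqrt{\frac{\log(\#\mathcal M_n+1)}{n(1-r_n)^3}},$$ where $\#\mathcal M_n$ is the number of models in $\mathcal M_n$. Assume that $a_n\to0$ as $n\to\infty$. Let $c>0$ be an arbitrary fixed finite constant. Consider (measurable) minimizers $$\hat m_n^*=\arg\min_{m\in\mathcal M_n}\mathrm{GCV}(m)\quad\text{and}\quad m_n^*=\arg\min_{m\in\mathcal M_n}\rho^2(m).$$ Then, uniformly over all parameters $\beta,\sigma,\Sigma$ of the Gaussian linear model described in the context that satisfy $\mathrm{Var}_{\beta,\sigma,\Sigma}[y]\le c$: (i) $|\rho^2(\hat m_n^* )-\rho^2(m_n^* )|=O_p(a_n)$; (ii) $|\mathrm{GCV}(\hat m_n^* )-\rho^2(\hat m_n^* )|=O_p(a_n)$. Moreover, let $C(\cdot)$ be any one of the three criteria $\mathrm{GCV}(\cdot)$, $S_p(\cdot)$, $\hat\rho^2(\cdot)$, let $L(\cdot)$ be either $\rho^2(\cdot)$ or $R^2(\cdot)$, and consider (measurable) minimizers $\hat m_n^{C}=\arg\min_{m\in\mathcal M_n}C(m)$ and $m_n^{L}=\arg\min_{m\in\mathcal M_n}L(m)$. Then, uniformly over all parameters $\beta,\sigma,\Sigma$ of the Gaussian linear model described in the context that satisfy $\mathrm{Var}_{\beta,\sigma,\Sigma}[y]\le c$, both $|L(\hat m_n^{C})-L(m_n^{L})|=O_p(a_n)$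 and $|C(\hat m_n^{C})-L(\hat m_n^{C})|=O_p(a_n)$.
   Context: Model. A response $y$ satisfies $y=\sum_{j=1}^\infty x_j\beta_j+u$, where $\beta=(\beta_j)_{j\ge1}$ is a real sequence; $u$ has mean zero and variance $\sigma^2\ge0$; the random sequence $x=(x_j)_{j\ge1}$ has mean zero and covariances $\Sigma=[E(x_ix_j)]_{i,j\ge1}$; the series converges in squared mean; each $x_j$ is uncorrelated with $u$; and for all $k\ge1$ and $j_1<\dots<j_k$ the covariance matrix of $(x_{j_1},\dots,x_{j_k})'$ is positive definite. All these random variables ($y$, $u$ and $x_j$, $j\ge1$) are assumed jointly Gaussian. Sample. $(Y,X)$ consists of $n$ i.i.d. copies $(y^{(i)},x^{(i)})$, $i=1,\dots,n$, of $(y,x)$; $P_{n,\beta,\sigma,\Sigma}$ and $E_{n,\beta,\sigma,\Sigma}$ denote the corresponding probability and expectation. $\mathrm{Var}_{\beta,\sigma,\Sigma}[y]$ is the variance of $y$. Models. A model is a 0-1 sequence $m=(m_j)_{j\ge1}$, with $|m|$ the number of ones in $m$ ($|m|=0$ is allowed). The restricted least-squares estimator $\tilde\beta(m)$ has $j$th component zero whenever $m_j=0$; its remaining $|m|$ components are obtained by least-squares regression of $Y=(y^{(1)},\dots,y^{(n)})'$ on the corresponding columns of $X$. The residual sum of squares is $\mathrm{RSS}(m)=\sum_{i=1}^n\bigl(y^{(i)}-x^{(i)\prime}\tilde\beta(m)\bigr)^2$. Prediction errors. Let $(y^{(f)},x^{(f)})$ be a copy of $(y,x)$ independent of $(Y,X)$.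 The conditional and unconditional mean squared prediction errors are $\rho^2(m)=E_{n,\beta,\sigma,\Sigma}\bigl[(y^{(f)}-x^{(f)\prime}\tilde\beta(m))^2\mid Y,X\bigr]$ and $R^2(m)=E_{n,\beta,\sigma,\Sigma}\bigl[(y^{(f)}-x^{(f)\prime}\tilde\beta(m))^2\bigr]$. For a data-dependent model $\hat m$, $\rho^2(\hat m)$ and $R^2(\hat m)$ denote the functions $m\mapsto\rho^2(m)$ and $m\mapsto R^2(m)$ evaluated at $m=\hat m$. Criteria. $$\mathrm{GCV}(m)=\frac{\mathrm{RSS}(m)}{n-|m|}\cdot\frac{n}{n-|m|},\quad S_p(m)=\frac{\mathrm{RSS}(m)}{n-|m|}\cdot\frac{n-1}{n-1-|m|},\quad \hat\rho^2(m)=\frac{\mathrm{RSS}(m)}{n-|m|}\cdot\frac{n+1}{n+1-|m|}.$$ Uniform $O_p$. For random variables $T_n$ (functions of the sample and possibly of the parameters), "$T_n=O_p(a_n)$ uniformly over a set of parameters" means $\lim_{K\to\infty}\limsup_{n\to\infty}\sup P_{n,\beta,\sigma,\Sigma}(|T_n|>K a_n)=0$, the supremum being over that set of parameters $(\beta,\sigma,\Sigma)$. *)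

theory Defs
  imports "HOL-Probability.Probability"
begin

section \<open>The Gaussian linear model\<close>

definition gaussian_rv :: "'w measure \<Rightarrow> ('w \<Rightarrow> real) \<Rightarrow> bool" where
  \<comment> \<open>Degenerate (almost surely constant) Gaussians are included; they occur, e.g., as the error
      when its variance is zero.\<close>
  "gaussian_rv M Z \<longleftrightarrow> Z \<in> borel_measurable M \<and>
     ((\<exists>\<mu> s. 0 < s \<and> distributed M lborel Z (\<lambda>t. ennreal (normal_density \<mu> s t))) \<or>
      (\<exists>\<mu>. AE \<omega> in M. Z \<omega> = \<mu>))"

text \<open>Sequences indexed by the integers \<open>j \<ge> 1\<close> are functions on \<^typ>\<open>nat\<close>, with the index shifted
  by one. Joint Gaussianity means that every finite linear combination of the variables is
  (possibly degenerate) Gaussian; in particular all variables are square-integrable, so the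
  expectations below are genuine.\<close>

locale gaussian_linear_model = prob_space M
  for M :: "'w measure" +
  fixes y u :: "'w \<Rightarrow> real" and x :: "'w \<Rightarrow> nat \<Rightarrow> real"
    and \<beta> :: "nat \<Rightarrow> real" and \<sigma> :: real and Cov :: "nat \<Rightarrow> nat \<Rightarrow> real"
  assumes y_rv: "random_variable borel y"
    and u_rv: "random_variable borel u"
    and x_rv: "\<And>j. random_variable borel (\<lambda>\<omega>. x \<omega> j)"
    and jointly_gaussian: "\<And>(a::real) (b::real) (d::nat \<Rightarrow> real) (k::nat).
      gaussian_rv M (\<lambda>\<omega>. a * y \<omega> + b * u \<omega> + (\<Sum>j<k. d j * x \<omega> j))"
    and u_mean: "expectation u = 0"
    and sigma_nonneg: "0 \<le> \<sigma>"
    and u_var: "variance u = \<sigma>\<^sup>2"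
    and x_mean: "\<And>j. expectation (\<lambda>\<omega>. x \<omega> j) = 0"
    and x_cov: "\<And>i j. expectation (\<lambda>\<omega>. x \<omega> i * x \<omega> j) = Cov i j"
    and x_u_uncorrelated: "\<And>j. expectation (\<lambda>\<omega>. x \<omega> j * u \<omega>) = 0"
    and response: "(\<lambda>k. expectation (\<lambda>\<omega>. (y \<omega> - ((\<Sum>j<k. x \<omega> j * \<beta> j) + u \<omega>))\<^sup>2)) \<longlonglongrightarrow> 0"
    and Cov_pos_def: "\<And>(J::nat set) (v::nat \<Rightarrow> real). finite J \<Longrightarrow> \<exists>j\<in>J. v j \<noteq> 0 \<Longrightarrow>
      0 < (\<Sum>i\<in>J. \<Sum>j\<in>J. v i * Cov i j * v j)"

type_synonym obs = "real \<times> (nat \<Rightarrow> real)"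
type_synonym sample = "nat \<Rightarrow> obs"
type_synonym param = "(nat \<Rightarrow> real) \<times> real \<times> (nat \<Rightarrow> nat \<Rightarrow> real)"
type_synonym model = "nat \<Rightarrow> bool"

definition obs_space :: "obs measure" where
  "obs_space = borel \<Otimes>\<^sub>M PiM UNIV (\<lambda>_. borel)"

text \<open>\<open>D\<close> is a law of \<open>(y, x)\<close> under the parameters \<open>(\<beta>, \<sigma>, Cov)\<close>. Taking the underlying
  probability space to live on triples loses no generality: the variables \<open>y\<close>, \<open>u\<close>, \<open>x\<close> of a
  model on an arbitrary space can be replaced by the coordinates under their joint law.\<close>

definition is_data_law :: "param \<Rightarrow> obs measure \<Rightarrow> bool" where
  "is_data_law \<theta> D \<longleftrightarrow> (case \<theta> of (\<beta>, \<sigma>, Cov) \<Rightarrow>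
     \<exists>(M :: (real \<times> real \<times> (nat \<Rightarrow> real)) measure) y u x.
       gaussian_linear_model M y u x \<beta> \<sigma> Cov \<and>
       D = distr M obs_space (\<lambda>\<omega>. (y \<omega>, x \<omega>)))"

definition param_space :: "param set" where
  "param_space = {\<theta>. \<exists>D. is_data_law \<theta> D}"

definition response_variance :: "obs measure \<Rightarrow> real" where
  "response_variance D = (\<integral>z. (fst z - (\<integral>z'. fst z' \<partial>D))\<^sup>2 \<partial>D)"


section \<open>Samples, estimators and prediction errors\<close>

definition sample_space :: "nat \<Rightarrow> sample measure" where
  "sample_space n = PiM {..<n} (\<lambda>_. obs_space)"

text \<open>The joint law of the sample and of the independent future observation.\<close>

definition joint_law :: "nat \<Rightarrow> obs measure \<Rightarrow> (sample \<times> obs) measure" where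
  "joint_law n D = PiM {..<n} (\<lambda>_. D) \<Otimes>\<^sub>M D"

definition msize :: "model \<Rightarrow> nat" where
  "msize m = card {j. m j}"

definition predict :: "(nat \<Rightarrow> real) \<Rightarrow> (nat \<Rightarrow> real) \<Rightarrow> real" where
  "predict x b = (\<Sum>j. x j * b j)"

definition sum_sq :: "nat \<Rightarrow> sample \<Rightarrow> (nat \<Rightarrow> real) \<Rightarrow> real" where
  "sum_sq n s b = (\<Sum>i<n. (fst (s i) - predict (snd (s i)) b)\<^sup>2)"

text \<open>The least-squares solution is unique only where the selected columns of the design matrix are
  linearly independent, i.e. for \<open>|m| < n\<close> outside a null set. On that null set any
  measurable choice of a minimizer is admitted.\<close>

definition restricted_ls_estimator ::
    "nat \<Rightarrow> model \<Rightarrow> (sample \<Rightarrow> nat \<Rightarrow> real) \<Rightarrow> bool" where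
  "restricted_ls_estimator n m b \<longleftrightarrow>
     (\<forall>j. (\<lambda>s. b s j) \<in> borel_measurable (sample_space n)) \<and>
     (\<forall>s\<in>space (sample_space n).
        (\<forall>j. \<not> m j \<longrightarrow> b s j = 0) \<and>
        (\<forall>b'. (\<forall>j. \<not> m j \<longrightarrow> b' j = 0) \<longrightarrow> sum_sq n s (b s) \<le> sum_sq n s b'))"

type_synonym estimator = "model \<Rightarrow> sample \<Rightarrow> nat \<Rightarrow> real"

definition RSS :: "nat \<Rightarrow> estimator \<Rightarrow> model \<Rightarrow> sample \<Rightarrow> real" where
  "RSS n b m s = sum_sq n s (b m s)"

definition GCV :: "nat \<Rightarrow> estimator \<Rightarrow> model \<Rightarrow> sample \<Rightarrow> real" where
  "GCV n b m s = RSS n b m s / (real n - real (msize m)) * (real n / (real n - real (msize m)))"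

definition Sp :: "nat \<Rightarrow> estimator \<Rightarrow> model \<Rightarrow> sample \<Rightarrow> real" where
  "Sp n b m s = RSS n b m s / (real n - real (msize m)) *
     ((real n - 1) / (real n - 1 - real (msize m)))"

definition rho2_hat :: "nat \<Rightarrow> estimator \<Rightarrow> model \<Rightarrow> sample \<Rightarrow> real" where
  "rho2_hat n b m s = RSS n b m s / (real n - real (msize m)) *
     ((real n + 1) / (real n + 1 - real (msize m)))"

definition sq_pred_error :: "estimator \<Rightarrow> model \<Rightarrow> sample \<times> obs \<Rightarrow> real" where
  "sq_pred_error b m = (\<lambda>(s, f). (fst f - predict (snd f) (b m s))\<^sup>2)"

definition sample_sigma :: "nat \<Rightarrow> obs measure \<Rightarrow> (sample \<times> obs) measure" where
  "sample_sigma n D = vimage_algebra (space (joint_law n D)) fst (sample_space n)"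

definition rho2 :: "nat \<Rightarrow> obs measure \<Rightarrow> estimator \<Rightarrow> model \<Rightarrow> sample \<times> obs \<Rightarrow> real" where
  "rho2 n D b m = real_cond_exp (joint_law n D) (sample_sigma n D) (sq_pred_error b m)"

text \<open>The unconditional error is a constant; the last argument is there only to give it the same
  type as \<open>rho2\<close>.\<close>

definition R2 :: "nat \<Rightarrow> obs measure \<Rightarrow> estimator \<Rightarrow> model \<Rightarrow> sample \<times> obs \<Rightarrow> real" where
  "R2 n D b m = (\<lambda>_. \<integral>\<omega>. sq_pred_error b m \<omega> \<partial>joint_law n D)"


section \<open>Minimizers, rates and uniform stochastic order\<close>

definition criterion_minimizer ::
    "nat \<Rightarrow> model set \<Rightarrow> (model \<Rightarrow> sample \<Rightarrow> real) \<Rightarrow> (sample \<Rightarrow> model) \<Rightarrow> bool" where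
  "criterion_minimizer n Ms C mh \<longleftrightarrow> mh \<in> sample_space n \<rightarrow>\<^sub>M count_space Ms \<and>
     (\<forall>s\<in>space (sample_space n). \<forall>m\<in>Ms. C (mh s) s \<le> C m s)"

text \<open>Conditional expectations are determined only up to null sets, and so is the property of
  minimizing them.\<close>

definition target_minimizer ::
    "nat \<Rightarrow> obs measure \<Rightarrow> model set \<Rightarrow> (model \<Rightarrow> sample \<times> obs \<Rightarrow> real) \<Rightarrow>
     (sample \<Rightarrow> model) \<Rightarrow> bool" where
  "target_minimizer n D Ms L mt \<longleftrightarrow> mt \<in> sample_space n \<rightarrow>\<^sub>M count_space Ms \<and>
     (AE \<omega> in joint_law n D. \<forall>m\<in>Ms. L (mt (fst \<omega>)) \<omega> \<le> L m \<omega>)"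

definition max_ratio :: "(nat \<Rightarrow> model set) \<Rightarrow> nat \<Rightarrow> real" where
  "max_ratio Ms n = (SUP m\<in>Ms n. real (msize m) / real n)"

definition rate :: "(nat \<Rightarrow> model set) \<Rightarrow> nat \<Rightarrow> real" where
  "rate Ms n = sqrt (ln (real (card (Ms n)) + 1) / (real n * (1 - max_ratio Ms n) ^ 3))"

definition uniformly_Op ::
    "'p set \<Rightarrow> (nat \<Rightarrow> 'p \<Rightarrow> 'w measure) \<Rightarrow> (nat \<Rightarrow> 'p \<Rightarrow> 'w \<Rightarrow> real) \<Rightarrow> (nat \<Rightarrow> real) \<Rightarrow> bool" where
  "uniformly_Op \<Theta> Q T a \<longleftrightarrow>
     ((\<lambda>K::real. limsup (\<lambda>n. SUP \<theta>\<in>\<Theta>.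
        emeasure (Q n \<theta>) {\<omega>\<in>space (Q n \<theta>). \<bar>T n \<theta> \<omega>\<bar> > K * a n})) \<longlongrightarrow> 0) at_top"

end

theory Submission
  imports Defs
begin

text \<open>Fix a model with \<open>k\<close> regressors and let \<open>v\<close> be the variance of the residual \<open>e\<close> of \<open>y\<close> on
  them. After whitening, the sample is an \<open>n \<times> (k + 1)\<close> array of independent standard
  normals (regressors and \<open>e / sqrt v\<close>), \<open>RSS / v\<close> is chi-square with \<open>n - k\<close> degrees of freedom and
  \<open>\<rho>\<^sup>2 = v (1 + |T|\<^sup>2)\<close>, where \<open>T\<close> is the least-squares coefficient of the standardised error on the
  whitened regressors. In any direction \<open>h\<close> the projection \<open>h \<bullet> T\<close> is \<open>|h|\<close> times the coefficient of
  the last column, which is normal with variance one over a chi-square variable with \<open>n - k + 1\<close>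
  degrees of freedom. Averaging \<open>cos (h \<bullet> T)\<close> over a Gaussian \<open>h\<close> identifies the
  Laplace transform, hence the law, of \<open>|T|\<^sup>2\<close> as that of a ratio of independent chi-square variables
  with \<open>k\<close> and \<open>n - k + 1\<close> degrees of freedom.
  Chernoff bounds show that outside an event of exponentially small probability all criteria and
  targets agree with \<open>v n / (n - k)\<close> up to a multiple of \<open>a\<^sub>n\<close>; a union bound over the models
  makes this simultaneous, and comparing minimizers of uniformly close functions finishes the
  proof.\<close>

section \<open>Standard Gaussian families\<close>

text \<open>The obstacle is the law of \<open>|T|\<^sup>2\<close>, whose classical derivation
  inverts a Gaussian Gram matrix. That is avoided here: only the last coefficient of a regression
  has a simple closed form, and rotation invariance of the Gaussian array lets any direction play
  the role of the last one. One-dimensional projections then determine the law of the norm. The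
  degrees of freedom \<open>n - k + 1\<close> arise because the last regressor is adjusted for only
  \<open>k - 1\<close> others. The cube in the rate has this origin. Put
  \<open>q = 1 - r\<^sub>n\<close>. A relative error \<open>\<delta>\<close> of
  \<open>RSS / (n - k)\<close> is inflated by up to a constant over \<open>q\<close>, so
  \<open>\<delta>\<close> is chosen of order \<open>a\<^sub>n * q\<close>; this puts
  \<open>q\<^sup>2\<close> into the Chernoff exponent, and the third factor comes from
  \<open>n - k \<ge> n * q\<close>. All parameters act through the single scale \<open>v\<close>,
  which is at most the variance of \<open>y\<close>; hence the uniformity. Standardising by
  \<open>sqrt v\<close> fails when \<open>v = 0\<close>, and that case is settled separately through
  the almost sure full rank of the design.\<close>

abbreviation std_normal :: "real measure" where
  "std_normal \<equiv> std_normal_distribution"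

interpretation std_normal: real_distribution std_normal
  by (rule real_dist_normal_dist)

lemma prob_space_std_normal: "prob_space std_normal"
  by unfold_locales

lemma (in prob_space) integrable_bounded:
  fixes f :: "'a \<Rightarrow> 'b :: {banach, second_countable_topology}"
  assumes "f \<in> borel_measurable M" "\<And>\<omega>. norm (f \<omega>) \<le> B"
  shows "integrable M f"
  using assms by (intro integrable_const_bound[where B = B]) auto

lemma measure_indicator_law:
  assumes "X \<in> borel_measurable M" "A \<in> sets borel"
  shows "measure (distr M borel X) A = (\<integral>\<omega>. indicator A (X \<omega>) \<partial>M)"
  using assms by (subst integral_distr[symmetric]) auto

lemma (in prob_space) law_std_normal:
  assumes [measurable]: "X \<in> borel_measurable M"
    and cf: "\<And>u. (\<integral>\<omega>. iexp (u * X \<omega>) \<partial>M) = complex_of_real (exp (- (u\<^sup>2) / 2))"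
  shows "distr M borel X = std_normal"
proof (rule Levy_uniqueness)
  show "real_distribution (distr M borel X)"
    by (rule real_distribution_distr) simp
  show "real_distribution std_normal" by (rule real_dist_normal_dist)
  show "char (distr M borel X) = char std_normal"
    by (rule ext) (subst char_std_normal_distribution, simp add: char_def integral_distr cf del: of_real_mult)
qed

text \<open>Levy's theorem is applied to the law of \<open>X\<close> under the density \<open>(1 + g) / (1 + \<kappa>)\<close>.\<close>

lemma (in prob_space) weighted_law_std_normal:
  assumes [measurable]: "X \<in> borel_measurable M" "g \<in> borel_measurable M" "A \<in> sets borel"
    and cf: "\<And>u. (\<integral>\<omega>. iexp (u * X \<omega>) \<partial>M) = complex_of_real (exp (- (u\<^sup>2) / 2))"
    and cfg: "\<And>u. (\<integral>\<omega>. iexp (u * X \<omega>) * complex_of_real (g \<omega>) \<partial>M)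
                  = complex_of_real (\<kappa> * exp (- (u\<^sup>2) / 2))"
    and g: "\<And>\<omega>. \<bar>g \<omega>\<bar> \<le> 1" and \<kappa>: "- 1 < \<kappa>"
  shows "(\<integral>\<omega>. indicator A (X \<omega>) * g \<omega> \<partial>M) = \<kappa> * measure std_normal A"
proof -
  define h where "h \<omega> = (1 + g \<omega>) / (1 + \<kappa>)" for \<omega>
  have h[measurable]: "h \<in> borel_measurable M" unfolding h_def by measurable
  have h0: "0 \<le> h \<omega>" for \<omega> using g[of \<omega>] \<kappa> by (auto simp: h_def abs_le_iff)
  have ig: "integrable M g" by (rule integrable_bounded[where B=1]) (use g in auto)
  have i1: "integrable M (\<lambda>\<omega>. iexp (u * X \<omega>))" for u
    by (rule integrable_bounded[where B=1]) auto
  have i2: "integrable M (\<lambda>\<omega>. iexp (u * X \<omega>) * complex_of_real (g \<omega>))" for u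
    by (rule integrable_bounded[where B=1]) (use g in \<open>auto simp: norm_mult\<close>)
  \<comment> \<open>At \<open>u = 0\<close> the hypothesis \<open>cfg\<close> identifies
    \<open>\<kappa>\<close> as the mean of \<open>g\<close>, so the density \<open>h\<close> has
    total mass one.\<close>
  have "(\<integral>\<omega>. complex_of_real (g \<omega>) \<partial>M) = complex_of_real \<kappa>" using cfg[of 0] by simp
  then have Eg: "(\<integral>\<omega>. g \<omega> \<partial>M) = \<kappa>" using integral_complex_of_real[of M g] by (metis of_real_eq_iff)
  have Eh: "(\<integral>\<omega>. h \<omega> \<partial>M) = 1" using ig Eg \<kappa> by (simp add: h_def prob_space)
  have ih: "integrable M h" using ig unfolding h_def by simp
  define M' where "M' = density M (\<lambda>\<omega>. ennreal (h \<omega>))"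
  have s: "sets M' = sets M" by (simp add: M'_def)
  have ps: "prob_space M'"
  proof (rule prob_spaceI)
    have "emeasure M' (space M') = (\<integral>\<^sup>+\<omega>. ennreal (h \<omega>) \<partial>M)"
      by (simp add: M'_def emeasure_density cong: nn_integral_cong)
    also have "\<dots> = 1" using ih h0 Eh by (subst nn_integral_eq_integral) auto
    finally show "emeasure M' (space M') = 1" .
  qed
  interpret M': prob_space M' by fact
  have X': "X \<in> borel_measurable M'" using s by (simp add: M'_def)
  have "distr M' borel X = std_normal"
  proof (rule M'.law_std_normal[OF X'])
    fix u
    have "(\<integral>\<omega>. iexp (u * X \<omega>) \<partial>M') = (\<integral>\<omega>. h \<omega> *\<^sub>R iexp (u * X \<omega>) \<partial>M)"
      unfolding M'_def by (subst integral_density) (auto simp: h0)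
    also have "\<dots> = (\<integral>\<omega>. (iexp (u * X \<omega>) + iexp (u * X \<omega>) * complex_of_real (g \<omega>)) / complex_of_real (1 + \<kappa>) \<partial>M)"
      by (intro Bochner_Integration.integral_cong) (auto simp: h_def scaleR_conv_of_real field_simps)
    also have "\<dots> = complex_of_real ((exp (- (u\<^sup>2) / 2) + \<kappa> * exp (- (u\<^sup>2) / 2)) / (1 + \<kappa>))"
      using i1 i2 by (simp add: cf cfg del: of_real_mult)
    also have "(exp (- (u\<^sup>2) / 2) + \<kappa> * exp (- (u\<^sup>2) / 2)) / (1 + \<kappa>) = exp (- (u\<^sup>2) / 2)"
      using \<kappa> by (simp add: field_simps)
    finally show "(\<integral>\<omega>. iexp (u * X \<omega>) \<partial>M') = complex_of_real (exp (- (u\<^sup>2) / 2))" .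
  qed
  then have "measure std_normal A = measure (distr M' borel X) A" by simp
  also have "\<dots> = (\<integral>\<omega>. indicator A (X \<omega>) \<partial>M')"
    using X' assms(3) by (subst measure_indicator_law) auto
  also have "\<dots> = (\<integral>\<omega>. h \<omega> * indicator A (X \<omega>) \<partial>M)"
    unfolding M'_def by (subst integral_density) (auto simp: h0)
  also have "\<dots> = (\<integral>\<omega>. (indicator A (X \<omega>) + indicator A (X \<omega>) * g \<omega>) / (1 + \<kappa>) \<partial>M)"
    by (intro Bochner_Integration.integral_cong) (auto simp: h_def field_simps)
  also have "\<dots> = ((\<integral>\<omega>. indicator A (X \<omega>) \<partial>M) + (\<integral>\<omega>. indicator A (X \<omega>) * g \<omega> \<partial>M)) / (1 + \<kappa>)"
  proof -
    have "integrable M (\<lambda>\<omega>. indicator A (X \<omega>) :: real)"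
      by (rule integrable_bounded[where B=1]) auto
    moreover have "integrable M (\<lambda>\<omega>. indicator A (X \<omega>) * g \<omega>)"
      by (rule integrable_bounded[where B=1]) (use g in \<open>auto simp: indicator_def\<close>)
    ultimately show ?thesis by simp
  qed
  also have "(\<integral>\<omega>. indicator A (X \<omega>) \<partial>M) = measure (distr M borel X) A"
    by (subst measure_indicator_law) auto
  also have "\<dots> = measure std_normal A" using law_std_normal[OF assms(1) cf] by simp
  finally show ?thesis using \<kappa> by (simp add: field_simps)
qed

text \<open>Encoded by the joint characteristic function: subfamilies, reindexings and orthogonal
  images are then obtained by substituting in \<open>t\<close>. Independence is a consequence,
  proved in \<open>std_gaussian_law\<close>.\<close>

definition std_gaussian :: "'w measure \<Rightarrow> 'i set \<Rightarrow> ('i \<Rightarrow> 'w \<Rightarrow> real) \<Rightarrow> bool" where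
  "std_gaussian M I X \<longleftrightarrow> prob_space M \<and> finite I \<and> (\<forall>i\<in>I. X i \<in> borel_measurable M) \<and>
     (\<forall>t. (\<integral>\<omega>. iexp (\<Sum>i\<in>I. t i * X i \<omega>) \<partial>M) = complex_of_real (exp (- (\<Sum>i\<in>I. (t i)\<^sup>2) / 2)))"

lemma std_gaussian_cf:
  "std_gaussian M I X \<Longrightarrow>
     (\<integral>\<omega>. iexp (\<Sum>i\<in>I. t i * X i \<omega>) \<partial>M) = complex_of_real (exp (- (\<Sum>i\<in>I. (t i)\<^sup>2) / 2))"
  by (simp add: std_gaussian_def)

lemma std_gaussian_subset:
  assumes "std_gaussian M I X" "J \<subseteq> I"
  shows "std_gaussian M J X"
proof -
  have fin: "finite I" using assms(1) by (simp add: std_gaussian_def)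
  have "(\<integral>\<omega>. iexp (\<Sum>i\<in>J. t i * X i \<omega>) \<partial>M) = complex_of_real (exp (- (\<Sum>i\<in>J. (t i)\<^sup>2) / 2))" for t
  proof -
    have "(\<Sum>i\<in>J. t i * X i \<omega>) = (\<Sum>i\<in>I. (if i \<in> J then t i else 0) * X i \<omega>)" for \<omega>
      by (rule sum.mono_neutral_cong_left) (use fin assms(2) in auto)
    moreover have "(\<Sum>i\<in>J. (t i)\<^sup>2) = (\<Sum>i\<in>I. (if i \<in> J then t i else 0)\<^sup>2)"
      by (rule sum.mono_neutral_cong_left) (use fin assms(2) in auto)
    ultimately show ?thesis using std_gaussian_cf[OF assms(1), of "\<lambda>i. if i \<in> J then t i else 0"] by simp
  qed
  then show ?thesis using assms finite_subset[OF assms(2) fin] by (auto simp: std_gaussian_def)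
qed

lemma std_gaussian_single:
  assumes "std_gaussian M I X" "i \<in> I"
  shows "(\<integral>\<omega>. iexp (u * X i \<omega>) \<partial>M) = complex_of_real (exp (- (u\<^sup>2) / 2))"
  using std_gaussian_cf[OF std_gaussian_subset[OF assms(1), of "{i}"], of "\<lambda>_. u"] assms(2) by simp

text \<open>The Cramer-Wold step: conditioning on \<open>X\<^sub>j \<in> A\<^sub>j\<close> leaves the characteristic function of the
  remaining variables unchanged, which is what makes the induction over the index set work.\<close>

lemma std_gaussian_prob_box:
  assumes "std_gaussian M I X" "\<And>i. i \<in> I \<Longrightarrow> A i \<in> sets borel"
  shows "measure M {\<omega>\<in>space M. \<forall>i\<in>I. X i \<omega> \<in> A i} = (\<Prod>i\<in>I. measure std_normal (A i))"
proof -
  have "finite I" using assms(1) by (simp add: std_gaussian_def)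
  then show ?thesis using assms
  proof (induction I arbitrary: M rule: finite_induct)
    case empty
    then interpret prob_space M by (simp add: std_gaussian_def)
    show ?case by (simp add: prob_space)
  next
    case (insert j I)
    interpret prob_space M using insert.prems(1) by (simp add: std_gaussian_def)
    have Xm[measurable]: "\<And>i. i \<in> insert j I \<Longrightarrow> X i \<in> borel_measurable M"
      using insert.prems(1) unfolding std_gaussian_def by blast
    have Xj[measurable]: "X j \<in> borel_measurable M" by (rule Xm) simp
    have Aj[measurable]: "A j \<in> sets borel" using insert.prems(2) by simp
    have cfj: "(\<integral>\<omega>. iexp (u * X j \<omega>) \<partial>M) = complex_of_real (exp (- (u\<^sup>2) / 2))" for u
      by (rule std_gaussian_single[OF insert.prems(1)]) simp
    define E where "E = X j -` A j \<inter> space M"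
    have E[measurable]: "E \<in> sets M" unfolding E_def by measurable
    have PE: "measure M E = measure std_normal (A j)"
      using law_std_normal[OF Xj cfj] measure_distr[OF Xj Aj] by (simp add: E_def)
    \<comment> \<open>Cosine and sine are treated separately because
      \<open>weighted_law_std_normal\<close> takes a real weight; together they give the
      characteristic function of the other variables restricted to \<open>E\<close>.\<close>
    have key: "(\<integral>\<omega>. indicator E \<omega> * cos (S \<omega>) \<partial>M) = exp (- (\<Sum>i\<in>I. (t i)\<^sup>2) / 2) * measure std_normal (A j)
        \<and> (\<integral>\<omega>. indicator E \<omega> * sin (S \<omega>) \<partial>M) = 0"
      if S: "S = (\<lambda>\<omega>. \<Sum>i\<in>I. t i * X i \<omega>)" for S t
    proof -
      have Sm[measurable]: "S \<in> borel_measurable M" unfolding S by measurable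
      define \<phi> where "\<phi> = exp (- (\<Sum>i\<in>I. (t i)\<^sup>2) / 2)"
      \<comment> \<open>Both signs are required, as \<open>cos S\<close> and \<open>sin S\<close>
        are half the sum and half the difference of exponentials in \<open>S\<close> and
        \<open>- S\<close>. The sign disappears on the right because \<open>\<phi>\<close> involves
        only squares; hence the sine part averages to zero.\<close>
      have two: "(\<integral>\<omega>. iexp (u * X j \<omega> + c * S \<omega>) \<partial>M) = complex_of_real (exp (- (u\<^sup>2) / 2) * \<phi>)"
        if "c = 1 \<or> c = -1" for u and c :: real
      proof -
        have "(\<Sum>i\<in>insert j I. (if i = j then u else c * t i) * X i \<omega>) = u * X j \<omega> + c * S \<omega>" for \<omega>
        proof -
          have "(\<Sum>i\<in>I. (if i = j then u else c * t i) * X i \<omega>) = c * S \<omega>"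
            unfolding S sum_distrib_left using insert.hyps by (intro sum.cong) auto
          then show ?thesis using insert.hyps by simp
        qed
        moreover have "(\<Sum>i\<in>insert j I. (if i = j then u else c * t i)\<^sup>2) = u\<^sup>2 + (\<Sum>i\<in>I. (t i)\<^sup>2)"
        proof -
          have "(\<Sum>i\<in>I. (if i = j then u else c * t i)\<^sup>2) = (\<Sum>i\<in>I. (t i)\<^sup>2)"
            using insert.hyps that by (intro sum.cong) (auto simp: power_mult_distrib)
          then show ?thesis using insert.hyps by simp
        qed
        moreover have "exp (- (u\<^sup>2 + (\<Sum>i\<in>I. (t i)\<^sup>2)) / 2) = exp (- (u\<^sup>2) / 2) * \<phi>"
          unfolding \<phi>_def by (simp add: exp_add[symmetric] add_divide_distrib diff_divide_distrib)
        ultimately show ?thesis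
          using std_gaussian_cf[OF insert.prems(1), of "\<lambda>i. if i = j then u else c * t i"] by simp
      qed
      have gaussian_square_integrable: "integrable M (\<lambda>\<omega>. iexp (u * X j \<omega> + c * S \<omega>))" for u and c :: real
        by (rule integrable_bounded[where B=1]) auto
      have co: "iexp (u * X j \<omega>) * complex_of_real (cos (S \<omega>))
          = (iexp (u * X j \<omega> + 1 * S \<omega>) + iexp (u * X j \<omega> + (-1) * S \<omega>)) / 2" for u \<omega>
        by (simp add: cos_of_real[symmetric] cos_exp_eq distrib_left exp_add exp_minus field_simps exp_diff)
      have si: "iexp (u * X j \<omega>) * complex_of_real (sin (S \<omega>))
          = (iexp (u * X j \<omega> + 1 * S \<omega>) - iexp (u * X j \<omega> + (-1) * S \<omega>)) / (2 * \<i>)" for u \<omega>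
        by (simp add: sin_of_real[symmetric] sin_exp_eq distrib_left exp_add exp_minus field_simps exp_diff)
      have c1: "(\<integral>\<omega>. indicator (A j) (X j \<omega>) * cos (S \<omega>) \<partial>M) = \<phi> * measure std_normal (A j)"
      proof (rule weighted_law_std_normal[OF Xj _ Aj cfj])
        show "(\<integral>\<omega>. iexp (u * X j \<omega>) * complex_of_real (cos (S \<omega>)) \<partial>M)
            = complex_of_real (\<phi> * exp (- u\<^sup>2 / 2))" for u
          unfolding co using gaussian_square_integrable[of u 1] gaussian_square_integrable[of u "-1"] two[of 1 u] two[of "-1" u]
          by (simp add: mult.commute)
        show "- 1 < \<phi>" unfolding \<phi>_def by (rule less_trans[OF _ exp_gt_zero]) simp
      qed auto
      have c2: "(\<integral>\<omega>. indicator (A j) (X j \<omega>) * sin (S \<omega>) \<partial>M) = 0 * measure std_normal (A j)"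
      proof (rule weighted_law_std_normal[OF Xj _ Aj cfj])
        show "(\<integral>\<omega>. iexp (u * X j \<omega>) * complex_of_real (sin (S \<omega>)) \<partial>M)
            = complex_of_real (0 * exp (- u\<^sup>2 / 2))" for u
          unfolding si using gaussian_square_integrable[of u 1] gaussian_square_integrable[of u "-1"] two[of 1 u] two[of "-1" u]
          by simp
      qed auto
      have ind: "\<omega> \<in> space M \<Longrightarrow> (indicator E \<omega> :: real) = indicator (A j) (X j \<omega>)" for \<omega>
        by (auto simp: E_def indicator_def)
      show ?thesis
        using c1 c2 by (simp add: ind \<phi>_def cong: Bochner_Integration.integral_cong)
    qed
    have split: "{\<omega>\<in>space M. \<forall>i\<in>insert j I. X i \<omega> \<in> A i} = E \<inter> {\<omega>\<in>space M. \<forall>i\<in>I. X i \<omega> \<in> A i}"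
      by (auto simp: E_def)
    define F where "F = {\<omega>\<in>space M. \<forall>i\<in>I. X i \<omega> \<in> A i}"
    have F[measurable]: "F \<in> sets M"
    proof -
      have "{\<omega>\<in>space M. X i \<omega> \<in> A i} \<in> sets M" if "i \<in> I" for i
        using that insert.prems(2)[of i] Xm[of i] by (auto intro: measurable_sets_Collect)
      then show ?thesis unfolding F_def using insert.hyps by (intro sets.sets_Collect_finite_All) auto
    qed
    show ?case
    proof (cases "measure M E = 0")
      \<comment> \<open>Conditioning on a null event is undefined; here both sides of the claim
        vanish.\<close>
      case True
      then have "measure M (E \<inter> F) = 0"
        by (metis E F Int_lower1 finite_measure_mono measure_nonneg order_antisym)
      then show ?thesis using split True PE insert.hyps by (simp add: F_def)
    next
      case False
      define M' where "M' = uniform_measure M E"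
      have nz: "emeasure M E \<noteq> 0" "emeasure M E \<noteq> \<infinity>"
        using False by (auto simp: emeasure_eq_measure)
      have ps: "prob_space M'" unfolding M'_def by (rule prob_space_uniform_measure[OF nz])
      have int_M': "(\<integral>\<omega>. f \<omega> \<partial>M') = (\<integral>\<omega>. (indicator E \<omega> / measure M E) *\<^sub>R f \<omega> \<partial>M)"
        if [measurable]: "f \<in> borel_measurable M" for f :: "_ \<Rightarrow> complex"
      proof -
        have "(\<lambda>x. indicator E x / emeasure M E) = (\<lambda>x. ennreal (indicator E x / measure M E))"
          using False by (auto simp: fun_eq_iff emeasure_eq_measure indicator_def ennreal_1[symmetric]
              divide_ennreal zero_less_measure_iff simp del: ennreal_1)
        then have "M' = density M (\<lambda>x. ennreal (indicator E x / measure M E))"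
          by (simp add: M'_def uniform_measure_def)
        then show ?thesis by (simp add: integral_density)
      qed
      \<comment> \<open>The induction is over arbitrary measures, so its hypothesis can be applied
        to the conditional law given \<open>E\<close>.\<close>
      have "std_gaussian M' I X"
        unfolding std_gaussian_def
      proof (intro conjI allI ballI ps insert.hyps)
        fix t
        define S where "S = (\<lambda>\<omega>. \<Sum>i\<in>I. t i * X i \<omega>)"
        have Sm[measurable]: "S \<in> borel_measurable M" unfolding S_def by measurable
        have ic: "integrable M (\<lambda>\<omega>. indicator E \<omega> * cos (S \<omega>))" "integrable M (\<lambda>\<omega>. indicator E \<omega> * sin (S \<omega>))"
          by (rule integrable_bounded[where B=1]; auto simp: indicator_def)+
        have "(\<integral>\<omega>. iexp (S \<omega>) \<partial>M') = (\<integral>\<omega>. (indicator E \<omega> / measure M E) *\<^sub>R iexp (S \<omega>) \<partial>M)"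
          by (rule int_M') measurable
        also have "\<dots> = (\<integral>\<omega>. (complex_of_real (indicator E \<omega> * cos (S \<omega>)) +
             \<i> * complex_of_real (indicator E \<omega> * sin (S \<omega>))) / complex_of_real (measure M E) \<partial>M)"
          by (intro Bochner_Integration.integral_cong refl)
             (simp add: scaleR_conv_of_real cis_conv_exp[symmetric] cis.code complex_eq_iff)
        also have "\<dots> = (complex_of_real (\<integral>\<omega>. indicator E \<omega> * cos (S \<omega>) \<partial>M) +
             \<i> * complex_of_real (\<integral>\<omega>. indicator E \<omega> * sin (S \<omega>) \<partial>M)) / complex_of_real (measure M E)"
          using ic by (subst integral_divide_zero, subst Bochner_Integration.integral_add)
             (simp_all add: complex_of_real_integrable_eq del: of_real_mult)
        also have "\<dots> = complex_of_real (exp (- (\<Sum>i\<in>I. (t i)\<^sup>2) / 2))"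
          using key[OF S_def] False PE by simp
        finally show "(\<integral>\<omega>. iexp (\<Sum>i\<in>I. t i * X i \<omega>) \<partial>M') = complex_of_real (exp (- (\<Sum>i\<in>I. (t i)\<^sup>2) / 2))"
          by (simp add: S_def)
      next
        fix i assume "i \<in> I" then show "X i \<in> borel_measurable M'"
          using Xm[of i] by (simp add: M'_def)
      qed
      from insert.IH[OF this] have IH: "measure M' F = (\<Prod>i\<in>I. measure std_normal (A i))"
        using insert.prems(2) by (simp add: M'_def F_def)
      have "measure M' F = measure M (E \<inter> F) / measure M E"
        unfolding M'_def using nz by (subst measure_uniform_measure) auto
      then have "measure M (E \<inter> F) = measure M E * (\<Prod>i\<in>I. measure std_normal (A i))"
        using IH False by (simp add: field_simps)
      then show ?thesis using split PE insert.hyps by (simp add: F_def)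
    qed
  qed
qed

interpretation std_normal_product: product_prob_space "\<lambda>_. std_normal" UNIV
  by unfold_locales

text \<open>Boxes determine a measure on a finite product, so the box probabilities already give the
  joint law and, with it, independence.\<close>

lemma std_gaussian_law:
  assumes "std_gaussian M I X"
  shows "distr M (PiM I (\<lambda>_. borel)) (\<lambda>\<omega>. \<lambda>i\<in>I. X i \<omega>) = PiM I (\<lambda>_. std_normal)"
proof (rule std_normal_product.PiM_eqI)
  interpret prob_space M using assms by (simp add: std_gaussian_def)
  show fin: "finite I" using assms by (simp add: std_gaussian_def)
  have Xm[measurable]: "\<And>i. i \<in> I \<Longrightarrow> X i \<in> borel_measurable M"
      using assms by (simp add: std_gaussian_def)
  show "sets (distr M (PiM I (\<lambda>_. borel)) (\<lambda>\<omega>. \<lambda>i\<in>I. X i \<omega>)) = sets (PiM I (\<lambda>_. std_normal))"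
    by (simp cong: sets_PiM_cong)
  fix A assume A: "\<And>i. i \<in> I \<Longrightarrow> A i \<in> sets std_normal"
  have m: "(\<lambda>\<omega>. \<lambda>i\<in>I. X i \<omega>) \<in> M \<rightarrow>\<^sub>M PiM I (\<lambda>_. borel)" by measurable
  have "emeasure (distr M (PiM I (\<lambda>_. borel)) (\<lambda>\<omega>. \<lambda>i\<in>I. X i \<omega>)) (Pi\<^sub>E I A)
     = emeasure M {\<omega>\<in>space M. \<forall>i\<in>I. X i \<omega> \<in> A i}"
    using A fin by (subst emeasure_distr[OF m]) (auto intro!: sets_PiM_I_finite arg_cong2[where f=emeasure] split: if_splits)
  also have "\<dots> = ennreal (\<Prod>i\<in>I. measure std_normal (A i))"
    using std_gaussian_prob_box[OF assms, of A] A by (simp add: emeasure_eq_measure)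
  also have "\<dots> = (\<Prod>i\<in>I. emeasure std_normal (A i))"
    by (simp add: std_normal.emeasure_eq_measure prod_ennreal)
  finally show "emeasure (distr M (PiM I (\<lambda>_. borel)) (\<lambda>\<omega>. \<lambda>i\<in>I. X i \<omega>)) (Pi\<^sub>E I A) = (\<Prod>i\<in>I. emeasure std_normal (A i))" .
qed

section \<open>Orthogonalisation\<close>

text \<open>Vectors of length \<open>n\<close> are functions on all of \<open>nat\<close> whose
  entries from \<open>n\<close> on are ignored, which is why many facts below hold only for indices
  below \<open>n\<close>.\<close>

definition ip :: "nat \<Rightarrow> (nat \<Rightarrow> real) \<Rightarrow> (nat \<Rightarrow> real) \<Rightarrow> real" where
  "ip n u v = (\<Sum>i<n. u i * v i)"

lemma ip_commute: "ip n u v = ip n v u"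
  by (simp add: ip_def mult.commute)

lemma ip_cong: "(\<And>i. i < n \<Longrightarrow> u i = u' i) \<Longrightarrow> (\<And>i. i < n \<Longrightarrow> v i = v' i) \<Longrightarrow> ip n u v = ip n u' v'"
  by (simp add: ip_def)

lemma ip_add: "ip n u (\<lambda>i. v i + w i) = ip n u v + ip n u w"
  by (simp add: ip_def distrib_left sum.distrib)

lemma ip_diff: "ip n u (\<lambda>i. v i - w i) = ip n u v - ip n u w"
  by (simp add: ip_def right_diff_distrib sum_subtractf)

lemma ip_scale: "ip n u (\<lambda>i. c * v i) = c * ip n u v"
  by (simp add: ip_def sum_distrib_left mult_ac)

lemma ip_sum: "ip n u (\<lambda>i. \<Sum>a\<in>A. c a * v a i) = (\<Sum>a\<in>A. c a * ip n u (v a))"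
  unfolding ip_def sum_distrib_left by (subst sum.swap) (simp add: mult_ac)

lemma ip_self_nonneg: "0 \<le> ip n u u"
  by (simp add: ip_def sum_nonneg)

lemma ip_self_eq_0: "ip n u u = 0 \<longleftrightarrow> (\<forall>i<n. u i = 0)"
  unfolding ip_def by (subst sum_nonneg_eq_0_iff) auto

lemma ip_zero: "(\<And>i. i < n \<Longrightarrow> u i = 0) \<Longrightarrow> ip n u v = 0"
  by (simp add: ip_def)

lemma ip_self_sum:
  assumes "finite A" "\<And>a b. a \<in> A \<Longrightarrow> b \<in> A \<Longrightarrow> a \<noteq> b \<Longrightarrow> ip n (v a) (v b) = 0"
  shows "ip n (\<lambda>i. \<Sum>a\<in>A. c a * v a i) (\<lambda>i. \<Sum>a\<in>A. c a * v a i) = (\<Sum>a\<in>A. (c a)\<^sup>2 * ip n (v a) (v a))"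
proof -
  have "ip n (\<lambda>i. \<Sum>a\<in>A. c a * v a i) (\<lambda>i. \<Sum>a\<in>A. c a * v a i)
      = (\<Sum>a\<in>A. c a * (\<Sum>b\<in>A. c b * ip n (v a) (v b)))"
    by (subst ip_sum, subst ip_commute) (simp add: ip_sum ip_commute)
  also have "\<dots> = (\<Sum>a\<in>A. c a * (c a * ip n (v a) (v a)))"
  proof (intro sum.cong refl)
    fix a assume a: "a \<in> A"
    have "(\<Sum>b\<in>A. c b * ip n (v a) (v b)) = (\<Sum>b\<in>{a}. c b * ip n (v a) (v b))"
      by (rule sum.mono_neutral_right) (use assms a in auto)
    then show "c a * (\<Sum>b\<in>A. c b * ip n (v a) (v b)) = c a * (c a * ip n (v a) (v a))" by simp
  qed
  finally show ?thesis by (simp add: power2_eq_square mult_ac)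
qed

lemma sum_lessThan_of_bool: "(\<Sum>l<j::nat. f l * of_bool (l = m)) = (if m < j then f m else (0::real))"
proof -
  have "(\<Sum>l<j. f l * of_bool (l = m)) = (\<Sum>l<j. if l = m then f l else 0)"
    by (intro sum.cong) auto
  then show ?thesis by (simp add: sum.delta cong: sum.cong_simp)
qed

text \<open>Where the previous residual vanishes, \<open>x / 0 = 0\<close> makes the step skip it.\<close>

function gram_schmidt :: "nat \<Rightarrow> (nat \<Rightarrow> nat \<Rightarrow> real) \<Rightarrow> nat \<Rightarrow> nat \<Rightarrow> real" where
  "gram_schmidt n Z j = (\<lambda>i. Z j i -
     (\<Sum>l<j. ip n (gram_schmidt n Z l) (Z j) / ip n (gram_schmidt n Z l) (gram_schmidt n Z l)
        * gram_schmidt n Z l i))"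
  by pat_completeness auto
termination by (relation "Wellfounded.measure (\<lambda>(n, Z, j). j)") auto

declare gram_schmidt.simps [simp del]

definition gs_coeff :: "nat \<Rightarrow> (nat \<Rightarrow> nat \<Rightarrow> real) \<Rightarrow> nat \<Rightarrow> nat \<Rightarrow> real" where
  "gs_coeff n Z j l = ip n (gram_schmidt n Z l) (Z j) / ip n (gram_schmidt n Z l) (gram_schmidt n Z l)"

lemma gram_schmidt_eq:
  "gram_schmidt n Z j = (\<lambda>i. Z j i - (\<Sum>l<j. gs_coeff n Z j l * gram_schmidt n Z l i))"
  by (subst gram_schmidt.simps) (simp add: gs_coeff_def)

lemma gram_schmidt_cong:
  "(\<And>l i. l \<le> j \<Longrightarrow> i < n \<Longrightarrow> Z l i = Z' l i) \<Longrightarrow> i < n \<Longrightarrow> gram_schmidt n Z j i = gram_schmidt n Z' j i"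
proof (induction j arbitrary: i rule: less_induct)
  case (less j)
  have *: "gram_schmidt n Z l i = gram_schmidt n Z' l i" if "l < j" "i < n" for l i
    using less.IH[OF that(1), of i] less.prems that by auto
  have "gs_coeff n Z j l = gs_coeff n Z' j l" if "l < j" for l
    unfolding gs_coeff_def using less.prems(1) *[OF that] by (auto intro!: arg_cong2[where f="(/)"] ip_cong)
  then show ?case using less.prems * by (simp add: gram_schmidt_eq[of n _ j])
qed

text \<open>A residual of norm zero vanishes below \<open>n\<close>, so both sides are then zero.
  Orthogonality therefore holds for every array, whatever its rank.\<close>

lemma gs_coeff_self: "gs_coeff n Z j l * ip n (gram_schmidt n Z l) (gram_schmidt n Z l) = ip n (gram_schmidt n Z l) (Z j)"
proof (cases "ip n (gram_schmidt n Z l) (gram_schmidt n Z l) = 0")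
  case True
  then have "ip n (gram_schmidt n Z l) (Z j) = 0" by (intro ip_zero) (simp add: ip_self_eq_0)
  then show ?thesis using True by simp
qed (simp add: gs_coeff_def)

lemma gram_schmidt_orthogonal_less:
  "l < j \<Longrightarrow> ip n (gram_schmidt n Z l) (gram_schmidt n Z j) = 0"
proof (induction j arbitrary: l rule: less_induct)
  case (less j)
  have o: "ip n (gram_schmidt n Z l) (gram_schmidt n Z m) = 0" if "m < j" "m \<noteq> l" for m
    using less.IH[of m l] less.IH[of l m] that less.prems ip_commute by (cases "l < m") auto
  have "ip n (gram_schmidt n Z l) (gram_schmidt n Z j)
      = ip n (gram_schmidt n Z l) (Z j) - (\<Sum>m<j. gs_coeff n Z j m * ip n (gram_schmidt n Z l) (gram_schmidt n Z m))"
    by (simp add: gram_schmidt_eq[of n Z j] ip_diff ip_sum)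
  also have "(\<Sum>m<j. gs_coeff n Z j m * ip n (gram_schmidt n Z l) (gram_schmidt n Z m))
     = (\<Sum>m\<in>{l}. gs_coeff n Z j m * ip n (gram_schmidt n Z l) (gram_schmidt n Z m))"
    by (rule sum.mono_neutral_right) (use less.prems o in auto)
  finally show ?case by (simp add: gs_coeff_self)
qed

lemma gram_schmidt_orthogonal:
  "l \<noteq> j \<Longrightarrow> ip n (gram_schmidt n Z l) (gram_schmidt n Z j) = 0"
  using gram_schmidt_orthogonal_less[of l j n Z] gram_schmidt_orthogonal_less[of j l n Z]
  by (metis ip_commute nat_neq_iff)

lemma gram_schmidt_ip_column:
  "j < l \<Longrightarrow> ip n (gram_schmidt n Z l) (Z j) = 0"
  "ip n (gram_schmidt n Z l) (Z l) = ip n (gram_schmidt n Z l) (gram_schmidt n Z l)"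
proof -
  have Z: "Z j = (\<lambda>i. gram_schmidt n Z j i + (\<Sum>m<j. gs_coeff n Z j m * gram_schmidt n Z m i))" for j
    by (simp add: gram_schmidt_eq[of n Z j])
  have e: "ip n (gram_schmidt n Z l) (Z j) = ip n (gram_schmidt n Z l) (gram_schmidt n Z j)
     + (\<Sum>m<j. gs_coeff n Z j m * ip n (gram_schmidt n Z l) (gram_schmidt n Z m))" for j
    by (subst Z) (simp add: ip_add ip_sum)
  show "j < l \<Longrightarrow> ip n (gram_schmidt n Z l) (Z j) = 0"
    by (simp add: e gram_schmidt_orthogonal)
  show "ip n (gram_schmidt n Z l) (Z l) = ip n (gram_schmidt n Z l) (gram_schmidt n Z l)"
    by (simp add: e gram_schmidt_orthogonal)
qed

text \<open>Expressed in the raw earlier columns, the Gram-Schmidt residual is itself the residual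
  of some coefficient vector, hence a competitor in the least-squares problem.\<close>

lemma gram_schmidt_span:
  "\<exists>a. \<forall>i. gram_schmidt n Z j i = Z j i - (\<Sum>l<j. a l * Z l i)"
proof (induction j rule: less_induct)
  case (less j)
  then have "\<forall>l. \<exists>a. l < j \<longrightarrow> (\<forall>i. gram_schmidt n Z l i = Z l i - (\<Sum>m<l. a m * Z m i))"
    by blast
  then obtain a where a: "\<And>l i. l < j \<Longrightarrow> gram_schmidt n Z l i = Z l i - (\<Sum>m<l. a l m * Z m i)"
    by metis
  define c where "c m = gs_coeff n Z j m - (\<Sum>l<j. if m < l then gs_coeff n Z j l * a l m else 0)" for m
  have "(\<Sum>l<j. gs_coeff n Z j l * gram_schmidt n Z l i) = (\<Sum>l<j. c l * Z l i)" for i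
  proof -
    have "(\<Sum>l<j. gs_coeff n Z j l * gram_schmidt n Z l i)
        = (\<Sum>l<j. gs_coeff n Z j l * Z l i) - (\<Sum>l<j. \<Sum>m<l. gs_coeff n Z j l * a l m * Z m i)"
      by (simp add: a right_diff_distrib sum_subtractf sum_distrib_left mult_ac)
    also have "(\<Sum>l<j. \<Sum>m<l. gs_coeff n Z j l * a l m * Z m i)
        = (\<Sum>l<j. \<Sum>m<j. if m < l then gs_coeff n Z j l * a l m * Z m i else 0)"
      by (intro sum.cong refl sum.mono_neutral_cong_left) auto
    also have "\<dots> = (\<Sum>m<j. (\<Sum>l<j. if m < l then gs_coeff n Z j l * a l m else 0) * Z m i)"
      by (subst sum.swap) (auto simp: sum_distrib_right intro!: sum.cong)
    finally show ?thesis by (simp add: c_def left_diff_distrib sum_subtractf)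
  qed
  then show ?case by (intro exI[of _ c]) (simp add: gram_schmidt_eq[of n Z j])
qed

section \<open>Least squares expressed through Gram-Schmidt residuals\<close>

definition ls_residual :: "(nat \<Rightarrow> nat \<Rightarrow> real) \<Rightarrow> nat \<Rightarrow> (nat \<Rightarrow> real) \<Rightarrow> nat \<Rightarrow> real" where
  "ls_residual Z k T = (\<lambda>i. Z k i - (\<Sum>j<k. T j * Z j i))"

abbreviation ls_rss :: "nat \<Rightarrow> (nat \<Rightarrow> nat \<Rightarrow> real) \<Rightarrow> nat \<Rightarrow> (nat \<Rightarrow> real) \<Rightarrow> real" where
  "ls_rss n Z k T \<equiv> ip n (ls_residual Z k T) (ls_residual Z k T)"

text \<open>Pythagoras: any residual is the Gram-Schmidt residual plus an orthogonal part
  \<open>p\<close> in the span of the earlier ones. Minimality forces \<open>p\<close> to vanish.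
  The minimizer may be non-unique, but its residual is not.\<close>

lemma least_squares_residual:
  assumes min: "\<And>b. ls_rss n Z k T \<le> ls_rss n Z k b"
  shows "ls_rss n Z k T = ip n (gram_schmidt n Z k) (gram_schmidt n Z k)"
    and "i < n \<Longrightarrow> ls_residual Z k T i = gram_schmidt n Z k i"
proof -
  let ?g = "gram_schmidt n Z"
  \<comment> \<open>Coefficients of \<open>p\<close> in the orthogonal system: those of column
    \<open>k\<close> minus those of the fitted combination. The inner conditional encodes that
    column \<open>j\<close> has coefficient one on its own residual and none on later ones.\<close>
  define d where "d l = gs_coeff n Z k l - (\<Sum>j<k. T j * (if l = j then 1 else if l < j then gs_coeff n Z j l else 0))" for l
  define p where "p i = (\<Sum>l<k. d l * ?g l i)" for i
  have Z: "Z j i = ?g j i + (\<Sum>m<j. gs_coeff n Z j m * ?g m i)" for j i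
    by (simp add: gram_schmidt_eq[of n Z j])
  have r: "ls_residual Z k T = (\<lambda>i. ?g k i + p i)"
  proof
    fix i
    have "(\<Sum>j<k. T j * Z j i)
        = (\<Sum>j<k. \<Sum>l<k. T j * (if l = j then 1 else if l < j then gs_coeff n Z j l else 0) * ?g l i)"
    proof (intro sum.cong refl)
      fix j assume j: "j \<in> {..<k}"
      have "(\<Sum>l<k. (if l = j then 1 else if l < j then gs_coeff n Z j l else 0) * ?g l i)
          = (\<Sum>l\<in>insert j {..<j}. (if l = j then 1 else if l < j then gs_coeff n Z j l else 0) * ?g l i)"
        by (rule sum.mono_neutral_right) (use j in auto)
      also have "\<dots> = Z j i" by (subst Z) simp
      finally have "T j * Z j i = T j * (\<Sum>l<k. (if l = j then 1 else if l < j then gs_coeff n Z j l else 0) * ?g l i)"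
        by simp
      also have "\<dots> = (\<Sum>l<k. T j * (if l = j then 1 else if l < j then gs_coeff n Z j l else 0) * ?g l i)"
        unfolding sum_distrib_left mult.assoc ..
      finally show "T j * Z j i = (\<Sum>l<k. T j * (if l = j then 1 else if l < j then gs_coeff n Z j l else 0) * ?g l i)" .
    qed
    also have "\<dots> = (\<Sum>l<k. (\<Sum>j<k. T j * (if l = j then 1 else if l < j then gs_coeff n Z j l else 0)) * ?g l i)"
      by (subst sum.swap) (simp add: sum_distrib_right)
    finally show "ls_residual Z k T i = ?g k i + p i"
      unfolding ls_residual_def p_def d_def by (subst Z[of k]) (simp add: left_diff_distrib sum_subtractf)
  qed
  have gp: "ip n (?g k) p = 0"
    unfolding p_def by (simp add: ip_sum gram_schmidt_orthogonal)
  have e: "ls_rss n Z k T = ip n (?g k) (?g k) + ip n p p"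
  proof -
    have "ip n (\<lambda>i. ?g k i + p i) (?g k) = ip n (?g k) (?g k)" "ip n (\<lambda>i. ?g k i + p i) p = ip n p p"
      using gp ip_commute[of n p "?g k"] by (subst ip_commute, simp add: ip_add)+
    then show ?thesis unfolding r by (simp add: ip_add)
  qed
  obtain a where "\<And>i. ?g k i = Z k i - (\<Sum>l<k. a l * Z l i)"
    using gram_schmidt_span[of n Z k] by blast
  then have "ls_residual Z k a = ?g k" by (simp add: ls_residual_def fun_eq_iff)
  then have "ip n p p \<le> 0" using min[of a] e by simp
  then have p0: "ip n p p = 0" using ip_self_nonneg[of n p] by simp
  then show "ls_rss n Z k T = ip n (?g k) (?g k)" using e by simp
  show "i < n \<Longrightarrow> ls_residual Z k T i = ?g k i" using p0 r by (simp add: ip_self_eq_0)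
qed

text \<open>The last regressor's residual is orthogonal to all other regressors, so pairing it with
  the fitted residual isolates \<open>T k\<close>. No other coefficient has such a short
  formula.\<close>

lemma least_squares_last_coeff:
  assumes min: "\<And>b. ls_rss n Z (Suc k) T
                   \<le> ls_rss n Z (Suc k) b"
    and nz: "ip n (gram_schmidt n Z k) (gram_schmidt n Z k) \<noteq> 0"
  shows "T k = ip n (gram_schmidt n Z k) (Z (Suc k)) / ip n (gram_schmidt n Z k) (gram_schmidt n Z k)"
proof -
  let ?g = "gram_schmidt n Z"
  have "ip n (?g k) (ls_residual Z (Suc k) T) = ip n (?g k) (?g (Suc k))"
    by (rule ip_cong) (auto simp: least_squares_residual(2)[OF min])
  also have "\<dots> = 0" by (rule gram_schmidt_orthogonal) simp
  also have "ip n (?g k) (ls_residual Z (Suc k) T)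
      = ip n (?g k) (Z (Suc k)) - (\<Sum>j<Suc k. T j * ip n (?g k) (Z j))"
    unfolding ls_residual_def by (simp add: ip_diff ip_sum del: sum.lessThan_Suc)
  also have "(\<Sum>j<Suc k. T j * ip n (?g k) (Z j)) = T k * ip n (?g k) (?g k)"
    by (simp add: gram_schmidt_ip_column)
  finally show ?thesis using nz by (simp add: field_simps)
qed

section \<open>Orthonormal systems in finite dimension\<close>

lemma bessel:
  fixes q :: "nat \<Rightarrow> nat \<Rightarrow> real"
  assumes o: "\<And>a b. a < k \<Longrightarrow> b < k \<Longrightarrow> ip n (q a) (q b) = of_bool (a = b)" and i: "i < n"
  shows "ip n (\<lambda>j. of_bool (j = i) - (\<Sum>a<k. q a i * q a j)) (\<lambda>j. of_bool (j = i) - (\<Sum>a<k. q a i * q a j))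
           = 1 - (\<Sum>a<k. (q a i)\<^sup>2)"
proof -
  let ?p = "\<lambda>j. \<Sum>a<k. q a i * q a j" and ?e = "\<lambda>j. of_bool (j = i) :: real"
  have e: "ip n v ?e = v i" for v
    using i by (simp add: ip_def sum_lessThan_of_bool)
  have pp: "ip n ?p ?p = (\<Sum>a<k. (q a i)\<^sup>2)"
    by (subst ip_self_sum) (auto simp: o)
  have "ip n (\<lambda>j. ?e j - ?p j) (\<lambda>j. ?e j - ?p j) = ip n ?e ?e - 2 * ip n ?p ?e + ip n ?p ?p"
    by (simp add: ip_diff ip_commute[of n "\<lambda>j. ?e j - ?p j"] ip_commute[of n ?e ?p])
  also have "\<dots> = 1 - 2 * ?p i + (\<Sum>a<k. (q a i)\<^sup>2)" unfolding pp e by simp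
  finally show ?thesis by (simp add: power2_eq_square)
qed

text \<open>By counting: the squared projections of the \<open>n\<close> unit vectors onto the span
  add up to \<open>k < n\<close>, so one unit vector has a projection shorter than one. Its
  normalised remainder is the new vector.\<close>

lemma orthonormal_extend:
  fixes q :: "nat \<Rightarrow> nat \<Rightarrow> real"
  assumes o: "\<And>a b. a < k \<Longrightarrow> b < k \<Longrightarrow> ip n (q a) (q b) = of_bool (a = b)" and kn: "k < n"
  shows "\<exists>v. ip n v v = 1 \<and> (\<forall>a<k. ip n (q a) v = 0)"
proof -
  have "(\<Sum>i<n. \<Sum>a<k. (q a i)\<^sup>2) = (\<Sum>a<k. ip n (q a) (q a))"
    unfolding ip_def by (subst sum.swap) (simp add: power2_eq_square)
  also have "\<dots> = real k" by (simp add: o)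
  finally have s: "(\<Sum>i<n. \<Sum>a<k. (q a i)\<^sup>2) = real k" .
  have "\<exists>i<n. (\<Sum>a<k. (q a i)\<^sup>2) < 1"
  proof (rule ccontr)
    assume a: "\<not> ?thesis"
    have "(\<Sum>i<n. 1) \<le> (\<Sum>i<n. \<Sum>a<k. (q a i)\<^sup>2)"
    proof (rule sum_mono)
      fix i assume "i \<in> {..<n}"
      then show "1 \<le> (\<Sum>a<k. (q a i)\<^sup>2)" using a by (metis lessThan_iff not_less)
    qed
    then show False using s kn by simp
  qed
  then obtain i where i: "i < n" "(\<Sum>a<k. (q a i)\<^sup>2) < 1" by blast
  define r where "r = (\<lambda>j. of_bool (j = i) - (\<Sum>a<k. q a i * q a j))"
  define s where "s = sqrt (ip n r r)"
  have "0 < ip n r r" unfolding r_def using bessel[OF o i(1)] i(2) by simp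
  then have s: "0 < s" "s * s = ip n r r" by (simp_all add: s_def)
  have "ip n (q a) r = 0" if "a < k" for a
  proof -
    have "ip n (q a) (\<lambda>j. of_bool (j = i)) = q a i" using i(1) by (simp add: ip_def sum_lessThan_of_bool)
    moreover have "(\<Sum>b<k. q b i * ip n (q a) (q b)) = q a i"
      using that by (simp add: o sum_lessThan_of_bool eq_commute[of a])
    ultimately show ?thesis unfolding r_def by (simp add: ip_diff ip_sum)
  qed
  moreover have "ip n (\<lambda>j. 1 / s * r j) (\<lambda>j. 1 / s * r j) = 1 / s * (1 / s * (s * s))"
    unfolding s(2) ip_scale by (subst ip_commute) (simp only: ip_scale)
  ultimately show ?thesis using s(1)
    by (intro exI[of _ "\<lambda>j. 1 / s * r j"] conjI allI impI) (simp_all only: ip_scale, simp_all)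
qed

lemma orthonormal_basis:
  fixes q :: "nat \<Rightarrow> nat \<Rightarrow> real"
  assumes "\<And>a b. a < k \<Longrightarrow> b < k \<Longrightarrow> ip n (q a) (q b) = of_bool (a = b)" "k \<le> n"
  shows "\<exists>q'. (\<forall>a<k. q' a = q a) \<and> (\<forall>a<n. \<forall>b<n. ip n (q' a) (q' b) = of_bool (a = b))"
  using assms
proof (induction "n - k" arbitrary: k q)
  case 0
  then show ?case by (intro exI[of _ q]) auto
next
  case (Suc d)
  then have kn: "k < n" by simp
  obtain v where v: "ip n v v = 1" "\<forall>a<k. ip n (q a) v = 0"
    using orthonormal_extend[OF Suc.prems(1) kn] by blast
  have o: "ip n ((q(k := v)) a) ((q(k := v)) b) = of_bool (a = b)" if "a < Suc k" "b < Suc k" for a b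
  proof -
    have "ip n v (q b) = 0" if "b < k" for b using v(2) that by (subst ip_commute) simp
    then show ?thesis using that v Suc.prems(1)[of a b] by (auto simp: less_Suc_eq)
  qed
  obtain q' where "\<forall>a<Suc k. q' a = (q(k := v)) a" "\<forall>a<n. \<forall>b<n. ip n (q' a) (q' b) = of_bool (a = b)"
  proof -
    have "d = n - Suc k" "Suc k \<le> n" using Suc.hyps(2) kn by simp_all
    from Suc.hyps(1)[OF this(1) o this(2)] show ?thesis using that by blast
  qed
  then show ?case by (intro exI[of _ q']) auto
qed

text \<open>Each unit vector has squared projection at most one by Bessel, while the total is
  \<open>n\<close>; so every one of them lies in the span. This yields the dual relation
  \<open>e\<close>, from which the identity follows by interchanging sums.\<close>

lemma parseval:
  fixes q :: "nat \<Rightarrow> nat \<Rightarrow> real"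
  assumes o: "\<And>a b. a < n \<Longrightarrow> b < n \<Longrightarrow> ip n (q a) (q b) = of_bool (a = b)"
  shows "ip n w w = (\<Sum>a<n. (ip n (q a) w)\<^sup>2)"
proof -
  have le: "(\<Sum>a<n. (q a i)\<^sup>2) \<le> 1" if "i < n" for i
    using bessel[OF o that] ip_self_nonneg[of n "\<lambda>j. of_bool (j = i) - (\<Sum>a<n. q a i * q a j)"] by simp
  have "(\<Sum>i<n. \<Sum>a<n. (q a i)\<^sup>2) = (\<Sum>a<n. ip n (q a) (q a))"
    unfolding ip_def by (subst sum.swap) (simp add: power2_eq_square)
  then have "(\<Sum>i<n. 1 - (\<Sum>a<n. (q a i)\<^sup>2)) = 0" by (simp add: o sum_subtractf)
  then have eq: "(\<Sum>a<n. (q a i)\<^sup>2) = 1" if "i < n" for i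
    using le that by (subst (asm) sum_nonneg_eq_0_iff) auto
  have e: "of_bool (j = i) = (\<Sum>a<n. q a i * q a j)" if "i < n" "j < n" for i j
  proof -
    have "ip n (\<lambda>j. of_bool (j = i) - (\<Sum>a<n. q a i * q a j)) (\<lambda>j. of_bool (j = i) - (\<Sum>a<n. q a i * q a j)) = 0"
      using bessel[of n n q, OF o that(1)] eq[OF that(1)] by simp
    then show ?thesis using that(2) unfolding ip_self_eq_0 by (metis eq_iff_diff_eq_0)
  qed
  have "(\<Sum>a<n. (ip n (q a) w)\<^sup>2) = (\<Sum>a<n. \<Sum>i<n. \<Sum>j<n. w i * w j * (q a i * q a j))"
    unfolding ip_def power2_eq_square sum_product by (simp add: mult_ac)
  also have "\<dots> = (\<Sum>i<n. \<Sum>j<n. \<Sum>a<n. w i * w j * (q a i * q a j))"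
    by (subst sum.swap) (intro sum.cong refl sum.swap)
  also have "\<dots> = (\<Sum>i<n. \<Sum>j<n. w i * w j * of_bool (j = i))"
    by (intro sum.cong refl) (simp add: e sum_distrib_left)
  also have "\<dots> = ip n w w"
    unfolding ip_def by (intro sum.cong refl) (simp add: sum_lessThan_of_bool)
  finally show ?thesis by simp
qed

text \<open>The basis \<open>q\<close> is built from the first \<open>k\<close> columns only, before
  \<open>w\<close> is chosen. With those columns fixed, the squared residual norm of a fresh column
  is thus a sum of squares of \<open>n - k\<close> fixed orthonormal functionals.\<close>

lemma gram_schmidt_norm_parseval:
  assumes nz: "\<And>l. l < k \<Longrightarrow> ip n (gram_schmidt n Z l) (gram_schmidt n Z l) \<noteq> 0" and kn: "k \<le> n"
  shows "\<exists>q. (\<forall>a<n. \<forall>b<n. ip n (q a) (q b) = of_bool (a = b)) \<and>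
    (\<forall>w. ip n (gram_schmidt n (Z(k := w)) k) (gram_schmidt n (Z(k := w)) k) = (\<Sum>a=k..<n. (ip n (q a) w)\<^sup>2))"
proof -
  let ?g = "gram_schmidt n Z"
  define s where "s l = sqrt (ip n (?g l) (?g l))" for l
  have s: "0 < s l" "s l * s l = ip n (?g l) (?g l)" if "l < k" for l
    using nz[OF that] ip_self_nonneg[of n "?g l"] by (auto simp: s_def)
  have sc: "ip n (\<lambda>i. c * u i) (\<lambda>i. d * v i) = c * d * ip n u v" for c d u v
    by (simp add: ip_scale) (subst ip_commute, simp add: ip_scale ip_commute)
  have "ip n (\<lambda>i. 1 / s a * ?g a i) (\<lambda>i. 1 / s b * ?g b i) = of_bool (a = b)" if "a < k" "b < k" for a b
    unfolding sc using gram_schmidt_orthogonal[of a b n Z] by (cases "a = b") (use s[OF that(1)] in \<open>auto simp flip: s(2)[OF that(1)]\<close>)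
  from orthonormal_basis[of k n "\<lambda>a i. 1 / s a * ?g a i", OF this kn]
  obtain q where q: "\<And>a. a < k \<Longrightarrow> q a = (\<lambda>i. 1 / s a * ?g a i)"
    "\<And>a b. a < n \<Longrightarrow> b < n \<Longrightarrow> ip n (q a) (q b) = of_bool (a = b)" by auto
  have "ip n (gram_schmidt n (Z(k := w)) k) (gram_schmidt n (Z(k := w)) k) = (\<Sum>a=k..<n. (ip n (q a) w)\<^sup>2)" for w
  proof -
    let ?Z = "Z(k := w)"
    let ?h = "gram_schmidt n ?Z"
    have gh: "?h l i = ?g l i" if "l < k" "i < n" for l i
      by (rule gram_schmidt_cong) (use that in auto)
    have lo: "ip n (q a) (?h k) = 0" if "a < k" for a
    proof -
      have "ip n (q a) (?h k) = ip n (?h k) (\<lambda>i. 1 / s a * ?h a i)"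
        by (subst ip_commute) (rule ip_cong, use gh that q(1) in auto)
      also have "\<dots> = 0" using that by (simp only: ip_scale) (simp add: gram_schmidt_orthogonal)
      finally show ?thesis .
    qed
    have hi: "ip n (q a) (?h k) = ip n (q a) w" if a: "k \<le> a" "a < n" for a
    proof -
      have "ip n (q a) (?h l) = 0" if l: "l < k" for l
      proof -
        have "ip n (q a) (?h l) = ip n (q a) (\<lambda>i. s l * q l i)"
          by (rule ip_cong) (use gh[OF l] q(1)[OF l] s(1)[OF l] in auto)
        also have "\<dots> = 0"
          unfolding ip_scale using q(2)[of a l] l a kn by simp
        finally show ?thesis .
      qed
      then show ?thesis by (subst gram_schmidt_eq) (simp add: ip_diff ip_sum)
    qed
    have "ip n (?h k) (?h k) = (\<Sum>a<n. (ip n (q a) (?h k))\<^sup>2)" by (rule parseval[OF q(2)])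
    also have "\<dots> = (\<Sum>a=k..<n. (ip n (q a) (?h k))\<^sup>2)"
      by (rule sum.mono_neutral_right) (use lo in auto)
    also have "\<dots> = (\<Sum>a=k..<n. (ip n (q a) w)\<^sup>2)" using hi by (intro sum.cong) auto
    finally show ?thesis .
  qed
  then show ?thesis using q(2) by blast
qed

lemma reflection_to_last:
  fixes h :: "nat \<Rightarrow> real"
  shows "\<exists>H. (\<forall>a\<le>k. \<forall>b\<le>k. (\<Sum>l\<le>k. H a l * H b l) = of_bool (a = b)) \<and>
             (\<forall>a\<le>k. \<forall>b\<le>k. H a b = H b a) \<and>
             (\<forall>a\<le>k. (\<Sum>l\<le>k. H a l * h l) = (if a = k then sqrt (\<Sum>l\<le>k. (h l)\<^sup>2) else 0))"
proof -
  define N where "N = sqrt (\<Sum>l\<le>k. (h l)\<^sup>2)"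
  have NN: "N * N = (\<Sum>l\<le>k. h l * h l)" unfolding N_def by (simp add: sum_nonneg power2_eq_square)
  define v where "v l = h l - (if l = k then N else 0)" for l
  define S where "S = (\<Sum>l\<le>k. v l * v l)"
  have vh: "(\<Sum>l\<le>k. v l * h l) = N * N - N * h k"
    unfolding v_def by (simp add: left_diff_distrib sum_subtractf NN if_distrib[of "\<lambda>x. x * _"] cong: if_cong)
  have "S = (\<Sum>l\<le>k. v l * h l) - N * v k"
    unfolding S_def by (subst (2) v_def) (simp add: right_diff_distrib sum_subtractf if_distrib[of "\<lambda>x. _ * x"] mult.commute cong: if_cong)
  \<comment> \<open>The vectors \<open>h\<close> and \<open>N\<close> times the last unit vector
    have equal length, so the squared norm of their difference \<open>v\<close> is twice its product
    with \<open>h\<close>. Reflecting along \<open>v\<close> therefore subtracts exactly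
    \<open>v\<close> from \<open>h\<close>.\<close>
  then have Sv: "S = 2 * (\<Sum>l\<le>k. v l * h l)"
    unfolding vh by (simp add: v_def algebra_simps)
  \<comment> \<open>the Householder reflection along \<open>v\<close>; it is the identity if \<open>v = 0\<close> because \<open>x / 0 = 0\<close>\<close>
  define H where "H a b = of_bool (a = b) - 2 * v a * v b / S" for a b
  have d: "(\<Sum>l\<le>k. of_bool (a = l) * f l) = f a" if "a \<le> k" for a and f :: "nat \<Rightarrow> real"
  proof -
    have "(\<Sum>l\<le>k. of_bool (a = l) * f l) = (\<Sum>l\<le>k. if l = a then f l else 0)"
      by (intro sum.cong) auto
    then show ?thesis using that by simp
  qed
  have z: "v l = 0" if "S = 0" "l \<le> k" for l
    using that unfolding S_def by (subst (asm) sum_nonneg_eq_0_iff) auto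
  have Hs: "(\<Sum>l\<le>k. H a l * f l) = f a - 2 * v a / S * (\<Sum>l\<le>k. v l * f l)" if "a \<le> k" for a f
    using that 
  proof -
    have "H a l * f l = of_bool (a = l) * f l - 2 * v a / S * (v l * f l)" for l
      by (simp add: H_def left_diff_distrib)
    then show ?thesis using that by (simp only: sum_subtractf d sum_distrib_left)
  qed

  show ?thesis
  proof (intro exI[of _ H] conjI allI impI)
    fix a b assume a: "a \<le> k" and b: "b \<le> k"
    have "(\<Sum>l\<le>k. v l * H b l) = v b - 2 * v b / S * S"
      using Hs[OF b, of v] by (simp add: S_def mult.commute)
    then have "(\<Sum>l\<le>k. H a l * H b l) = H b a + 2 * v a / S * v b"
      unfolding Hs[OF a] using z[OF _ b] by (cases "S = 0") auto
    then show "(\<Sum>l\<le>k. H a l * H b l) = of_bool (a = b)" by (auto simp: H_def)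
    show "H a b = H b a" by (simp add: H_def)
    show "(\<Sum>l\<le>k. H a l * h l) = (if a = k then sqrt (\<Sum>l\<le>k. (h l)\<^sup>2) else 0)"
    proof -
      have "(\<Sum>l\<le>k. H a l * h l) = h a - v a"
        unfolding Hs[OF a] using Sv z[OF _ a] by (cases "S = 0") (auto simp: field_simps)
      then show ?thesis by (simp add: v_def N_def)
    qed
  qed
qed

section \<open>Laws of Gram-Schmidt residuals\<close>

lemma emeasure_distr_nn_integral:
  assumes "X \<in> M \<rightarrow>\<^sub>M N" "A \<in> sets N"
  shows "emeasure (distr M N X) A = (\<integral>\<^sup>+\<omega>. indicator A (X \<omega>) \<partial>M)"
proof -
  have "emeasure (distr M N X) A = (\<integral>\<^sup>+y. indicator A y \<partial>distr M N X)"
    using assms(2) by simp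
  also have "\<dots> = (\<integral>\<^sup>+\<omega>. indicator A (X \<omega>) \<partial>M)"
    using assms by (intro nn_integral_distr) auto
  finally show ?thesis .
qed

lemma std_gaussian_reindex:
  assumes "std_gaussian M I X" "inj_on f J" "f ` J \<subseteq> I"
  shows "std_gaussian M J (\<lambda>j. X (f j))"
proof -
  have G: "std_gaussian M (f ` J) X" by (rule std_gaussian_subset[OF assms(1,3)])
  have "(\<integral>\<omega>. iexp (\<Sum>j\<in>J. t j * X (f j) \<omega>) \<partial>M) = complex_of_real (exp (- (\<Sum>j\<in>J. (t j)\<^sup>2) / 2))" for t
  proof -
    have "(\<Sum>i\<in>f ` J. t (the_inv_into J f i) * X i \<omega>) = (\<Sum>j\<in>J. t j * X (f j) \<omega>)" for \<omega>
      by (simp add: sum.reindex[OF assms(2)] the_inv_into_f_f[OF assms(2)])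
    moreover have "(\<Sum>i\<in>f ` J. (t (the_inv_into J f i))\<^sup>2) = (\<Sum>j\<in>J. (t j)\<^sup>2)"
      by (simp add: sum.reindex[OF assms(2)] the_inv_into_f_f[OF assms(2)])
    ultimately show ?thesis using std_gaussian_cf[OF G, of "\<lambda>i. t (the_inv_into J f i)"] by simp
  qed
  moreover have "finite J" using G assms(2) by (auto simp: std_gaussian_def dest: finite_imageD)
  ultimately show ?thesis using G by (auto simp: std_gaussian_def)
qed

text \<open>Orthonormal rows make the pulled-back coefficient vector as long as \<open>t\<close>,
  and the characteristic function depends on \<open>t\<close> only through its length.\<close>

lemma std_gaussian_linear:
  assumes G: "std_gaussian M I X" and J: "finite J"
    and o: "\<And>a b. a \<in> J \<Longrightarrow> b \<in> J \<Longrightarrow> (\<Sum>i\<in>I. C a i * C b i) = of_bool (a = b)"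
  shows "std_gaussian M J (\<lambda>a \<omega>. \<Sum>i\<in>I. C a i * X i \<omega>)"
proof -
  have "(\<integral>\<omega>. iexp (\<Sum>a\<in>J. t a * (\<Sum>i\<in>I. C a i * X i \<omega>)) \<partial>M) = complex_of_real (exp (- (\<Sum>a\<in>J. (t a)\<^sup>2) / 2))" for t
  proof -
    have 1: "(\<Sum>a\<in>J. t a * (\<Sum>i\<in>I. C a i * X i \<omega>)) = (\<Sum>i\<in>I. (\<Sum>a\<in>J. t a * C a i) * X i \<omega>)" for \<omega>
      unfolding sum_distrib_left sum_distrib_right by (subst sum.swap) (simp add: mult.assoc)
    have "(\<Sum>i\<in>I. (\<Sum>a\<in>J. t a * C a i)\<^sup>2) = (\<Sum>i\<in>I. \<Sum>a\<in>J. \<Sum>b\<in>J. t a * t b * (C a i * C b i))"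
      unfolding power2_eq_square sum_product by (simp add: mult_ac)
    also have "\<dots> = (\<Sum>a\<in>J. \<Sum>b\<in>J. t a * t b * (\<Sum>i\<in>I. C a i * C b i))"
      unfolding sum_distrib_left by (subst sum.swap) (intro sum.cong refl sum.swap)
    also have "\<dots> = (\<Sum>a\<in>J. \<Sum>b\<in>J. if b = a then t a * t b else 0)"
      by (intro sum.cong refl) (auto simp: o)
    also have "\<dots> = (\<Sum>a\<in>J. (t a)\<^sup>2)" using J by (simp add: power2_eq_square cong: sum.cong_simp)
    finally show ?thesis using std_gaussian_cf[OF G, of "\<lambda>i. \<Sum>a\<in>J. t a * C a i"] unfolding 1 by simp
  qed
  then show ?thesis using G J by (auto simp: std_gaussian_def intro!: borel_measurable_sum borel_measurable_times)
qed

lemma std_gaussian_iid: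
  assumes G: "std_gaussian D J Y" and I: "finite I"
  shows "std_gaussian (PiM I (\<lambda>_. D)) (I \<times> J) (\<lambda>p s. Y (snd p) (s (fst p)))"
proof -
  interpret D: prob_space D using G by (simp add: std_gaussian_def)
  interpret P: product_prob_space "\<lambda>_. D" I by unfold_locales
  have J: "finite J" and Y[measurable]: "\<And>j. j \<in> J \<Longrightarrow> Y j \<in> borel_measurable D"
    using G by (auto simp: std_gaussian_def)
  have "(\<integral>s. iexp (\<Sum>p\<in>I\<times>J. t p * Y (snd p) (s (fst p))) \<partial>PiM I (\<lambda>_. D))
      = complex_of_real (exp (- (\<Sum>p\<in>I\<times>J. (t p)\<^sup>2) / 2))" for t
  proof -
    have "(\<integral>s. iexp (\<Sum>p\<in>I\<times>J. t p * Y (snd p) (s (fst p))) \<partial>PiM I (\<lambda>_. D))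
        = (\<integral>s. (\<Prod>i\<in>I. iexp (\<Sum>j\<in>J. t (i, j) * Y j (s i))) \<partial>PiM I (\<lambda>_. D))"
    proof (intro Bochner_Integration.integral_cong refl)
      fix s
      have "(\<Sum>p\<in>I\<times>J. t p * Y (snd p) (s (fst p))) = (\<Sum>i\<in>I. \<Sum>j\<in>J. t (i, j) * Y j (s i))"
        using I J by (simp add: sum.cartesian_product split_beta)
      then show "iexp (\<Sum>p\<in>I\<times>J. t p * Y (snd p) (s (fst p))) = (\<Prod>i\<in>I. iexp (\<Sum>j\<in>J. t (i, j) * Y j (s i)))"
        using I by (simp add: exp_sum[symmetric] sum_distrib_left del: of_real_mult)
    qed
    also have "\<dots> = (\<Prod>i\<in>I. \<integral>s. iexp (\<Sum>j\<in>J. t (i, j) * Y j s) \<partial>D)"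
    proof (rule P.product_integral_prod[OF I])
      fix i
      have [measurable]: "(\<lambda>s. \<Sum>j\<in>J. t (i, j) * Y j s) \<in> borel_measurable D" by measurable
      show "integrable D (\<lambda>s. iexp (\<Sum>j\<in>J. t (i, j) * Y j s))"
        by (rule D.integrable_bounded[where B=1]) (auto simp del: of_real_sum of_real_mult)
    qed
    also have "\<dots> = (\<Prod>i\<in>I. complex_of_real (exp (- (\<Sum>j\<in>J. (t (i, j))\<^sup>2) / 2)))"
      by (intro prod.cong refl std_gaussian_cf[OF G])
    also have "\<dots> = complex_of_real (exp (\<Sum>i\<in>I. - (\<Sum>j\<in>J. (t (i, j))\<^sup>2) / 2))"
      using I by (simp add: exp_sum)
    also have "(\<Sum>i\<in>I. - (\<Sum>j\<in>J. (t (i, j))\<^sup>2) / 2) = - (\<Sum>p\<in>I\<times>J. (t p)\<^sup>2) / 2"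
      using I J by (simp add: sum.cartesian_product split_beta sum_negf sum_divide_distrib)
    finally show ?thesis .
  qed
  moreover have "(\<lambda>s. Y (snd p) (s (fst p))) \<in> borel_measurable (PiM I (\<lambda>_. D))" if "p \<in> I \<times> J" for p
  proof -
    have "(\<lambda>s. s (fst p)) \<in> PiM I (\<lambda>_. D) \<rightarrow>\<^sub>M D"
      using that by (intro measurable_component_singleton) auto
    from measurable_compose[OF this Y[of "snd p"]] show ?thesis using that by (auto simp: mem_Times_iff)
  qed
  ultimately show ?thesis using I J P.prob_space_axioms by (auto simp: std_gaussian_def)
qed

section \<open>Gaussian vectors, Gaussian matrices and chi-square laws\<close>

definition gauss_vec :: "nat \<Rightarrow> (nat \<Rightarrow> real) measure" where
  "gauss_vec n = PiM {..<n} (\<lambda>_. std_normal)"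

text \<open>Storing a matrix by columns lets Fubini split off the last column while the earlier ones
  are held fixed.\<close>

definition gauss_cols :: "nat \<Rightarrow> nat \<Rightarrow> (nat \<Rightarrow> nat \<Rightarrow> real) measure" where
  "gauss_cols n k = PiM {..<k} (\<lambda>_. gauss_vec n)"

text \<open>As an image of a Gaussian vector it turns chi-square integrals into products over
  independent normals. For \<open>d = 0\<close> it is the point mass at zero.\<close>

definition chi2 :: "nat \<Rightarrow> real measure" where
  "chi2 d = distr (gauss_vec d) borel (\<lambda>x. \<Sum>i<d. (x i)\<^sup>2)"

lemma prob_space_gauss_vec: "prob_space (gauss_vec n)"
  unfolding gauss_vec_def by (rule prob_space_PiM) unfold_locales

lemma prob_space_gauss_cols: "prob_space (gauss_cols n k)"
  unfolding gauss_cols_def by (rule prob_space_PiM) (rule prob_space_gauss_vec)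

lemma gauss_vec_component [measurable]: "i < n \<Longrightarrow> (\<lambda>x. x i) \<in> borel_measurable (gauss_vec n)"
  using measurable_component_singleton[of i "{..<n}" "\<lambda>_. std_normal"] by (simp add: gauss_vec_def)

lemma gauss_cols_column: "j < k \<Longrightarrow> (\<lambda>Z. Z j) \<in> gauss_cols n k \<rightarrow>\<^sub>M gauss_vec n"
  using measurable_component_singleton[of j "{..<k}" "\<lambda>_. gauss_vec n"] by (simp add: gauss_cols_def)

lemma gauss_cols_component [measurable]:
  "j < k \<Longrightarrow> i < n \<Longrightarrow> (\<lambda>Z. Z j i) \<in> borel_measurable (gauss_cols n k)"
  using measurable_compose[OF gauss_cols_column gauss_vec_component] by simp

lemma prob_space_chi2: "prob_space (chi2 d)"
  unfolding chi2_def by (rule prob_space.prob_space_distr[OF prob_space_gauss_vec]) measurable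

lemma sets_chi2 [measurable_cong]: "sets (chi2 d) = sets borel"
  by (simp add: chi2_def)

lemma space_chi2 [simp]: "space (chi2 d) = UNIV"
  by (simp add: chi2_def)

lemma std_gaussian_gauss_vec: "std_gaussian (gauss_vec n) {..<n} (\<lambda>i x. x i)"
proof -
  have "std_gaussian std_normal {()} (\<lambda>_ x. x)"
    using prob_space_std_normal char_std_normal_distribution
    by (simp add: std_gaussian_def fun_eq_iff char_def)
  from std_gaussian_iid[OF this, of "{..<n}"]
  have "std_gaussian (gauss_vec n) ({..<n} \<times> {()}) (\<lambda>p s. s (fst p))"
    by (simp add: gauss_vec_def)
  from std_gaussian_reindex[OF this, of "\<lambda>i. (i, ())" "{..<n}"] show ?thesis
    by (simp add: inj_on_def image_subset_iff)
qed

lemma std_gaussian_gauss_cols: "std_gaussian (gauss_cols n k) ({..<k} \<times> {..<n}) (\<lambda>p Z. Z (fst p) (snd p))"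
  unfolding gauss_cols_def by (rule std_gaussian_iid[OF std_gaussian_gauss_vec]) simp

lemma chi2_law:
  assumes G: "std_gaussian M I X" and d: "card I = d"
  shows "distr M borel (\<lambda>\<omega>. \<Sum>i\<in>I. (X i \<omega>)\<^sup>2) = chi2 d"
proof -
  have I: "finite I" using G by (simp add: std_gaussian_def)
  obtain f where f: "bij_betw f {..<d} I"
    using ex_bij_betw_nat_finite[OF I] d by (auto simp: atLeast0LessThan)
  have G': "std_gaussian M {..<d} (\<lambda>j. X (f j))"
    by (rule std_gaussian_reindex[OF G]) (use f in \<open>auto simp: bij_betw_def\<close>)
  have [measurable]: "\<And>j. j \<in> {..<d} \<Longrightarrow> X (f j) \<in> borel_measurable M"
    using G' unfolding std_gaussian_def by blast
  have s: "sets (PiM {..<d} (\<lambda>_. borel)) = sets (gauss_vec d)"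
    unfolding gauss_vec_def by (rule sets_PiM_cong) auto
  have m: "(\<lambda>\<omega>. \<lambda>j\<in>{..<d}. X (f j) \<omega>) \<in> M \<rightarrow>\<^sub>M gauss_vec d"
    by (subst measurable_cong_sets[OF refl s[symmetric]]) measurable
  have "chi2 d = distr (distr M (gauss_vec d) (\<lambda>\<omega>. \<lambda>j\<in>{..<d}. X (f j) \<omega>)) borel (\<lambda>x. \<Sum>i<d. (x i)\<^sup>2)"
    using std_gaussian_law[OF G'] distr_cong[OF refl s, of M]
    by (simp add: chi2_def gauss_vec_def)
  also have "\<dots> = distr M borel (\<lambda>\<omega>. \<Sum>j<d. (X (f j) \<omega>)\<^sup>2)"
    using m by (subst distr_distr) (auto simp: comp_def)
  also have "(\<lambda>\<omega>. \<Sum>j<d. (X (f j) \<omega>)\<^sup>2) = (\<lambda>\<omega>. \<Sum>i\<in>I. (X i \<omega>)\<^sup>2)"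
    using sum.reindex_bij_betw[OF f, of "\<lambda>i. (X i _)\<^sup>2"] by (intro ext) auto
  finally show ?thesis by simp
qed

lemma chi2_pos:
  assumes "0 < d" shows "AE y in chi2 d. 0 < y"
proof -
  have "AE x in std_normal. x \<noteq> 0"
    by (subst AE_density) (auto intro: AE_mp[OF AE_lborel_singleton[of "0::real"]])
  also have "std_normal = distr (gauss_vec d) borel (\<lambda>x. x 0)"
    using prob_space.law_std_normal[OF prob_space_gauss_vec, of "\<lambda>x. x 0" d]
      std_gaussian_single[OF std_gaussian_gauss_vec, of 0 d] assms by simp
  finally have "AE x in gauss_vec d. x 0 \<noteq> 0"
    using assms by (subst (asm) AE_distr_iff) auto
  then show ?thesis
    unfolding chi2_def
  proof (subst AE_distr_iff, goal_cases)
    case 3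
    then show ?case
    proof eventually_elim
      case (elim x)
      have "0 < (x 0)\<^sup>2" using elim by simp
      also have "\<dots> \<le> (\<Sum>i<d. (x i)\<^sup>2)" by (rule member_le_sum) (use assms in auto)
      finally show ?case .
    qed
  qed auto
qed

lemma chi2_nonneg: "AE y in chi2 d. 0 \<le> y"
  unfolding chi2_def by (subst AE_distr_iff) (auto intro!: AE_I2 sum_nonneg)

lemma std_gaussian_cols_measurable:
  assumes G: "std_gaussian M ({..<k} \<times> {..<n}) X"
  shows "(\<lambda>\<omega>. \<lambda>j\<in>{..<k}. \<lambda>i\<in>{..<n}. X (j, i) \<omega>) \<in> M \<rightarrow>\<^sub>M gauss_cols n k"
proof -
  have "X (j, i) \<in> borel_measurable M" if "j < k" "i < n" for i j
    using G that by (auto simp: std_gaussian_def)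
  then show ?thesis unfolding gauss_cols_def gauss_vec_def
    by (intro measurable_restrict) auto
qed

lemma std_gaussian_cols_law:
  assumes G: "std_gaussian M ({..<k} \<times> {..<n}) X"
  shows "distr M (gauss_cols n k) (\<lambda>\<omega>. \<lambda>j\<in>{..<k}. \<lambda>i\<in>{..<n}. X (j, i) \<omega>) = gauss_cols n k"
proof -
  let ?I = "{..<k} \<times> {..<n}"
  define c where "c x = (\<lambda>j\<in>{..<k}. \<lambda>i\<in>{..<n}. x (j, i))" for x :: "nat \<times> nat \<Rightarrow> real"
  have c: "c \<in> PiM ?I (\<lambda>_. borel) \<rightarrow>\<^sub>M gauss_cols n k"
    unfolding c_def gauss_cols_def gauss_vec_def
    by (intro measurable_restrict) auto
  have law: "distr M' (gauss_cols n k) (\<lambda>\<omega>. \<lambda>j\<in>{..<k}. \<lambda>i\<in>{..<n}. Y (j, i) \<omega>)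
      = distr (PiM ?I (\<lambda>_. std_normal)) (gauss_cols n k) c"
    if G: "std_gaussian M' ?I Y" for M' :: "'x measure" and Y
  proof -
    have [measurable]: "\<And>p. p \<in> ?I \<Longrightarrow> Y p \<in> borel_measurable M'"
      using G unfolding std_gaussian_def by blast
    have m: "(\<lambda>\<omega>. \<lambda>p\<in>?I. Y p \<omega>) \<in> M' \<rightarrow>\<^sub>M PiM ?I (\<lambda>_. borel)" by measurable
    have "distr (PiM ?I (\<lambda>_. std_normal)) (gauss_cols n k) c = distr M' (gauss_cols n k) (c \<circ> (\<lambda>\<omega>. \<lambda>p\<in>?I. Y p \<omega>))"
      unfolding std_gaussian_law[OF G, symmetric] by (rule distr_distr[OF c m])
    also have "c \<circ> (\<lambda>\<omega>. \<lambda>p\<in>?I. Y p \<omega>) = (\<lambda>\<omega>. \<lambda>j\<in>{..<k}. \<lambda>i\<in>{..<n}. Y (j, i) \<omega>)"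
      by (auto simp: c_def fun_eq_iff restrict_def)
    finally show ?thesis ..
  qed
  have "distr M (gauss_cols n k) (\<lambda>\<omega>. \<lambda>j\<in>{..<k}. \<lambda>i\<in>{..<n}. X (j, i) \<omega>)
     = distr (gauss_cols n k) (gauss_cols n k) (\<lambda>Z. \<lambda>j\<in>{..<k}. \<lambda>i\<in>{..<n}. Z j i)"
    unfolding law[OF G] using law[OF std_gaussian_gauss_cols[of n k]] by simp
  also have "\<dots> = distr (gauss_cols n k) (gauss_cols n k) (\<lambda>Z. Z)"
  proof (rule distr_cong[OF refl refl])
    fix Z assume Z: "Z \<in> space (gauss_cols n k)"
    show "(\<lambda>j\<in>{..<k}. \<lambda>i\<in>{..<n}. Z j i) = Z"
    proof
      fix j
      show "(\<lambda>j\<in>{..<k}. \<lambda>i\<in>{..<n}. Z j i) j = Z j"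
      proof (cases "j < k")
        case True
        then have "Z j \<in> extensional {..<n}"
          using Z by (auto simp: gauss_cols_def gauss_vec_def space_PiM PiE_def)
        then show ?thesis using True by (simp add: extensional_restrict)
      qed (use Z in \<open>auto simp: gauss_cols_def space_PiM PiE_def extensional_def\<close>)
    qed
  qed
  finally show ?thesis by (simp add: distr_id2)
qed

text \<open>Carries laws computed on the canonical matrix space over to any standard Gaussian
  family. Condition \<open>loc\<close> is there because the family fills only the entries with
  \<open>j < k\<close> and \<open>i < n\<close>, whereas \<open>F\<close> takes total
  functions.\<close>

lemma std_gaussian_transfer:
  assumes G: "std_gaussian M ({..<k} \<times> {..<n}) X" and F: "F \<in> gauss_cols n k \<rightarrow>\<^sub>M N"
    and loc: "\<And>Z Z'. (\<And>j i. j < k \<Longrightarrow> i < n \<Longrightarrow> Z j i = Z' j i) \<Longrightarrow> F Z = F Z'"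
  shows "distr M N (\<lambda>\<omega>. F (\<lambda>j i. X (j, i) \<omega>)) = distr (gauss_cols n k) N F"
    and "(\<lambda>\<omega>. F (\<lambda>j i. X (j, i) \<omega>)) \<in> M \<rightarrow>\<^sub>M N"
proof -
  let ?R = "\<lambda>\<omega>. \<lambda>j\<in>{..<k}. \<lambda>i\<in>{..<n}. X (j, i) \<omega>"
  have e: "F (\<lambda>j i. X (j, i) \<omega>) = F (?R \<omega>)" for \<omega> by (rule loc) simp
  note m = std_gaussian_cols_measurable[OF G]
  show "(\<lambda>\<omega>. F (\<lambda>j i. X (j, i) \<omega>)) \<in> M \<rightarrow>\<^sub>M N"
    unfolding e by (rule measurable_compose[OF m F])
  show "distr M N (\<lambda>\<omega>. F (\<lambda>j i. X (j, i) \<omega>)) = distr (gauss_cols n k) N F"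
    unfolding e using distr_distr[OF F m] std_gaussian_cols_law[OF G] by (simp add: comp_def)
qed

section \<open>Residual norms and last coefficients of a Gaussian matrix\<close>

lemma measurable_gram_schmidt:
  assumes "\<And>l i. l \<le> j \<Longrightarrow> i < n \<Longrightarrow> (\<lambda>\<omega>. Z \<omega> l i) \<in> borel_measurable M" "i < n"
  shows "(\<lambda>\<omega>. gram_schmidt n (Z \<omega>) j i) \<in> borel_measurable M"
  using assms
proof (induction j arbitrary: i rule: less_induct)
  case (less j)
  note [measurable] = less.prems(1)
  have [measurable]: "(\<lambda>\<omega>. gram_schmidt n (Z \<omega>) l i) \<in> borel_measurable M" if "l < j" "i < n" for l i
    by (rule less.IH[OF that(1) _ that(2)]) (use that less.prems in auto)
  show ?case unfolding gram_schmidt_eq[of n _ j] gs_coeff_def ip_def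
    using less.prems(2) by (auto intro!: borel_measurable_diff borel_measurable_sum borel_measurable_times borel_measurable_divide less.prems(1))
qed

lemma measurable_ip:
  assumes "\<And>i. i < n \<Longrightarrow> (\<lambda>\<omega>. u \<omega> i) \<in> borel_measurable M" "\<And>i. i < n \<Longrightarrow> (\<lambda>\<omega>. v \<omega> i) \<in> borel_measurable M"
  shows "(\<lambda>\<omega>. ip n (u \<omega>) (v \<omega>)) \<in> borel_measurable M"
  unfolding ip_def using assms by (intro borel_measurable_sum borel_measurable_times) auto

definition gs_sqnorm :: "nat \<Rightarrow> nat \<Rightarrow> (nat \<Rightarrow> nat \<Rightarrow> real) \<Rightarrow> real" where
  "gs_sqnorm n k Z = ip n (gram_schmidt n Z k) (gram_schmidt n Z k)"

text \<open>By \<open>least_squares_last_coeff\<close> this is the coefficient of column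
  \<open>k\<close> when column \<open>Suc k\<close> is regressed on columns \<open>0\<close> to
  \<open>k\<close>, written as an explicit measurable function of the array.\<close>

definition gs_last_coeff :: "nat \<Rightarrow> nat \<Rightarrow> (nat \<Rightarrow> nat \<Rightarrow> real) \<Rightarrow> real" where
  "gs_last_coeff n k Z = ip n (gram_schmidt n Z k) (Z (Suc k)) / gs_sqnorm n k Z"

lemma gs_sqnorm_cong:
  "(\<And>l i. l \<le> k \<Longrightarrow> i < n \<Longrightarrow> Z l i = Z' l i) \<Longrightarrow> gs_sqnorm n k Z = gs_sqnorm n k Z'"
  unfolding gs_sqnorm_def by (intro ip_cong gram_schmidt_cong) auto

lemma gs_last_coeff_cong:
  assumes "\<And>l i. l \<le> Suc k \<Longrightarrow> i < n \<Longrightarrow> Z l i = Z' l i"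
  shows "gs_last_coeff n k Z = gs_last_coeff n k Z'"
proof -
  have "ip n (gram_schmidt n Z k) (Z (Suc k)) = ip n (gram_schmidt n Z' k) (Z' (Suc k))"
    by (intro ip_cong gram_schmidt_cong) (use assms in auto)
  then show ?thesis using gs_sqnorm_cong[of k n Z Z'] assms by (simp add: gs_last_coeff_def)
qed

lemma gs_sqnorm_cong_lessThan:
  "(\<And>l i. l < Suc k \<Longrightarrow> i < n \<Longrightarrow> Z l i = Z' l i) \<Longrightarrow> gs_sqnorm n k Z = gs_sqnorm n k Z'"
  by (rule gs_sqnorm_cong) auto

lemma measurable_gs_sqnorm:
  assumes "\<And>l i. l \<le> k \<Longrightarrow> i < n \<Longrightarrow> (\<lambda>\<omega>. Z \<omega> l i) \<in> borel_measurable M"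
  shows "(\<lambda>\<omega>. gs_sqnorm n k (Z \<omega>)) \<in> borel_measurable M"
  unfolding gs_sqnorm_def by (intro measurable_ip measurable_gram_schmidt) (use assms in auto)

lemma measurable_gs_last_coeff:
  assumes "\<And>l i. l \<le> Suc k \<Longrightarrow> i < n \<Longrightarrow> (\<lambda>\<omega>. Z \<omega> l i) \<in> borel_measurable M"
  shows "(\<lambda>\<omega>. gs_last_coeff n k (Z \<omega>)) \<in> borel_measurable M"
  unfolding gs_last_coeff_def
  by (intro borel_measurable_divide measurable_gs_sqnorm measurable_ip measurable_gram_schmidt) (use assms in auto)

lemma gauss_cols_gs_sqnorm_measurable: "k < m \<Longrightarrow> gs_sqnorm n k \<in> borel_measurable (gauss_cols n m)"
  by (rule measurable_gs_sqnorm) (auto intro: gauss_cols_component)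

lemma nn_integral_gauss_cols_Suc:
  assumes "f \<in> borel_measurable (gauss_cols n (Suc k))"
  shows "(\<integral>\<^sup>+Z. f Z \<partial>gauss_cols n (Suc k)) = (\<integral>\<^sup>+Z. \<integral>\<^sup>+w. f (Z(k := w)) \<partial>gauss_vec n \<partial>gauss_cols n k)"
proof -
  interpret prob_space "gauss_vec n" by (rule prob_space_gauss_vec)
  interpret P: product_sigma_finite "\<lambda>_. gauss_vec n" by unfold_locales
  show ?thesis using assms P.product_nn_integral_insert[of "{..<k}" k f]
    by (simp add: gauss_cols_def lessThan_Suc)
qed

lemma integral_gauss_cols_Suc:
  fixes f :: "_ \<Rightarrow> real"
  assumes "integrable (gauss_cols n (Suc k)) f"
  shows "(\<integral>Z. f Z \<partial>gauss_cols n (Suc k)) = (\<integral>Z. \<integral>w. f (Z(k := w)) \<partial>gauss_vec n \<partial>gauss_cols n k)"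
proof -
  interpret prob_space "gauss_vec n" by (rule prob_space_gauss_vec)
  interpret P: product_sigma_finite "\<lambda>_. gauss_vec n" by unfold_locales
  show ?thesis using assms P.product_integral_insert[of "{..<k}" k f]
    by (simp add: gauss_cols_def lessThan_Suc)
qed

lemma std_gaussian_ip:
  assumes "finite A" "\<And>a b. a \<in> A \<Longrightarrow> b \<in> A \<Longrightarrow> ip n (q a) (q b) = of_bool (a = b)"
  shows "std_gaussian (gauss_vec n) A (\<lambda>a w. ip n (q a) w)"
  unfolding ip_def by (rule std_gaussian_linear[OF std_gaussian_gauss_vec assms(1)]) (use assms(2) in \<open>simp add: ip_def\<close>)

text \<open>Given the first \<open>k\<close> columns, the new residual norm is a sum of
  \<open>n - k\<close> squared independent normals, whatever those columns are as long as they are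
  independent. The induction serves only to show that they almost surely are: each earlier residual
  norm has \<open>n - l > 0\<close> degrees of freedom and is therefore positive.\<close>

lemma gs_sqnorm_law_gauss_cols:
  "k \<le> n \<Longrightarrow> distr (gauss_cols n (Suc k)) borel (gs_sqnorm n k) = chi2 (n - k)"
proof (induction k rule: less_induct)
  case (less k)
  have nz: "AE Z in gauss_cols n k. \<forall>l\<in>{..<k}. gs_sqnorm n l Z \<noteq> 0"
  proof (rule AE_finite_allI)
    fix l assume l: "l \<in> {..<k}"
    have G: "std_gaussian (gauss_cols n k) ({..<Suc l} \<times> {..<n}) (\<lambda>p Z. Z (fst p) (snd p))"
      by (rule std_gaussian_subset[OF std_gaussian_gauss_cols]) (use l in auto)
    have "distr (gauss_cols n k) borel (gs_sqnorm n l) = chi2 (n - l)"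
      using std_gaussian_transfer(1)[OF G gauss_cols_gs_sqnorm_measurable[OF lessI] gs_sqnorm_cong_lessThan]
        less.IH[of l] l less.prems by simp
    moreover have "AE y in chi2 (n - l). 0 < y" by (rule chi2_pos) (use l less.prems in auto)
    ultimately have "AE y in distr (gauss_cols n k) borel (gs_sqnorm n l). 0 < y" by (simp only:)
    then show "AE Z in gauss_cols n k. gs_sqnorm n l Z \<noteq> 0"
      using l by (subst (asm) AE_distr_iff) (auto intro: gauss_cols_gs_sqnorm_measurable)
  qed simp
  have m[measurable]: "gs_sqnorm n k \<in> borel_measurable (gauss_cols n (Suc k))"
    by (rule gauss_cols_gs_sqnorm_measurable) simp
  show ?case
  proof (rule measure_eqI)
    fix A assume "A \<in> sets (distr (gauss_cols n (Suc k)) borel (gs_sqnorm n k))"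
    then have A[measurable]: "A \<in> sets borel" by simp
    interpret prob_space "gauss_cols n k" by (rule prob_space_gauss_cols)
    have "emeasure (distr (gauss_cols n (Suc k)) borel (gs_sqnorm n k)) A
        = (\<integral>\<^sup>+Z. indicator A (gs_sqnorm n k Z) \<partial>gauss_cols n (Suc k))"
      by (rule emeasure_distr_nn_integral) measurable
    also have "\<dots> = (\<integral>\<^sup>+Z. \<integral>\<^sup>+w. indicator A (gs_sqnorm n k (Z(k := w))) \<partial>gauss_vec n \<partial>gauss_cols n k)"
      by (rule nn_integral_gauss_cols_Suc) measurable
    also have "\<dots> = (\<integral>\<^sup>+Z. emeasure (chi2 (n - k)) A \<partial>gauss_cols n k)"
    proof (rule nn_integral_cong_AE, use nz in eventually_elim)
      fix Z assume "\<forall>l\<in>{..<k}. gs_sqnorm n l Z \<noteq> 0"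
      then obtain q where q: "\<And>a b. a < n \<Longrightarrow> b < n \<Longrightarrow> ip n (q a) (q b) = of_bool (a = b)"
        "\<And>w. gs_sqnorm n k (Z(k := w)) = (\<Sum>a=k..<n. (ip n (q a) w)\<^sup>2)"
        using gram_schmidt_norm_parseval[of k n Z] less.prems unfolding gs_sqnorm_def by auto
      have G: "std_gaussian (gauss_vec n) {k..<n} (\<lambda>a w. ip n (q a) w)"
        by (rule std_gaussian_ip) (auto simp: q)
      have [measurable]: "(\<lambda>w. ip n (q a) w) \<in> borel_measurable (gauss_vec n)" for a
        by (rule measurable_ip) auto
      have "(\<integral>\<^sup>+w. indicator A (gs_sqnorm n k (Z(k := w))) \<partial>gauss_vec n)
          = emeasure (distr (gauss_vec n) borel (\<lambda>w. \<Sum>a=k..<n. (ip n (q a) w)\<^sup>2)) A"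
        unfolding q(2) by (rule emeasure_distr_nn_integral[symmetric]) measurable
      also have "\<dots> = emeasure (chi2 (n - k)) A" by (subst chi2_law[OF G]) simp_all
      finally show "(\<integral>\<^sup>+w. indicator A (gs_sqnorm n k (Z(k := w))) \<partial>gauss_vec n) = emeasure (chi2 (n - k)) A" .
    qed
    also have "\<dots> = emeasure (chi2 (n - k)) A" by (simp add: emeasure_space_1)
    finally show "emeasure (distr (gauss_cols n (Suc k)) borel (gs_sqnorm n k)) A = emeasure (chi2 (n - k)) A" .
  qed (simp add: chi2_def)
qed

lemma gs_sqnorm_law:
  assumes G: "std_gaussian M ({..<m} \<times> {..<n}) X" and "k < m" "k \<le> n"
  shows "distr M borel (\<lambda>\<omega>. gs_sqnorm n k (\<lambda>j i. X (j, i) \<omega>)) = chi2 (n - k)"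
    and "(\<lambda>\<omega>. gs_sqnorm n k (\<lambda>j i. X (j, i) \<omega>)) \<in> borel_measurable M"
proof -
  have G': "std_gaussian M ({..<Suc k} \<times> {..<n}) X"
    by (rule std_gaussian_subset[OF G]) (use assms in auto)
  note T = std_gaussian_transfer[OF G' gauss_cols_gs_sqnorm_measurable[OF lessI] gs_sqnorm_cong_lessThan]
  show "distr M borel (\<lambda>\<omega>. gs_sqnorm n k (\<lambda>j i. X (j, i) \<omega>)) = chi2 (n - k)"
    using T(1) gs_sqnorm_law_gauss_cols[OF assms(3)] by simp
  show "(\<lambda>\<omega>. gs_sqnorm n k (\<lambda>j i. X (j, i) \<omega>)) \<in> borel_measurable M"
    by (rule T(2))
qed

lemma gs_sqnorm_pos:
  assumes "std_gaussian M ({..<m} \<times> {..<n}) X" "k < m" "k < n"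
  shows "AE \<omega> in M. 0 < gs_sqnorm n k (\<lambda>j i. X (j, i) \<omega>)"
proof -
  have "AE y in distr M borel (\<lambda>\<omega>. gs_sqnorm n k (\<lambda>j i. X (j, i) \<omega>)). 0 < y"
    unfolding gs_sqnorm_law(1)[OF assms(1,2) less_imp_le[OF assms(3)]] using assms(3) by (intro chi2_pos) simp
  then show ?thesis using gs_sqnorm_law(2)[OF assms(1,2)] assms(3) by (subst (asm) AE_distr_iff) auto
qed

section \<open>Chi-square bounds\<close>

lemma measurable_chi2 [simp]: "f \<in> borel_measurable (chi2 d) \<longleftrightarrow> f \<in> borel_measurable borel"
  by (rule arg_cong[where f="\<lambda>S. f \<in> S"]) (rule measurable_cong_sets[OF sets_chi2 refl])

lemma nn_integral_exp_std_normal: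
  assumes "- 1 / 2 < \<mu>"
  shows "(\<integral>\<^sup>+x. ennreal (exp (- \<mu> * x\<^sup>2)) \<partial>std_normal) = ennreal (1 / sqrt (1 + 2 * \<mu>))"
proof -
  \<comment> \<open>Tilting the standard normal density by \<open>exp (- \<mu> * x\<^sup>2)\<close>
    gives \<open>s\<close> times the normal density with standard deviation
    \<open>s\<close>.\<close>
  define s where "s = 1 / sqrt (1 + 2 * \<mu>)"
  have s: "0 < s" "s\<^sup>2 = 1 / (1 + 2 * \<mu>)" using assms by (simp_all add: s_def power_divide)
  have e: "std_normal_density x * exp (- \<mu> * x\<^sup>2) = s * normal_density 0 s x" for x
  proof -
    have "s * (1 / sqrt (2 * pi * s\<^sup>2)) = 1 / sqrt (2 * pi)"
      using s(1) by (simp add: real_sqrt_mult)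
    moreover have "exp (- x\<^sup>2 / 2) * exp (- \<mu> * x\<^sup>2) = exp (- (x - 0)\<^sup>2 / (2 * s\<^sup>2))"
      unfolding s(2) using assms by (simp add: exp_add[symmetric] field_simps)
    ultimately have "1 / sqrt (2 * pi) * (exp (- x\<^sup>2 / 2) * exp (- \<mu> * x\<^sup>2))
        = s * (1 / sqrt (2 * pi * s\<^sup>2)) * exp (- (x - 0)\<^sup>2 / (2 * s\<^sup>2))" by (simp only:)
    then show ?thesis unfolding std_normal_density_def normal_density_def[of 0 s] by (simp only: mult.assoc)
  qed
  have "(\<integral>\<^sup>+x. ennreal (exp (- \<mu> * x\<^sup>2)) \<partial>std_normal)
      = (\<integral>\<^sup>+x. ennreal (std_normal_density x) * ennreal (exp (- \<mu> * x\<^sup>2)) \<partial>lborel)"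
    by (subst nn_integral_density) auto
  also have "\<dots> = (\<integral>\<^sup>+x. ennreal s * ennreal (normal_density 0 s x) \<partial>lborel)"
    using s(1) by (simp add: ennreal_mult[symmetric] e[simplified])
  also have "\<dots> = ennreal s"
    using s(1) by (simp add: nn_integral_cmult nn_integral_eq_integral)
  finally show ?thesis by (simp add: s_def)
qed

lemma nn_integral_chi2:
  assumes "f \<in> borel_measurable borel"
  shows "(\<integral>\<^sup>+y. f y \<partial>chi2 d) = (\<integral>\<^sup>+x. f (\<Sum>i<d. (x i)\<^sup>2) \<partial>gauss_vec d)"
  unfolding chi2_def using assms by (subst nn_integral_distr) auto

lemma chi2_laplace:
  assumes "- 1 / 2 < \<mu>"
  shows "(\<integral>\<^sup>+y. ennreal (exp (- \<mu> * y)) \<partial>chi2 d) = ennreal ((1 / sqrt (1 + 2 * \<mu>)) ^ d)"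
proof -
  have "(\<integral>\<^sup>+y. ennreal (exp (- \<mu> * y)) \<partial>chi2 d)
      = (\<integral>\<^sup>+x. (\<Prod>i<d. ennreal (exp (- \<mu> * (x i)\<^sup>2))) \<partial>gauss_vec d)"
    by (subst nn_integral_chi2) (simp_all add: prod_ennreal exp_sum[symmetric] sum_distrib_left sum_negf)
  also have "\<dots> = (\<Prod>i<d. \<integral>\<^sup>+x. ennreal (exp (- \<mu> * x\<^sup>2)) \<partial>std_normal)"
    unfolding gauss_vec_def by (rule std_normal_product.product_nn_integral_prod) auto
  also have "\<dots> = ennreal ((1 / sqrt (1 + 2 * \<mu>)) ^ d)"
    using assms by (simp add: nn_integral_exp_std_normal[simplified] ennreal_power)
  finally show ?thesis .
qed

lemma nn_integral_exp_decay:
  assumes "0 < y"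
  shows "(\<integral>\<^sup>+l. ennreal (exp (- l * y)) * indicator {0..} l \<partial>lborel) = ennreal (1 / y)"
proof -
  have "((\<lambda>l. - exp (- l * y) / y) \<longlongrightarrow> 0) at_top"
    using assms by real_asymp
  then have "(\<integral>\<^sup>+l. ennreal (exp (- l * y)) * indicator {0..} l \<partial>lborel) = ennreal (0 - (- exp (- 0 * y) / y))"
    by (intro nn_integral_FTC_atLeast) (use assms in \<open>auto intro!: derivative_eq_intros\<close>)
  then show ?thesis by simp
qed

lemma nn_integral_power_decay:
  assumes "3 \<le> d"
  shows "(\<integral>\<^sup>+l. ennreal ((1 / sqrt (1 + 2 * l)) ^ d) * indicator {0..} l \<partial>lborel) = ennreal (1 / (real d - 2))"
proof -
  define c where "c = real d - 2"
  have c: "0 < c" using assms by (simp add: c_def)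
  define F where "F l = - ((1 + 2 * l) powr (- c / 2)) / c" for l :: real
  have "(F \<longlongrightarrow> - 0 / c) at_top"
    unfolding F_def using c by (intro tendsto_intros tendsto_neg_powr) (auto, real_asymp)
  moreover have "(F has_real_derivative (1 / sqrt (1 + 2 * l)) ^ d) (at l)" if "0 \<le> l" for l
  proof -
    have "(1 / sqrt (1 + 2 * l)) ^ d = (1 + 2 * l) powr (- c / 2 - 1)"
    proof -
      have "(1 / sqrt (1 + 2 * l)) ^ d = ((1 + 2 * l) powr (- 1 / 2)) powr real d"
        using that by (subst powr_realpow) (auto simp: powr_minus powr_half_sqrt field_simps)
      then show ?thesis by (simp add: powr_powr c_def field_simps)
    qed
    moreover have "(F has_real_derivative (1 + 2 * l) powr (- c / 2 - 1)) (at l)"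
      unfolding F_def using that c by (auto intro!: derivative_eq_intros simp: field_simps)
    ultimately show ?thesis by simp
  qed
  ultimately have "(\<integral>\<^sup>+l. ennreal ((1 / sqrt (1 + 2 * l)) ^ d) * indicator {0..} l \<partial>lborel) = ennreal (- 0 / c - F 0)"
    by (intro nn_integral_FTC_atLeast) (auto intro!: zero_le_power)
  then show ?thesis by (simp add: F_def c_def)
qed

text \<open>Write \<open>1 / y\<close> as the integral of \<open>exp (- l * y)\<close> over
  \<open>l \<ge> 0\<close>, exchange the integrals and integrate the Laplace transform; the
  resulting power of \<open>1 + 2 * l\<close> is integrable at infinity for
  \<open>d \<ge> 3\<close>.\<close>

lemma chi2_inverse_moment:
  assumes "3 \<le> d"
  shows "(\<integral>\<^sup>+y. ennreal (1 / y) \<partial>chi2 d) = ennreal (1 / (real d - 2))"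
proof -
  interpret prob_space "chi2 d" by (rule prob_space_chi2)
  interpret P: pair_sigma_finite "chi2 d" lborel by unfold_locales
  have "AE y in chi2 d. 0 < y" using assms by (intro chi2_pos) simp
  then have "(\<integral>\<^sup>+y. ennreal (1 / y) \<partial>chi2 d)
      = (\<integral>\<^sup>+y. \<integral>\<^sup>+l. ennreal (exp (- l * y)) * indicator {0..} l \<partial>lborel \<partial>chi2 d)"
    by (intro nn_integral_cong_AE) (auto simp: nn_integral_exp_decay[simplified])
  also have "\<dots> = (\<integral>\<^sup>+l. \<integral>\<^sup>+y. ennreal (exp (- l * y)) * indicator {0..} l \<partial>chi2 d \<partial>lborel)"
    by (rule P.Fubini'[symmetric]) measurable
  also have "\<dots> = (\<integral>\<^sup>+l. ennreal ((1 / sqrt (1 + 2 * l)) ^ d) * indicator {0..} l \<partial>lborel)"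
    by (intro nn_integral_cong) (auto simp: indicator_def chi2_laplace[simplified])
  finally show ?thesis using nn_integral_power_decay[OF assms] by simp
qed

text \<open>The range of \<open>\<mu>\<close> keeps \<open>2 * \<mu>\<close> within one half, where
  \<open>ln (1 + x)\<close> differs from \<open>x\<close> by at most \<open>2 * x\<^sup>2\<close>.
  Centring cancels the linear term and leaves the quadratic exponent.\<close>

lemma chi2_centered_laplace:
  assumes "\<bar>\<mu>\<bar> \<le> 1 / 4"
  shows "(\<integral>\<^sup>+y. ennreal (exp (- \<mu> * (y - real d))) \<partial>chi2 d) \<le> ennreal (exp (4 * real d * \<mu>\<^sup>2))"
proof -
  have \<mu>: "0 < 1 + 2 * \<mu>" "- 1 / 2 < \<mu>" using assms by (auto simp: abs_le_iff)
  have "(\<integral>\<^sup>+y. ennreal (exp (- \<mu> * (y - real d))) \<partial>chi2 d)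
      = (\<integral>\<^sup>+y. ennreal (exp (\<mu> * real d)) * ennreal (exp (- \<mu> * y)) \<partial>chi2 d)"
    by (simp add: ennreal_mult[symmetric] exp_add[symmetric] algebra_simps)
  also have "\<dots> = ennreal (exp (\<mu> * real d)) * ennreal ((1 / sqrt (1 + 2 * \<mu>)) ^ d)"
    unfolding chi2_laplace[OF \<mu>(2), symmetric] by (rule nn_integral_cmult) simp
  also have "\<dots> = ennreal (exp (\<mu> * real d - real d / 2 * ln (1 + 2 * \<mu>)))"
  proof -
    have "1 / sqrt (1 + 2 * \<mu>) = exp (- ln (1 + 2 * \<mu>) / 2)"
    proof -
      have "sqrt (1 + 2 * \<mu>) = exp (ln (sqrt (1 + 2 * \<mu>)))" using \<mu>(1) by simp
      also have "\<dots> = exp (ln (1 + 2 * \<mu>) / 2)" using \<mu>(1) by (subst ln_sqrt) auto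
      finally have "1 / sqrt (1 + 2 * \<mu>) = inverse (exp (ln (1 + 2 * \<mu>) / 2))"
        by (simp only: inverse_eq_divide)
      then show ?thesis unfolding exp_minus[symmetric] by (simp only: minus_divide_left)
    qed
    then have "(1 / sqrt (1 + 2 * \<mu>)) ^ d = exp (real d * (- ln (1 + 2 * \<mu>) / 2))"
      by (simp only: exp_of_nat_mult)
    then have "exp (\<mu> * real d) * (1 / sqrt (1 + 2 * \<mu>)) ^ d = exp (\<mu> * real d + real d * (- ln (1 + 2 * \<mu>) / 2))"
      by (simp only: exp_add)
    also have "\<mu> * real d + real d * (- ln (1 + 2 * \<mu>) / 2) = \<mu> * real d - real d / 2 * ln (1 + 2 * \<mu>)"
      by simp
    finally show ?thesis by (subst ennreal_mult'[symmetric]) simp_all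
  qed
  also have "\<dots> \<le> ennreal (exp (4 * real d * \<mu>\<^sup>2))"
  proof (intro ennreal_leI, subst exp_le_cancel_iff)
    have "\<bar>ln (1 + 2 * \<mu>) - 2 * \<mu>\<bar> \<le> 2 * (2 * \<mu>)\<^sup>2"
      by (rule abs_ln_one_plus_x_minus_x_bound) (use assms in auto)
    then have "2 * \<mu> - ln (1 + 2 * \<mu>) \<le> 8 * \<mu>\<^sup>2" by (simp add: abs_le_iff power_mult_distrib)
    then have "real d / 2 * (2 * \<mu> - ln (1 + 2 * \<mu>)) \<le> real d / 2 * (8 * \<mu>\<^sup>2)"
      by (intro mult_left_mono) auto
    then show "\<mu> * real d - real d / 2 * ln (1 + 2 * \<mu>) \<le> 4 * real d * \<mu>\<^sup>2"
      by (simp add: algebra_simps)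
  qed
  finally show ?thesis .
qed

text \<open>A Chernoff bound on a scale \<open>N\<close> that may exceed \<open>d\<close>. The slack
  is used for the numerator of the ratio in \<open>error_tail\<close>, which has \<open>k\<close>
  degrees of freedom but is compared on the scale \<open>n\<close>.\<close>

lemma chi2_one_sided_tail:
  assumes s: "s = 1 \<or> s = -1" and \<eta>: "0 \<le> \<eta>" "\<eta> \<le> N" and N: "real d \<le> N" "0 < N"
  shows "emeasure (chi2 d) {y. \<eta> \<le> s * (y - real d)} \<le> ennreal (exp (- (\<eta>\<^sup>2) / (16 * N)))"
proof -
  \<comment> \<open>This minimizes \<open>4 * N * \<mu>\<^sup>2 - \<mu> * \<eta>\<close>, with
    minimum \<open>- \<eta>\<^sup>2 / (16 * N)\<close>; since \<open>\<eta> \<le> N\<close> it stays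
    in the admissible range.\<close>
  define \<mu> where "\<mu> = \<eta> / (8 * N)"
  have \<mu>: "0 \<le> \<mu>" "\<mu> \<le> 1 / 4" using \<eta> N by (auto simp: \<mu>_def divide_simps)
  have "emeasure (chi2 d) {y. \<eta> \<le> s * (y - real d)} = (\<integral>\<^sup>+y. indicator {y. \<eta> \<le> s * (y - real d)} y \<partial>chi2 d)"
    by simp
  also have "\<dots> \<le> (\<integral>\<^sup>+y. ennreal (exp (- (\<mu> * \<eta>))) * ennreal (exp (- (- s * \<mu>) * (y - real d))) \<partial>chi2 d)"
  proof (intro nn_integral_mono)
    fix y
    have "1 \<le> exp (- (\<mu> * \<eta>)) * exp (- (- s * \<mu>) * (y - real d))" if "\<eta> \<le> s * (y - real d)"
    proof -
      have "0 \<le> \<mu> * (s * (y - real d) - \<eta>)" using \<mu> that by simp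
      then show ?thesis by (simp add: exp_add[symmetric] algebra_simps)
    qed
    then show "indicator {y. \<eta> \<le> s * (y - real d)} y
        \<le> ennreal (exp (- (\<mu> * \<eta>))) * ennreal (exp (- (- s * \<mu>) * (y - real d)))"
      by (simp only: ennreal_mult[symmetric] exp_ge_zero indicator_def) (auto simp del: ennreal_1 simp flip: ennreal_1)
  qed
  also have "\<dots> \<le> ennreal (exp (- (\<mu> * \<eta>))) * ennreal (exp (4 * real d * (- s * \<mu>)\<^sup>2))"
  proof (subst nn_integral_cmult)
    show "(\<lambda>y. ennreal (exp (- (- s * \<mu>) * (y - real d)))) \<in> borel_measurable (chi2 d)" by simp
    have "\<bar>- s * \<mu>\<bar> \<le> 1 / 4" using s \<mu> by auto
    then show "ennreal (exp (- (\<mu> * \<eta>))) * (\<integral>\<^sup>+y. ennreal (exp (- (- s * \<mu>) * (y - real d))) \<partial>chi2 d)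
        \<le> ennreal (exp (- (\<mu> * \<eta>))) * ennreal (exp (4 * real d * (- s * \<mu>)\<^sup>2))"
      by (intro mult_left_mono chi2_centered_laplace) auto
  qed
  also have "\<dots> = ennreal (exp (4 * real d * \<mu>\<^sup>2 - \<mu> * \<eta>))"
    using s by (auto simp: ennreal_mult[symmetric] exp_add[symmetric] power_mult_distrib)
  also have "\<dots> \<le> ennreal (exp (- (\<eta>\<^sup>2) / (16 * N)))"
  proof (intro ennreal_leI, subst exp_le_cancel_iff)
    have "4 * real d * \<mu>\<^sup>2 \<le> 4 * N * \<mu>\<^sup>2" using N by (intro mult_right_mono) auto
    also have "\<dots> - \<mu> * \<eta> = - (\<eta>\<^sup>2) / (16 * N)"
      using N by (simp add: \<mu>_def power2_eq_square field_simps)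
    finally show "4 * real d * \<mu>\<^sup>2 - \<mu> * \<eta> \<le> - (\<eta>\<^sup>2) / (16 * N)" by simp
  qed
  finally show ?thesis .
qed

lemma chi2_tail:
  assumes \<eta>: "0 \<le> \<eta>" "\<eta> \<le> N" and N: "real d \<le> N" "0 < N"
  shows "emeasure (chi2 d) {y. \<eta> \<le> \<bar>y - real d\<bar>} \<le> ennreal (2 * exp (- (\<eta>\<^sup>2) / (16 * N)))"
proof -
  have "{y. \<eta> \<le> \<bar>y - real d\<bar>} = {y. \<eta> \<le> 1 * (y - real d)} \<union> {y. \<eta> \<le> (-1) * (y - real d)}" by auto
  then have "emeasure (chi2 d) {y. \<eta> \<le> \<bar>y - real d\<bar>}
      \<le> emeasure (chi2 d) {y. \<eta> \<le> 1 * (y - real d)} + emeasure (chi2 d) {y. \<eta> \<le> (-1) * (y - real d)}"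
    by (simp only:) (rule emeasure_subadditive; simp)
  also have "\<dots> \<le> ennreal (exp (- (\<eta>\<^sup>2) / (16 * N))) + ennreal (exp (- (\<eta>\<^sup>2) / (16 * N)))"
    by (intro add_mono chi2_one_sided_tail) (use assms in auto)
  finally show ?thesis by (simp flip: ennreal_plus)
qed

text \<open>Both characteristic functions are limits of the same power series, whose coefficients are the
  moments.\<close>

lemma law_eq_of_moments:
  fixes V :: "'v \<Rightarrow> real" and W :: "'w \<Rightarrow> real"
  assumes "prob_space M" "prob_space M'"
    and V[measurable]: "V \<in> borel_measurable M" and W[measurable]: "W \<in> borel_measurable M'"
    and bV: "AE \<omega> in M. \<bar>V \<omega>\<bar> \<le> 1" and bW: "AE \<omega> in M'. \<bar>W \<omega>\<bar> \<le> 1"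
    and eq: "\<And>n. (\<integral>\<omega>. V \<omega> ^ n \<partial>M) = (\<integral>\<omega>. W \<omega> ^ n \<partial>M')"
  shows "distr M borel V = distr M' borel W"
proof -
  interpret M: prob_space M by fact
  interpret M': prob_space M' by fact
  interpret V: real_distribution "distr M borel V" by (rule M.real_distribution_distr) simp
  interpret W: real_distribution "distr M' borel W" by (rule M'.real_distribution_distr) simp
  have approx: "cmod (char (distr L borel U) t - (\<Sum>k\<le>n. ((\<i> * t) ^ k / fact k) * (\<integral>\<omega>. U \<omega> ^ k \<partial>L)))
      \<le> 2 * \<bar>t\<bar> ^ n / fact n"
    if L: "prob_space L" and U[measurable]: "U \<in> borel_measurable L" and bU: "AE \<omega> in L. \<bar>U \<omega>\<bar> \<le> 1"
    for L :: "'x measure" and U t n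
  proof -
    interpret L: prob_space L by fact
    interpret U: real_distribution "distr L borel U" by (rule L.real_distribution_distr) simp
    have pw: "AE \<omega> in L. \<bar>U \<omega>\<bar> ^ k \<le> 1" for k using bU by eventually_elim (simp add: power_le_one)
    then have i: "integrable L (\<lambda>\<omega>. U \<omega> ^ k)" for k
      by (intro L.integrable_const_bound[where B=1]) (auto simp: power_abs)
    have i': "integrable L (\<lambda>\<omega>. \<bar>U \<omega>\<bar> ^ k)" for k
      using i[of k] by (simp flip: power_abs)
    have "cmod (char (distr L borel U) t - (\<Sum>k\<le>n. ((\<i> * t) ^ k / fact k) * (\<integral>x. x ^ k \<partial>distr L borel U)))
       \<le> (2 * \<bar>t\<bar> ^ n / fact n) * (\<integral>x. \<bar>x\<bar> ^ n \<partial>distr L borel U)"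
      by (rule U.char_approx1) (use i in \<open>simp add: integrable_distr_eq\<close>)
    also have "\<dots> \<le> (2 * \<bar>t\<bar> ^ n / fact n) * 1"
    proof (intro mult_left_mono)
      have "(\<integral>x. \<bar>x\<bar> ^ n \<partial>distr L borel U) = (\<integral>\<omega>. \<bar>U \<omega>\<bar> ^ n \<partial>L)" by (simp add: integral_distr)
      also have "\<dots> \<le> (\<integral>\<omega>. 1 \<partial>L)" by (rule integral_mono_AE) (use pw i' in auto)
      finally show "(\<integral>x. \<bar>x\<bar> ^ n \<partial>distr L borel U) \<le> 1" by (simp add: L.prob_space)
    qed auto
    finally show ?thesis by (simp add: integral_distr)
  qed
  show ?thesis
  proof (rule Levy_uniqueness)
    show "char (distr M borel V) = char (distr M' borel W)"
    proof
      fix t :: real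
      define S where "S n = (\<Sum>k\<le>n. ((\<i> * t) ^ k / fact k) * complex_of_real (\<integral>\<omega>. V \<omega> ^ k \<partial>M))" for n
      have l0: "(\<lambda>n. 2 * \<bar>t\<bar> ^ n / fact n) \<longlonglongrightarrow> 0"
        using tendsto_mult[OF tendsto_const[of 2] summable_LIMSEQ_zero[OF summable_exp[of "\<bar>t\<bar>"]]]
        by (simp add: field_simps)
      have "(\<lambda>n. char (distr M borel V) t - S n) \<longlonglongrightarrow> 0"
        by (rule Lim_null_comparison[OF always_eventually l0])
           (use approx[OF assms(1) V bV] in \<open>simp add: S_def\<close>)
      moreover have "(\<lambda>n. char (distr M' borel W) t - S n) \<longlonglongrightarrow> 0"
        by (rule Lim_null_comparison[OF always_eventually l0])
           (use approx[OF assms(2) W bW] in \<open>simp add: S_def eq\<close>)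
      ultimately have "(\<lambda>n. (char (distr M borel V) t - S n) - (char (distr M' borel W) t - S n)) \<longlonglongrightarrow> 0 - 0"
        by (rule tendsto_diff)
      then show "char (distr M borel V) t = char (distr M' borel W) t"
        by (simp add: LIMSEQ_const_iff)
    qed
  qed unfold_locales
qed

section \<open>Least squares in a Gaussian design\<close>

lemma std_gaussian_cos:
  assumes G: "std_gaussian M I X"
  shows "(\<integral>\<omega>. cos (\<Sum>i\<in>I. t i * X i \<omega>) \<partial>M) = exp (- (\<Sum>i\<in>I. (t i)\<^sup>2) / 2)"
proof -
  interpret prob_space M using G by (simp add: std_gaussian_def)
  have [measurable]: "\<And>i. i \<in> I \<Longrightarrow> X i \<in> borel_measurable M"
    using G unfolding std_gaussian_def by blast
  have m: "(\<lambda>\<omega>. \<Sum>i\<in>I. t i * X i \<omega>) \<in> borel_measurable M" by measurable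
  have "integrable M (\<lambda>\<omega>. iexp (\<Sum>i\<in>I. t i * X i \<omega>))"
    by (rule integrable_bounded[where B=1]) (use m in \<open>auto simp del: of_real_sum\<close>)
  then have "(\<integral>\<omega>. Re (iexp (\<Sum>i\<in>I. t i * X i \<omega>)) \<partial>M) = Re (\<integral>\<omega>. iexp (\<Sum>i\<in>I. t i * X i \<omega>) \<partial>M)"
    by (rule integral_Re)
  then show ?thesis unfolding std_gaussian_cf[OF G]
    by (simp add: Re_exp del: of_real_sum of_real_mult)
qed

lemma nn_integral_std_normal_square: "(\<integral>\<^sup>+x. ennreal (x\<^sup>2) \<partial>std_normal) = 1"
  using std_normal_distribution_even_moments[of 1] by (subst nn_integral_eq_integral) simp_all

lemma nn_integral_ip_square:
  "(\<integral>\<^sup>+w. ennreal ((ip n v w)\<^sup>2) \<partial>gauss_vec n) = ennreal (ip n v v)"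
proof (cases "ip n v v = 0")
  case True
  then have "ip n v w = 0" for w by (intro ip_zero) (simp add: ip_self_eq_0)
  then show ?thesis by simp
next
  case False
  define s where "s = sqrt (ip n v v)"
  have s: "0 < s" "s * s = ip n v v" using False ip_self_nonneg[of n v] by (auto simp: s_def)
  define u where "u = (\<lambda>i. 1 / s * v i)"
  have v: "v = (\<lambda>i. s * u i)" using s(1) by (simp add: u_def)
  have "ip n v v = s * s * ip n u u"
    by (subst (1 2) v) (simp only: ip_scale, subst ip_commute, simp only: ip_scale mult.assoc)
  then have u1: "ip n u u = 1" using s False by simp
  have G: "std_gaussian (gauss_vec n) {()} (\<lambda>_ w. ip n u w)"
    by (rule std_gaussian_ip) (simp_all add: u1)
  have m[measurable]: "(\<lambda>w. ip n u w) \<in> borel_measurable (gauss_vec n)"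
    by (rule measurable_ip) auto
  have law: "distr (gauss_vec n) borel (\<lambda>w. ip n u w) = std_normal"
    by (rule prob_space.law_std_normal[OF prob_space_gauss_vec m]) (rule std_gaussian_single[OF G], simp)
  have "ip n v w = s * ip n u w" for w
    by (subst v) (subst ip_commute, simp only: ip_scale, subst ip_commute, rule refl)
  then have "(\<integral>\<^sup>+w. ennreal ((ip n v w)\<^sup>2) \<partial>gauss_vec n)
      = (\<integral>\<^sup>+w. ennreal (ip n v v) * ennreal ((ip n u w)\<^sup>2) \<partial>gauss_vec n)"
    unfolding s(2)[symmetric] using s(1)
    by (simp add: ennreal_mult[symmetric] power_mult_distrib power2_eq_square mult_ac)
  also have "\<dots> = ennreal (ip n v v) * (\<integral>\<^sup>+x. ennreal (x\<^sup>2) \<partial>distr (gauss_vec n) borel (\<lambda>w. ip n u w))"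
    by (simp add: nn_integral_cmult nn_integral_distr)
  finally show ?thesis unfolding law nn_integral_std_normal_square by simp
qed

lemma gauss_cols_gs_last_coeff_measurable:
  "gs_last_coeff n k \<in> borel_measurable (gauss_cols n (Suc (Suc k)))"
  by (rule measurable_gs_last_coeff) (auto intro: gauss_cols_component)

lemma gs_last_coeff_upd:
  "gs_last_coeff n k (Z(Suc k := w)) = ip n (\<lambda>i. gram_schmidt n Z k i / gs_sqnorm n k Z) w"
proof -
  have "gs_sqnorm n k (Z(Suc k := w)) = gs_sqnorm n k Z"
    by (rule gs_sqnorm_cong) auto
  moreover have "ip n (gram_schmidt n (Z(Suc k := w)) k) w = ip n (gram_schmidt n Z k) w"
    by (intro ip_cong gram_schmidt_cong) auto
  moreover have "ip n (\<lambda>i. gram_schmidt n Z k i / gs_sqnorm n k Z) w = ip n (gram_schmidt n Z k) w / gs_sqnorm n k Z"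
    by (simp add: ip_def sum_divide_distrib)
  ultimately show ?thesis by (simp add: gs_last_coeff_def)
qed

text \<open>By \<open>gs_last_coeff_upd\<close> this is the conditional variance of the last
  coefficient. If the residual vanishes both sides are zero by \<open>x / 0 = 0\<close>, so the
  conditional computations below are valid for every array.\<close>

lemma ip_gram_schmidt_div_sqnorm:
  "ip n (\<lambda>i. gram_schmidt n Z k i / gs_sqnorm n k Z) (\<lambda>i. gram_schmidt n Z k i / gs_sqnorm n k Z) = 1 / gs_sqnorm n k Z"
proof -
  have "ip n (\<lambda>i. gram_schmidt n Z k i / gs_sqnorm n k Z) (\<lambda>i. gram_schmidt n Z k i / gs_sqnorm n k Z)
      = gs_sqnorm n k Z / (gs_sqnorm n k Z * gs_sqnorm n k Z)"
    by (simp add: ip_def gs_sqnorm_def sum_divide_distrib)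
  then show ?thesis by simp
qed

text \<open>With the regressors fixed, the coefficient is a linear functional of an independent
  Gaussian column, so it is centred normal. Averaging its characteristic function over the
  chi-square residual norm gives the mixture on the right.\<close>

lemma gs_last_coeff_cos:
  assumes "k \<le> n"
  shows "(\<integral>Z. cos (N * gs_last_coeff n k Z) \<partial>gauss_cols n (Suc (Suc k)))
       = (\<integral>y. exp (- (N\<^sup>2 / (2 * y))) \<partial>chi2 (n - k))"
proof -
  interpret P: prob_space "gauss_cols n (Suc (Suc k))" by (rule prob_space_gauss_cols)
  note [measurable] = gauss_cols_gs_last_coeff_measurable gauss_cols_gs_sqnorm_measurable[OF lessI]
  have "(\<integral>Z. cos (N * gs_last_coeff n k Z) \<partial>gauss_cols n (Suc (Suc k)))
      = (\<integral>Z. \<integral>w. cos (N * gs_last_coeff n k (Z(Suc k := w))) \<partial>gauss_vec n \<partial>gauss_cols n (Suc k))"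
    by (rule integral_gauss_cols_Suc) (rule P.integrable_bounded[where B=1], auto)
  also have "\<dots> = (\<integral>Z. exp (- (N\<^sup>2 / (2 * gs_sqnorm n k Z))) \<partial>gauss_cols n (Suc k))"
  proof (intro Bochner_Integration.integral_cong refl)
    fix Z
    let ?v = "\<lambda>i. gram_schmidt n Z k i / gs_sqnorm n k Z"
    have "(\<integral>w. cos (N * gs_last_coeff n k (Z(Suc k := w))) \<partial>gauss_vec n)
        = (\<integral>w. cos (\<Sum>i<n. (N * ?v i) * w i) \<partial>gauss_vec n)"
      unfolding gs_last_coeff_upd ip_def sum_distrib_left mult.assoc ..
    also have "\<dots> = exp (- (\<Sum>i<n. (N * ?v i)\<^sup>2) / 2)"
      by (rule std_gaussian_cos[OF std_gaussian_gauss_vec])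
    also have "(\<Sum>i<n. (N * ?v i)\<^sup>2) = N\<^sup>2 * ip n ?v ?v"
      unfolding ip_def sum_distrib_left by (simp add: power2_eq_square mult_ac)
    finally show "(\<integral>w. cos (N * gs_last_coeff n k (Z(Suc k := w))) \<partial>gauss_vec n) = exp (- (N\<^sup>2 / (2 * gs_sqnorm n k Z)))"
      unfolding ip_gram_schmidt_div_sqnorm by (simp add: mult.commute del: fun_upd_apply)
  qed
  also have "\<dots> = (\<integral>y. exp (- (N\<^sup>2 / (2 * y))) \<partial>distr (gauss_cols n (Suc k)) borel (gs_sqnorm n k))"
    by (subst integral_distr) auto
  finally show ?thesis unfolding gs_sqnorm_law_gauss_cols[OF assms] .
qed

lemma gs_last_coeff_square:
  assumes "k \<le> n"
  shows "(\<integral>\<^sup>+Z. ennreal ((gs_last_coeff n k Z)\<^sup>2) \<partial>gauss_cols n (Suc (Suc k)))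
       = (\<integral>\<^sup>+y. ennreal (1 / y) \<partial>chi2 (n - k))"
proof -
  note [measurable] = gauss_cols_gs_last_coeff_measurable gauss_cols_gs_sqnorm_measurable[OF lessI]
  have "(\<integral>\<^sup>+Z. ennreal ((gs_last_coeff n k Z)\<^sup>2) \<partial>gauss_cols n (Suc (Suc k)))
      = (\<integral>\<^sup>+Z. \<integral>\<^sup>+w. ennreal ((gs_last_coeff n k (Z(Suc k := w)))\<^sup>2) \<partial>gauss_vec n \<partial>gauss_cols n (Suc k))"
    by (rule nn_integral_gauss_cols_Suc) measurable
  also have "\<dots> = (\<integral>\<^sup>+Z. ennreal (1 / gs_sqnorm n k Z) \<partial>gauss_cols n (Suc k))"
    unfolding gs_last_coeff_upd by (simp add: nn_integral_ip_square ip_gram_schmidt_div_sqnorm)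
  also have "\<dots> = (\<integral>\<^sup>+y. ennreal (1 / y) \<partial>distr (gauss_cols n (Suc k)) borel (gs_sqnorm n k))"
    by (subst nn_integral_distr) auto
  finally show ?thesis unfolding gs_sqnorm_law_gauss_cols[OF assms] .
qed

lemma chi2_ratio_nonneg: "AE p in chi2 a \<Otimes>\<^sub>M chi2 b. 0 \<le> fst p / snd p"
proof -
  interpret A: prob_space "chi2 a" by (rule prob_space_chi2)
  interpret B: prob_space "chi2 b" by (rule prob_space_chi2)
  interpret AB: pair_prob_space "chi2 a" "chi2 b" by unfold_locales
  show ?thesis
  proof (rule AB.AE_pair_measure)
    show "{p \<in> space (chi2 a \<Otimes>\<^sub>M chi2 b). 0 \<le> fst p / snd p} \<in> sets (chi2 a \<Otimes>\<^sub>M chi2 b)"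
      by measurable
    show "AE x in chi2 a. AE y in chi2 b. 0 \<le> fst (x, y) / snd (x, y)"
      using chi2_nonneg[of a]
    proof eventually_elim
      case (elim x)
      show ?case using chi2_nonneg[of b] by eventually_elim (use elim in simp)
    qed
  qed
qed

section \<open>The law of the least-squares coefficients\<close>

text \<open>Columns below \<open>k\<close> are the whitened regressors and column \<open>k\<close>
  is the response of the regression, later taken to be the standardised error. Thus \<open>T\<close>
  is an estimation error whose true value is zero.\<close>

locale gaussian_least_squares =
  fixes M :: "'w measure" and n k :: nat and X :: "nat \<times> nat \<Rightarrow> 'w \<Rightarrow> real" and T :: "'w \<Rightarrow> nat \<Rightarrow> real"
  assumes gaussian: "std_gaussian M ({..<Suc k} \<times> {..<n}) X"
    and kn: "k < n"
    and T_measurable: "j < k \<Longrightarrow> (\<lambda>\<omega>. T \<omega> j) \<in> borel_measurable M"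
    and T_min: "\<omega> \<in> space M \<Longrightarrow>
        ls_rss n (\<lambda>j i. X (j, i) \<omega>) k (T \<omega>)
      \<le> ls_rss n (\<lambda>j i. X (j, i) \<omega>) k b"
begin

sublocale prob_space M using gaussian by (simp add: std_gaussian_def)

lemma X_measurable: "j < Suc k \<Longrightarrow> i < n \<Longrightarrow> X (j, i) \<in> borel_measurable M"
  using gaussian by (auto simp: std_gaussian_def)

lemma residual_law:
  "distr M borel (\<lambda>\<omega>. ls_rss n (\<lambda>j i. X (j, i) \<omega>) k (T \<omega>))
     = chi2 (n - k)"
proof -
  have "distr M borel (\<lambda>\<omega>. ls_rss n (\<lambda>j i. X (j, i) \<omega>) k (T \<omega>))
      = distr M borel (\<lambda>\<omega>. gs_sqnorm n k (\<lambda>j i. X (j, i) \<omega>))"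
    by (rule distr_cong) (auto simp: gs_sqnorm_def least_squares_residual(1)[OF T_min])
  then show ?thesis using gs_sqnorm_law(1)[OF gaussian] kn by simp
qed

text \<open>Reflecting the columns so that \<open>h\<close> becomes a multiple of the last unit vector turns \<open>h \<bullet> T\<close>
  into a multiple of the last coefficient of a regression with the same law.\<close>

lemma projection_law:
  assumes k: "k = Suc k'"
  shows "distr M borel (\<lambda>\<omega>. \<Sum>l<k. h l * T \<omega> l)
       = distr (gauss_cols n (Suc k)) borel (\<lambda>Z. sqrt (\<Sum>l<k. (h l)\<^sup>2) * gs_last_coeff n k' Z)"
proof -
  have le: "{..k'} = {..<k}" "\<And>a. a \<le> k' \<longleftrightarrow> a < k" using k by auto
  obtain H where H0: "(\<forall>a<k. \<forall>b<k. (\<Sum>l<k. H a l * H b l) = of_bool (a = b)) \<and>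
      (\<forall>a<k. \<forall>b<k. H a b = H b a) \<and>
      (\<forall>a<k. (\<Sum>l<k. H a l * h l) = (if a = k' then sqrt (\<Sum>l<k. (h l)\<^sup>2) else 0))"
    using reflection_to_last[of k' h] unfolding le by (rule exE)
  have H: "\<And>a b. a < k \<Longrightarrow> b < k \<Longrightarrow> (\<Sum>l<k. H a l * H b l) = of_bool (a = b)"
    "\<And>a b. a < k \<Longrightarrow> b < k \<Longrightarrow> H a b = H b a"
    "\<And>a. a < k \<Longrightarrow> (\<Sum>l<k. H a l * h l) = (if a = k' then sqrt (\<Sum>l<k. (h l)\<^sup>2) else 0)"
    by (rule H0[THEN conjunct1, rule_format], assumption+)
       (rule H0[THEN conjunct2, THEN conjunct1, rule_format], assumption+,
        rule H0[THEN conjunct2, THEN conjunct2, rule_format], assumption)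
  define N where "N = sqrt (\<Sum>l<k. (h l)\<^sup>2)"
  \<comment> \<open>The reflection is extended by the identity on index \<open>k\<close>: regressors
    are mixed, the response column stays as it is.\<close>
  define E where "E a b = (if a < k \<and> b < k then H a b else of_bool (a = b))" for a b :: nat
  have E: "(\<Sum>l<Suc k. E a l * E b l) = of_bool (a = b)" if "a < Suc k" "b < Suc k" for a b
  proof -
    have "(\<Sum>l<k. E a l * E b l) = (if a < k \<and> b < k then of_bool (a = b) else 0)"
    proof (cases "a < k \<and> b < k")
      case True
      then show ?thesis using H(1)[of a b] by (simp add: E_def)
    next
      case False
      then have "E a l * E b l = 0" if "l < k" for l
        using that \<open>a < Suc k\<close> \<open>b < Suc k\<close> by (auto simp: E_def)
      then have "(\<Sum>l<k. E a l * E b l) = 0" by (intro sum.neutral) auto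
      then show ?thesis using False by (simp only: if_False)
    qed
    then show ?thesis using that by (auto simp: E_def)
  qed
  let ?I = "{..<Suc k} \<times> {..<n}"
  define X' where "X' p \<omega> = (\<Sum>q\<in>?I. (E (fst p) (fst q) * of_bool (snd p = snd q)) * X q \<omega>)" for p \<omega>
  have G': "std_gaussian M ?I X'"
    unfolding X'_def
  proof (rule std_gaussian_linear[OF gaussian])
    fix a b assume a: "a \<in> ?I" and b: "b \<in> ?I"
    have "(\<Sum>q\<in>?I. (E (fst a) (fst q) * of_bool (snd a = snd q)) * (E (fst b) (fst q) * of_bool (snd b = snd q)))
        = (\<Sum>l<Suc k. \<Sum>i<n. (E (fst a) l * E (fst b) l) * (of_bool (snd a = snd b) * of_bool (i = snd a)))"
      by (simp only: sum.cartesian_product split_beta) (intro sum.cong refl, auto)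
    also have "\<dots> = (\<Sum>l<Suc k. (E (fst a) l * E (fst b) l) * of_bool (snd a = snd b))"
      using a by (intro sum.cong refl) (auto simp: sum_distrib_left[symmetric] sum_lessThan_of_bool[of "\<lambda>_. 1", simplified])
    also have "\<dots> = of_bool (a = b)"
      using E[of "fst a" "fst b"] a b by (auto simp: sum_distrib_right[symmetric] prod_eq_iff simp del: sum.lessThan_Suc)
    finally show "(\<Sum>q\<in>?I. (E (fst a) (fst q) * of_bool (snd a = snd q)) * (E (fst b) (fst q) * of_bool (snd b = snd q)))
        = of_bool (a = b)" .
  qed simp
  have X'_eq: "X' (j, i) \<omega> = (\<Sum>l<Suc k. E j l * X (l, i) \<omega>)" if "i < n" for j i \<omega>
  proof -
    have "X' (j, i) \<omega> = (\<Sum>l<Suc k. \<Sum>i'<n. (E j l * X (l, i') \<omega>) * of_bool (i' = i))"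
      unfolding X'_def by (simp only: sum.cartesian_product split_beta) (intro sum.cong refl, auto)
    then show ?thesis using that by (simp add: sum_lessThan_of_bool del: sum.lessThan_Suc)
  qed
  let ?Z = "\<lambda>\<omega> j i. X (j, i) \<omega>" and ?Z' = "\<lambda>\<omega> j i. X' (j, i) \<omega>"
  have Z'k: "?Z' \<omega> k i = ?Z \<omega> k i" if "i < n" for \<omega> i
    unfolding X'_eq[OF that] by (simp add: E_def)
  have Z'j: "?Z' \<omega> j i = (\<Sum>l<k. H j l * ?Z \<omega> l i)" if "i < n" "j < k" for \<omega> i j
    unfolding X'_eq[OF that(1)] using that by (simp add: E_def)
  have res: "ls_residual (?Z' \<omega>) k c i = ls_residual (?Z \<omega>) k (\<lambda>l. \<Sum>j<k. c j * H j l) i" if "i < n" for \<omega> c i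
  proof -
    have "(\<Sum>j<k. c j * ?Z' \<omega> j i) = (\<Sum>j<k. \<Sum>l<k. c j * H j l * ?Z \<omega> l i)"
      using that by (simp add: Z'j sum_distrib_left mult.assoc)
    also have "\<dots> = (\<Sum>l<k. (\<Sum>j<k. c j * H j l) * ?Z \<omega> l i)"
      by (subst sum.swap) (simp add: sum_distrib_right)
    finally show ?thesis unfolding ls_residual_def using Z'k[OF that] by simp
  qed
  \<comment> \<open>The minimizer in reflected coordinates. Since \<open>H\<close> is symmetric with
    orthonormal rows it is its own inverse, so applying it again recovers \<open>T\<close> and the
    residuals agree.\<close>
  define T' where "T' \<omega> j = (\<Sum>l<k. H j l * T \<omega> l)" for \<omega> j
  have T'T: "(\<Sum>j<k. T' \<omega> j * H j l) = T \<omega> l" if "l < k" for \<omega> l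
  proof -
    have "(\<Sum>j<k. T' \<omega> j * H j l) = (\<Sum>j<k. \<Sum>m<k. T \<omega> m * (H m j * H l j))"
      unfolding T'_def sum_distrib_right using that by (intro sum.cong refl) (simp add: H(2) mult_ac)
    also have "\<dots> = (\<Sum>m<k. T \<omega> m * (\<Sum>j<k. H m j * H l j))"
      unfolding sum_distrib_left by (rule sum.swap)
    also have "\<dots> = T \<omega> l" using that by (simp add: H(1) sum_lessThan_of_bool)
    finally show ?thesis .
  qed
  have resT: "ls_residual (?Z' \<omega>) k (T' \<omega>) i = ls_residual (?Z \<omega>) k (T \<omega>) i" if "i < n" for \<omega> i
    unfolding res[OF that] using T'T by (simp add: ls_residual_def)
  have min': "ls_rss n (?Z' \<omega>) k (T' \<omega>)
      \<le> ls_rss n (?Z' \<omega>) k c" if "\<omega> \<in> space M" for \<omega> c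
  proof -
    have "ls_rss n (?Z' \<omega>) k (T' \<omega>)
        = ls_rss n (?Z \<omega>) k (T \<omega>)"
      by (rule ip_cong) (auto simp: resT)
    also have "\<dots> \<le> ls_rss n (?Z \<omega>) k (\<lambda>l. \<Sum>j<k. c j * H j l)"
      by (rule T_min[OF that])
    also have "\<dots> = ls_rss n (?Z' \<omega>) k c"
      by (rule ip_cong) (auto simp: res)
    finally show ?thesis .
  qed
  have proj: "(\<Sum>l<k. h l * T \<omega> l) = N * T' \<omega> k'" for \<omega>
  proof -
    have "(\<Sum>l<k. h l * T \<omega> l) = (\<Sum>l<k. h l * (\<Sum>j<k. T' \<omega> j * H j l))"
      by (intro sum.cong refl) (simp add: T'T)
    also have "\<dots> = (\<Sum>j<k. T' \<omega> j * (\<Sum>l<k. H j l * h l))"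
      unfolding sum_distrib_left by (subst sum.swap) (simp add: mult_ac)
    also have "\<dots> = (\<Sum>j<k. T' \<omega> j * N * of_bool (j = k'))"
      by (intro sum.cong refl) (simp add: H(3) N_def)
    also have "\<dots> = N * T' \<omega> k'" using k by (simp add: sum_lessThan_of_bool)
    finally show ?thesis .
  qed
  \<comment> \<open>Only almost sure, because the formula for the last coefficient divides by a
    residual norm; equality of the laws is unaffected.\<close>
  have ae: "AE \<omega> in M. (\<Sum>l<k. h l * T \<omega> l) = N * gs_last_coeff n k' (?Z' \<omega>)"
  proof -
    have "AE \<omega> in M. 0 < gs_sqnorm n k' (?Z' \<omega>)"
      by (rule gs_sqnorm_pos[OF G']) (use kn k in auto)
    then show ?thesis using AE_space
    proof eventually_elim
    fix \<omega> assume w: "0 < gs_sqnorm n k' (?Z' \<omega>)" "\<omega> \<in> space M"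
    have "T' \<omega> k' = gs_last_coeff n k' (?Z' \<omega>)"
      using least_squares_last_coeff[of n "?Z' \<omega>" k' "T' \<omega>"] min'[OF w(2)] w(1)
      by (simp add: k gs_last_coeff_def gs_sqnorm_def)
    then show "(\<Sum>l<k. h l * T \<omega> l) = N * gs_last_coeff n k' (?Z' \<omega>)" using proj by simp
    qed
  qed
  have loc: "N * gs_last_coeff n k' Z = N * gs_last_coeff n k' Z'"
    if "\<And>j i. j < Suc k \<Longrightarrow> i < n \<Longrightarrow> Z j i = Z' j i" for Z Z'
    using gs_last_coeff_cong[of k' n Z Z'] that k by simp
  have F: "(\<lambda>Z. N * gs_last_coeff n k' Z) \<in> borel_measurable (gauss_cols n (Suc k))"
    using gauss_cols_gs_last_coeff_measurable[of n k'] k by simp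
  note tr = std_gaussian_transfer[OF G' F loc]
  have "distr M borel (\<lambda>\<omega>. \<Sum>l<k. h l * T \<omega> l) = distr M borel (\<lambda>\<omega>. N * gs_last_coeff n k' (?Z' \<omega>))"
    by (rule distr_cong_AE) (use ae tr(2) T_measurable in \<open>auto intro!: borel_measurable_sum borel_measurable_times\<close>)
  also have "\<dots> = distr (gauss_cols n (Suc k)) borel (\<lambda>Z. N * gs_last_coeff n k' Z)" by (rule tr(1))
  finally show ?thesis by (simp add: N_def)
qed

lemma projection_cos:
  assumes k: "0 < k"
  shows "(\<integral>\<omega>. cos (\<Sum>l<k. h l * T \<omega> l) \<partial>M) = (\<integral>y. exp (- ((\<Sum>l<k. (h l)\<^sup>2) / (2 * y))) \<partial>chi2 (n - k + 1))"
proof -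
  obtain k' where k': "k = Suc k'" using k by (cases k) auto
  note [measurable] = gauss_cols_gs_last_coeff_measurable
  have m: "(\<lambda>\<omega>. \<Sum>l<k. h l * T \<omega> l) \<in> borel_measurable M"
    using T_measurable by (intro borel_measurable_sum borel_measurable_times) auto
  have "(\<integral>\<omega>. cos (\<Sum>l<k. h l * T \<omega> l) \<partial>M) = (\<integral>x. cos x \<partial>distr M borel (\<lambda>\<omega>. \<Sum>l<k. h l * T \<omega> l))"
    by (subst integral_distr[OF m]) auto
  also have "\<dots> = (\<integral>Z. cos (sqrt (\<Sum>l<k. (h l)\<^sup>2) * gs_last_coeff n k' Z) \<partial>gauss_cols n (Suc (Suc k')))"
    unfolding projection_law[OF k'] using k' by (subst integral_distr) auto
  also have "\<dots> = (\<integral>y. exp (- ((sqrt (\<Sum>l<k. (h l)\<^sup>2))\<^sup>2 / (2 * y))) \<partial>chi2 (n - k'))"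
    by (rule gs_last_coeff_cos) (use kn k' in simp)
  \<comment> \<open>The last regressor is adjusted for \<open>k' = k - 1\<close> others, which
    leaves one degree of freedom more than the \<open>n - k\<close> of the residual sum of
    squares.\<close>
  also have "n - k' = n - k + 1" using kn k' by simp
  finally show ?thesis by (simp add: sum_nonneg)
qed

text \<open>The projection law in the direction of a unit vector. The condition
  \<open>Suc k < n\<close> leaves at least three degrees of freedom in \<open>n - k + 1\<close>, as
  the inverse chi-square moment requires.\<close>

lemma coeff_square:
  assumes j: "j < k" and nk: "Suc k < n"
  shows "(\<integral>\<^sup>+\<omega>. ennreal ((T \<omega> j)\<^sup>2) \<partial>M) = ennreal (1 / (real n - real k - 1))"
proof -
  obtain k' where k': "k = Suc k'" using j by (cases k) auto
  note [measurable] = gauss_cols_gs_last_coeff_measurable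
  have e: "(\<Sum>l<k. of_bool (l = j) * T \<omega> l) = T \<omega> j" for \<omega>
    using j sum_lessThan_of_bool[of "T \<omega>" j k] by (simp add: mult.commute)
  have n1: "(\<Sum>l<k. (of_bool (l = j) :: real)\<^sup>2) = 1"
    using j sum_lessThan_of_bool[of "\<lambda>_. 1" j k] by (simp add: power2_eq_square)
  note law = projection_law[OF k', of "\<lambda>l. of_bool (l = j)", unfolded e n1]
  have "(\<integral>\<^sup>+\<omega>. ennreal ((T \<omega> j)\<^sup>2) \<partial>M) = (\<integral>\<^sup>+x. ennreal (x\<^sup>2) \<partial>distr M borel (\<lambda>\<omega>. T \<omega> j))"
    using T_measurable[OF j] by (subst nn_integral_distr) auto
  also have "\<dots> = (\<integral>\<^sup>+Z. ennreal ((gs_last_coeff n k' Z)\<^sup>2) \<partial>gauss_cols n (Suc (Suc k')))"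
    unfolding law using k' by (subst nn_integral_distr) auto
  also have "\<dots> = (\<integral>\<^sup>+y. ennreal (1 / y) \<partial>chi2 (n - k'))"
    by (rule gs_last_coeff_square) (use kn k' in simp)
  also have "\<dots> = ennreal (1 / (real (n - k') - 2))"
    by (rule chi2_inverse_moment) (use nk k' in simp)
  also have "real (n - k') - 2 = real n - real k - 1" using nk k' by simp
  finally show ?thesis .
qed

lemma error_mean:
  assumes "Suc k < n"
  shows "(\<integral>\<^sup>+\<omega>. ennreal (\<Sum>j<k. (T \<omega> j)\<^sup>2) \<partial>M) = ennreal (real k / (real n - real k - 1))"
proof -
  have "(\<integral>\<^sup>+\<omega>. ennreal (\<Sum>j<k. (T \<omega> j)\<^sup>2) \<partial>M) = (\<integral>\<^sup>+\<omega>. (\<Sum>j<k. ennreal ((T \<omega> j)\<^sup>2)) \<partial>M)"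
    by (simp add: sum_ennreal)
  also have "\<dots> = (\<Sum>j<k. \<integral>\<^sup>+\<omega>. ennreal ((T \<omega> j)\<^sup>2) \<partial>M)"
    using T_measurable by (intro nn_integral_sum) auto
  also have "\<dots> = (\<Sum>j<k. ennreal (1 / (real n - real k - 1)))"
    using assms by (intro sum.cong refl coeff_square) auto
  also have "\<dots> = ennreal (real k / (real n - real k - 1))"
    using assms by (subst sum_ennreal) auto
  finally show ?thesis .
qed

text \<open>An independent Gaussian vector \<open>h\<close> linearises the norm:
  \<open>exp (- l * |T|\<^sup>2)\<close> is the mean of \<open>cos (sqrt (2 * l) * (h \<bullet> T))\<close> over \<open>h\<close>, and for fixed \<open>h\<close>
  the law of \<open>h \<bullet> T\<close> is known.\<close>

lemma error_laplace:
  assumes k: "0 < k" and l: "0 \<le> l"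
  shows "(\<integral>\<omega>. exp (- l * (\<Sum>j<k. (T \<omega> j)\<^sup>2)) \<partial>M)
       = (\<integral>p. exp (- l * (fst p / snd p)) \<partial>(chi2 k \<Otimes>\<^sub>M chi2 (n - k + 1)))"
proof -
  define r where "r = sqrt (2 * l)"
  have r: "r\<^sup>2 = 2 * l" using l by (simp add: r_def)
  let ?d = "n - k + 1"
  interpret V: prob_space "gauss_vec k" by (rule prob_space_gauss_vec)
  interpret A: prob_space "chi2 k" by (rule prob_space_chi2)
  interpret B: prob_space "chi2 ?d" by (rule prob_space_chi2)
  interpret MV: pair_prob_space M "gauss_vec k" by unfold_locales
  interpret AB: pair_prob_space "chi2 k" "chi2 ?d" by unfold_locales
  have m1: "(\<lambda>p. \<Sum>j<k. (r * snd p j) * T (fst p) j) \<in> borel_measurable (M \<Otimes>\<^sub>M gauss_vec k)"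
  proof (intro borel_measurable_sum borel_measurable_times borel_measurable_const)
    fix j assume j: "j \<in> {..<k}"
    show "(\<lambda>p. snd p j) \<in> borel_measurable (M \<Otimes>\<^sub>M gauss_vec k)"
      using j by (intro measurable_compose[OF measurable_snd gauss_vec_component]) auto
    show "(\<lambda>p. T (fst p) j) \<in> borel_measurable (M \<Otimes>\<^sub>M gauss_vec k)"
      using j by (intro measurable_compose[OF measurable_fst T_measurable]) auto
  qed
  have "(\<integral>\<omega>. exp (- l * (\<Sum>j<k. (T \<omega> j)\<^sup>2)) \<partial>M) = (\<integral>\<omega>. \<integral>h. cos (\<Sum>j<k. (r * h j) * T \<omega> j) \<partial>gauss_vec k \<partial>M)"
  proof (intro Bochner_Integration.integral_cong refl)
    fix \<omega>
    have "(\<integral>h. cos (\<Sum>j<k. (r * T \<omega> j) * h j) \<partial>gauss_vec k) = exp (- (\<Sum>j<k. (r * T \<omega> j)\<^sup>2) / 2)"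
      by (rule std_gaussian_cos[OF std_gaussian_gauss_vec])
    also have "(\<Sum>j<k. (r * T \<omega> j)\<^sup>2) = 2 * l * (\<Sum>j<k. (T \<omega> j)\<^sup>2)"
      by (simp only: power_mult_distrib r sum_distrib_left)
    finally show "exp (- l * (\<Sum>j<k. (T \<omega> j)\<^sup>2)) = (\<integral>h. cos (\<Sum>j<k. (r * h j) * T \<omega> j) \<partial>gauss_vec k)"
      by (simp add: mult_ac)
  qed
  also have "\<dots> = (\<integral>h. \<integral>\<omega>. cos (\<Sum>j<k. (r * h j) * T \<omega> j) \<partial>M \<partial>gauss_vec k)"
    by (rule MV.Fubini_integral[symmetric], rule MV.P.integrable_bounded[where B=1])
       (use m1 in \<open>auto simp: split_beta\<close>)
  also have "\<dots> = (\<integral>h. \<integral>y. exp (- ((\<Sum>j<k. (r * h j)\<^sup>2) / (2 * y))) \<partial>chi2 ?d \<partial>gauss_vec k)"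
    by (simp only: projection_cos[OF k])
  also have "\<dots> = (\<integral>h. \<integral>y. exp (- l * ((\<Sum>j<k. (h j)\<^sup>2) / y)) \<partial>chi2 ?d \<partial>gauss_vec k)"
    by (simp add: power_mult_distrib r flip: sum_distrib_left)
  also have "\<dots> = (\<integral>x. \<integral>y. exp (- l * (x / y)) \<partial>chi2 ?d \<partial>chi2 k)"
  proof -
    have "(\<lambda>x. \<integral>y. exp (- l * (x / y)) \<partial>chi2 ?d) \<in> borel_measurable borel"
      by (rule B.borel_measurable_lebesgue_integral) measurable
    then show ?thesis unfolding chi2_def[of k] by (subst integral_distr) auto
  qed
  also have "\<dots> = (\<integral>p. exp (- l * (fst p / snd p)) \<partial>(chi2 k \<Otimes>\<^sub>M chi2 ?d))"
  proof -
    note nn = chi2_ratio_nonneg[of k ?d]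
    have "integrable (chi2 k \<Otimes>\<^sub>M chi2 ?d) (\<lambda>p. exp (- l * (fst p / snd p)))"
      by (rule AB.P.integrable_const_bound[where B=1]) (use nn in eventually_elim, use l in \<open>auto simp del: times_divide_eq_right\<close>)
    from AB.integral_fst'[OF this] show ?thesis by simp
  qed
  finally show ?thesis .
qed

text \<open>Passing to \<open>exp (- q)\<close> makes both variables bounded; the moments of the
  transforms are Laplace transforms at integers, given by \<open>error_laplace\<close>. The map
  \<open>- ln\<close> then restores the original variables.\<close>

lemma error_law:
  assumes k: "0 < k"
  shows "distr M borel (\<lambda>\<omega>. \<Sum>j<k. (T \<omega> j)\<^sup>2)
       = distr (chi2 k \<Otimes>\<^sub>M chi2 (n - k + 1)) borel (\<lambda>p. fst p / snd p)"
proof -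
  let ?R = "chi2 k \<Otimes>\<^sub>M chi2 (n - k + 1)"
  let ?Q = "\<lambda>\<omega>. \<Sum>j<k. (T \<omega> j)\<^sup>2"
  interpret A: prob_space "chi2 k" by (rule prob_space_chi2)
  interpret B: prob_space "chi2 (n - k + 1)" by (rule prob_space_chi2)
  interpret AB: pair_prob_space "chi2 k" "chi2 (n - k + 1)" by unfold_locales
  have Q[measurable]: "?Q \<in> borel_measurable M"
    using T_measurable by (intro borel_measurable_sum borel_measurable_power) auto
  have R[measurable]: "(\<lambda>p. fst p / snd p) \<in> borel_measurable ?R"
    by measurable
  note nn = chi2_ratio_nonneg[of k "n - k + 1"]
  have pw: "exp (- q) ^ m = exp (- real m * q)" for q and m :: nat
    by (simp add: exp_of_nat_mult[symmetric])
  have eq: "distr M borel (\<lambda>\<omega>. exp (- ?Q \<omega>)) = distr ?R borel (\<lambda>p. exp (- (fst p / snd p)))"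
  proof (rule law_eq_of_moments)
    show "AE p in ?R. \<bar>exp (- (fst p / snd p))\<bar> \<le> 1" using nn by eventually_elim simp
    show "(\<integral>\<omega>. exp (- ?Q \<omega>) ^ m \<partial>M) = (\<integral>p. exp (- (fst p / snd p)) ^ m \<partial>?R)" for m
      unfolding pw by (rule error_laplace[OF k]) simp
    show "prob_space ?R" by (rule AB.P.prob_space_axioms)
  qed (auto simp: sum_nonneg intro: prob_space_axioms)
  have "distr (distr M borel (\<lambda>\<omega>. exp (- ?Q \<omega>))) borel (\<lambda>v. - ln v) = distr M borel ?Q"
    by (subst distr_distr) (auto simp: comp_def)
  moreover have "distr (distr ?R borel (\<lambda>p. exp (- (fst p / snd p)))) borel (\<lambda>v. - ln v)
      = distr ?R borel (\<lambda>p. fst p / snd p)"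
    by (subst distr_distr) (auto simp: comp_def)
  ultimately show ?thesis using eq by simp
qed

section \<open>Deviation bounds for the residual sum of squares and the estimation error\<close>

lemma residual_tail:
  assumes "0 \<le> \<delta>" "\<delta> \<le> 1"
  shows "emeasure M {\<omega>\<in>space M. real (n - k) * \<delta> \<le>
      \<bar>ls_rss n (\<lambda>j i. X (j, i) \<omega>) k (T \<omega>) - real (n - k)\<bar>}
    \<le> ennreal (2 * exp (- (real (n - k) * \<delta>\<^sup>2) / 16))" (is "emeasure M ?A \<le> _")
proof -
  let ?r = "\<lambda>\<omega>. ls_rss n (\<lambda>j i. X (j, i) \<omega>) k (T \<omega>)"
  have m: "?r \<in> borel_measurable M"
    unfolding ls_residual_def using X_measurable T_measurable
    by (intro measurable_ip borel_measurable_diff borel_measurable_sum borel_measurable_times) auto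
  have "emeasure M ?A = emeasure (distr M borel ?r) {y. real (n - k) * \<delta> \<le> \<bar>y - real (n - k)\<bar>}"
    using m by (subst emeasure_distr) (auto intro!: arg_cong2[where f=emeasure])
  also have "\<dots> \<le> ennreal (2 * exp (- ((real (n - k) * \<delta>)\<^sup>2) / (16 * real (n - k))))"
    unfolding residual_law using assms kn by (intro chi2_tail) (auto simp: mult_left_le)
  also have "- ((real (n - k) * \<delta>)\<^sup>2) / (16 * real (n - k)) = - (real (n - k) * \<delta>\<^sup>2) / 16"
    using kn by (simp add: power2_eq_square del: of_nat_diff)
  finally show ?thesis .
qed

lemma error_tail:
  assumes "0 < \<delta>" "\<delta> \<le> 1 / 2"
  shows "emeasure M {\<omega>\<in>space M. 4 * real n * \<delta> / real (n - k + 1)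
      < \<bar>(\<Sum>j<k. (T \<omega> j)\<^sup>2) - real k / real (n - k + 1)\<bar>}
    \<le> ennreal (4 * exp (- (real (n - k) * \<delta>\<^sup>2) / 16))" (is "emeasure M ?A \<le> _")
proof (cases "k = 0")
  \<comment> \<open>Without regressors the compared quantities are both zero, and the strict
    inequality makes the event empty.\<close>
  case True
  have "0 \<le> 4 * real n * \<delta> / real (n - k + 1)" using assms by simp
  with True have "?A = {}" by (simp add: not_less)
  then show ?thesis by (simp only: emeasure_empty) simp
next
  case False
  define d where "d = n - k + 1"
  have d: "0 < real d" "n - k \<le> d" by (auto simp: d_def)
  let ?R = "chi2 k \<Otimes>\<^sub>M chi2 d"
  let ?Q = "\<lambda>\<omega>. \<Sum>j<k. (T \<omega> j)\<^sup>2"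
  let ?S = "{q. 4 * real n * \<delta> / real d < \<bar>q - real k / real d\<bar>}"
  let ?E = "exp (- (real (n - k) * \<delta>\<^sup>2) / 16)"
  interpret A: prob_space "chi2 k" by (rule prob_space_chi2)
  interpret B: prob_space "chi2 d" by (rule prob_space_chi2)
  have Q[measurable]: "?Q \<in> borel_measurable M"
    using T_measurable by (intro borel_measurable_sum borel_measurable_power) auto
  have S[measurable]: "?S \<in> sets borel" by measurable
  \<comment> \<open>The numerator is controlled on the scale \<open>n\<close>, since relative
    accuracy would be too much to ask of a chi-square variable with few degrees of freedom; the
    denominator is controlled relative to \<open>d\<close>.\<close>
  define X1 where "X1 = {x. real n * \<delta> \<le> \<bar>x - real k\<bar>}"
  define Y1 where "Y1 = {y. real d * \<delta> \<le> \<bar>y - real d\<bar>}"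
  have [measurable]: "X1 \<in> sets borel" "Y1 \<in> sets borel" unfolding X1_def Y1_def by measurable
  have "emeasure M ?A = emeasure (distr M borel ?Q) ?S"
    by (subst emeasure_distr) (auto simp: d_def intro!: arg_cong2[where f=emeasure])
  also have "\<dots> = emeasure ?R ((\<lambda>p. fst p / snd p) -` ?S \<inter> space ?R)"
  proof -
    have "distr M borel ?Q = distr ?R borel (\<lambda>p. fst p / snd p)"
      unfolding d_def by (rule error_law) (use False in simp)
    moreover have "(\<lambda>p. fst p / snd p) \<in> borel_measurable ?R" by measurable
    ultimately show ?thesis using S by (simp only: emeasure_distr)
  qed
  also have "\<dots> \<le> emeasure ?R (X1 \<times> UNIV \<union> UNIV \<times> Y1)"
  proof (rule emeasure_mono)
    show "(\<lambda>p. fst p / snd p) -` ?S \<inter> space ?R \<subseteq> X1 \<times> UNIV \<union> UNIV \<times> Y1"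
    proof
      fix p assume p: "p \<in> (\<lambda>p. fst p / snd p) -` ?S \<inter> space ?R"
      obtain x y where xy: "p = (x, y)" by (cases p)
      show "p \<in> X1 \<times> UNIV \<union> UNIV \<times> Y1"
      proof (rule ccontr)
        assume "p \<notin> X1 \<times> UNIV \<union> UNIV \<times> Y1"
        then have x: "\<bar>x - real k\<bar> < real n * \<delta>" and y: "\<bar>y - real d\<bar> < real d * \<delta>"
          by (auto simp: xy X1_def Y1_def)
        \<comment> \<open>Here \<open>\<delta> \<le> 1 / 2\<close> keeps the denominator above
          \<open>d / 2\<close>. Two error terms and this factor two make up the constant 4 of the
          event.\<close>
        have "real d * \<delta> \<le> real d * (1 / 2)" using assms d by (intro mult_left_mono) auto
        moreover have "real d - y < real d * \<delta>" using y by simp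
        ultimately have y2: "real d / 2 \<le> y" "0 < y" using d(1) by linarith+
        have "x / y - real k / real d = ((x - real k) * real d + real k * (real d - y)) / (y * real d)"
          using y2 d by (simp add: field_simps)
        then have "\<bar>x / y - real k / real d\<bar> = \<bar>(x - real k) * real d + real k * (real d - y)\<bar> / (y * real d)"
          using y2 d by (simp add: abs_mult)
        also have "\<dots> \<le> (2 * real n * real d * \<delta>) / (y * real d)"
        proof (rule divide_right_mono)
          have "\<bar>(x - real k) * real d + real k * (real d - y)\<bar> \<le> \<bar>x - real k\<bar> * real d + real k * \<bar>y - real d\<bar>"
            using d by (simp add: abs_mult abs_minus_commute abs_triangle_ineq[THEN order_trans])
          also have "\<dots> \<le> (real n * \<delta>) * real d + real n * (real d * \<delta>)"
            using x y kn by (intro add_mono mult_mono) auto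
          finally show "\<bar>(x - real k) * real d + real k * (real d - y)\<bar> \<le> 2 * real n * real d * \<delta>"
            by (simp add: mult_ac)
        qed (use y2 d in auto)
        also have "\<dots> = (2 * real n * \<delta>) / y" using d by simp
        also have "\<dots> \<le> (2 * real n * \<delta>) / (real d / 2)"
          using y2 d assms by (intro divide_left_mono) auto
        also have "\<dots> = 4 * real n * \<delta> / real d" by simp
        finally show False using p by (simp add: xy)
      qed
    qed
  qed measurable
  also have "\<dots> \<le> emeasure ?R (X1 \<times> UNIV) + emeasure ?R (UNIV \<times> Y1)"
    by (rule emeasure_subadditive) measurable
  also have "emeasure ?R (X1 \<times> UNIV) = emeasure (chi2 k) X1"
    using B.emeasure_space_1 by (subst B.emeasure_pair_measure_Times) auto
  also have "emeasure ?R (UNIV \<times> Y1) = emeasure (chi2 d) Y1"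
    using A.emeasure_space_1 by (subst B.emeasure_pair_measure_Times) auto
  also have "emeasure (chi2 k) X1 + emeasure (chi2 d) Y1 \<le> ennreal (2 * ?E) + ennreal (2 * ?E)"
  proof (rule add_mono)
    have "emeasure (chi2 k) X1 \<le> ennreal (2 * exp (- ((real n * \<delta>)\<^sup>2) / (16 * real n)))"
      unfolding X1_def using assms kn by (intro chi2_tail) (auto simp: mult_left_le)
    also have "\<dots> \<le> ennreal (2 * ?E)"
    proof -
      have "((real n * \<delta>)\<^sup>2) / (16 * real n) = real n * \<delta>\<^sup>2 / 16" using kn by (simp add: power2_eq_square)
      moreover have "real (n - k) * \<delta>\<^sup>2 \<le> real n * \<delta>\<^sup>2" by (intro mult_right_mono) auto
      ultimately show ?thesis by (intro ennreal_leI) simp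
    qed
    finally show "emeasure (chi2 k) X1 \<le> ennreal (2 * ?E)" .
    have "emeasure (chi2 d) Y1 \<le> ennreal (2 * exp (- ((real d * \<delta>)\<^sup>2) / (16 * real d)))"
      unfolding Y1_def using assms d by (intro chi2_tail) (auto simp: mult_left_le)
    also have "\<dots> \<le> ennreal (2 * ?E)"
    proof -
      have "((real d * \<delta>)\<^sup>2) / (16 * real d) = real d * \<delta>\<^sup>2 / 16" using d by (simp add: power2_eq_square)
      moreover have "real (n - k) * \<delta>\<^sup>2 \<le> real d * \<delta>\<^sup>2" using d by (intro mult_right_mono) auto
      ultimately show ?thesis by (intro ennreal_leI) simp
    qed
    finally show "emeasure (chi2 d) Y1 \<le> ennreal (2 * ?E)" .
  qed
  finally show ?thesis by (simp flip: ennreal_plus)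
qed

end

section \<open>Whitening the regressors\<close>

definition bilin :: "nat set \<Rightarrow> (nat \<Rightarrow> nat \<Rightarrow> real) \<Rightarrow> (nat \<Rightarrow> real) \<Rightarrow> (nat \<Rightarrow> real) \<Rightarrow> real" where
  "bilin J B u v = (\<Sum>i\<in>J. \<Sum>j\<in>J. u i * B i j * v j)"

lemma bilin_commute: "(\<And>i j. B i j = B j i) \<Longrightarrow> bilin J B u v = bilin J B v u"
  unfolding bilin_def by (subst sum.swap) (simp add: mult_ac)

lemma bilin_diff: "bilin J B u (\<lambda>i. v i - w i) = bilin J B u v - bilin J B u w"
  by (simp add: bilin_def right_diff_distrib sum_subtractf)

lemma bilin_scale: "bilin J B u (\<lambda>i. c * v i) = c * bilin J B u v"
  by (simp add: bilin_def sum_distrib_left mult_ac)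

lemma bilin_sum: "bilin J B u (\<lambda>i. \<Sum>a\<in>A. c a * v a i) = (\<Sum>a\<in>A. c a * bilin J B u (v a))"
proof -
  have "bilin J B u (\<lambda>i. \<Sum>a\<in>A. c a * v a i) = (\<Sum>i\<in>J. \<Sum>j\<in>J. \<Sum>a\<in>A. c a * (u i * B i j * v a j))"
    by (simp add: bilin_def sum_distrib_left mult_ac)
  also have "\<dots> = (\<Sum>i\<in>J. \<Sum>a\<in>A. \<Sum>j\<in>J. c a * (u i * B i j * v a j))"
    by (intro sum.cong refl sum.swap)
  also have "\<dots> = (\<Sum>a\<in>A. \<Sum>i\<in>J. \<Sum>j\<in>J. c a * (u i * B i j * v a j))"
    by (rule sum.swap)
  finally show ?thesis by (simp add: bilin_def sum_distrib_left)
qed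

lemma bilin_mono_neutral:
  assumes "finite J'" "J \<subseteq> J'" "\<And>i. i \<notin> J \<Longrightarrow> u i = 0" "\<And>i. i \<notin> J \<Longrightarrow> v i = 0"
  shows "bilin J' B u v = bilin J B u v"
proof -
  have "bilin J' B u v = (\<Sum>i\<in>J. \<Sum>j\<in>J'. u i * B i j * v j)"
    unfolding bilin_def by (rule sum.mono_neutral_right) (use assms in auto)
  also have "\<dots> = bilin J B u v"
    unfolding bilin_def by (intro sum.cong refl sum.mono_neutral_right) (use assms in auto)
  finally show ?thesis .
qed

text \<open>Gram-Schmidt for the covariance form, adding one index at a time. The new vector has
  entry one at \<open>p\<close>, so positive definiteness makes its norm positive. The matrix
  \<open>A\<close> recovers the regressors for every sequence \<open>x\<close>, not just almost
  surely.\<close>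

lemma whitening_exists:
  fixes B :: "nat \<Rightarrow> nat \<Rightarrow> real"
  assumes sym: "\<And>i j. B i j = B j i" and "finite J"
    and "\<And>v. \<exists>j\<in>J. v j \<noteq> 0 \<Longrightarrow> 0 < bilin J B v v"
  shows "\<exists>W A. (\<forall>l<card J. \<forall>i. i \<notin> J \<longrightarrow> W l i = 0) \<and>
     (\<forall>a<card J. \<forall>b<card J. bilin J B (W a) (W b) = of_bool (a = b)) \<and>
     (\<forall>x. \<forall>j\<in>J. x j = (\<Sum>l<card J. A j l * (\<Sum>i\<in>J. W l i * x i)))"
  using assms(2,3)
proof (induction J rule: finite_induct)
  case empty
  then show ?case by simp
next
  case (insert p J)
  let ?J = "insert p J" and ?k = "card J"
  have sub: "bilin ?J B u u = bilin J B u u" if "\<And>i. i \<notin> J \<Longrightarrow> u i = 0" for u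
    by (rule bilin_mono_neutral) (use insert.hyps that in auto)
  have "0 < bilin J B v v" if v: "\<exists>j\<in>J. v j \<noteq> 0" for v
  proof -
    let ?v = "\<lambda>j. if j \<in> J then v j else 0"
    have "0 < bilin ?J B ?v ?v" by (rule insert.prems) (use v in auto)
    also have "\<dots> = bilin J B ?v ?v" by (rule sub) simp
    also have "\<dots> = bilin J B v v" unfolding bilin_def by (intro sum.cong) auto
    finally show ?thesis .
  qed
  from insert.IH[OF this] obtain W A where W0: "\<And>l i. l < ?k \<Longrightarrow> i \<notin> J \<Longrightarrow> W l i = 0"
    and Wo: "\<And>a b. a < ?k \<Longrightarrow> b < ?k \<Longrightarrow> bilin J B (W a) (W b) = of_bool (a = b)"
    and A: "\<And>x j. j \<in> J \<Longrightarrow> x j = (\<Sum>l<?k. A j l * (\<Sum>i\<in>J. W l i * x i))" by blast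
  let ?e = "\<lambda>i. of_bool (i = p) :: real"
  define c where "c l = bilin ?J B (W l) ?e" for l
  define r where "r = (\<lambda>i. ?e i - (\<Sum>l<?k. c l * W l i))"
  have Wo': "bilin ?J B (W a) (W b) = of_bool (a = b)" if "a < ?k" "b < ?k" for a b
    using Wo[OF that] bilin_mono_neutral[of ?J J "W a" "W b" B, OF _ subset_insertI] insert.hyps W0 that by simp
  have rW: "bilin ?J B (W a) r = 0" if "a < ?k" for a
  proof -
    have "(\<Sum>l<?k. c l * bilin ?J B (W a) (W l)) = (\<Sum>l<?k. c l * of_bool (l = a))"
      using that by (intro sum.cong refl) (auto simp: Wo')
    then show ?thesis using that unfolding r_def
      by (simp add: bilin_diff bilin_sum sum_lessThan_of_bool) (simp add: c_def)
  qed
  have rp: "r p = 1" using W0 insert.hyps by (simp add: r_def)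
  have rpos: "0 < bilin ?J B r r" by (rule insert.prems) (use rp in auto)
  define s where "s = sqrt (bilin ?J B r r)"
  have s: "0 < s" "s * s = bilin ?J B r r" using rpos by (simp_all add: s_def)
  define W' where "W' = W(?k := (\<lambda>i. 1 / s * r i))"
  \<comment> \<open>Solving the definition of the new whitened variable for \<open>x p\<close> gives
    \<open>s\<close> times that variable plus the projection on the old ones.\<close>
  define A' where "A' j l = (if j = p then (if l = ?k then s else c l) else (if l = ?k then 0 else A j l))" for j l
  have card: "card ?J = Suc ?k" using insert.hyps by simp
  have "W' l i = 0" if "l < Suc ?k" "i \<notin> ?J" for l i
    using that W0 by (auto simp: W'_def r_def less_Suc_eq)
  moreover have "bilin ?J B (W' a) (W' b) = of_bool (a = b)" if "a < Suc ?k" "b < Suc ?k" for a b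
  proof -
    have 1: "bilin ?J B (W a) (\<lambda>i. 1 / s * r i) = 0" if "a < ?k" for a
      using rW[OF that] by (simp only: bilin_scale mult_zero_right)
    have 2: "bilin ?J B (\<lambda>i. 1 / s * r i) (W a) = 0" if "a < ?k" for a
      by (subst bilin_commute[OF sym]) (rule 1[OF that])
    have "bilin ?J B (\<lambda>i. 1 / s * r i) (\<lambda>i. 1 / s * r i) = 1 / s * bilin ?J B (\<lambda>i. 1 / s * r i) r"
      by (rule bilin_scale)
    also have "bilin ?J B (\<lambda>i. 1 / s * r i) r = 1 / s * bilin ?J B r r"
      by (subst bilin_commute[OF sym]) (rule bilin_scale)
    also have "1 / s * (1 / s * bilin ?J B r r) = 1"
      unfolding s(2)[symmetric] using s(1) by simp
    finally have 3: "bilin ?J B (\<lambda>i. 1 / s * r i) (\<lambda>i. 1 / s * r i) = 1" .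
    show ?thesis
      using that Wo'[of a b] 1[of a] 2[of b] 3 unfolding W'_def fun_upd_apply
      by (cases "a = ?k"; cases "b = ?k") auto
  qed
  moreover have "x j = (\<Sum>l<Suc ?k. A' j l * (\<Sum>i\<in>?J. W' l i * x i))" if j: "j \<in> ?J" for x j
  proof -
    have zl: "(\<Sum>i\<in>?J. W' l i * x i) = (\<Sum>i\<in>J. W l i * x i)" if "l < ?k" for l
      using that W0[OF that] insert.hyps by (simp add: W'_def)
    have zk: "(\<Sum>i\<in>?J. W' ?k i * x i) = 1 / s * (x p - (\<Sum>l<?k. c l * (\<Sum>i\<in>J. W l i * x i)))"
    proof -
      have "(\<Sum>i\<in>?J. W' ?k i * x i) = 1 / s * (\<Sum>i\<in>?J. r i * x i)"
        by (simp add: W'_def sum_distrib_left mult.assoc)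
      also have "(\<Sum>i\<in>?J. r i * x i) = (\<Sum>i\<in>?J. ?e i * x i) - (\<Sum>i\<in>?J. \<Sum>l<?k. c l * (W l i * x i))"
        by (simp add: r_def left_diff_distrib sum_subtractf sum_distrib_right mult.assoc)
      also have "(\<Sum>i\<in>?J. ?e i * x i) = x p"
      proof -
        have "(\<Sum>i\<in>J. ?e i * x i) = 0" using insert.hyps by (intro sum.neutral) auto
        then show ?thesis using insert.hyps by simp
      qed
      also have "(\<Sum>i\<in>?J. \<Sum>l<?k. c l * (W l i * x i)) = (\<Sum>l<?k. c l * (\<Sum>i\<in>J. W l i * x i))"
        using insert.hyps W0 by (subst sum.swap) (simp add: sum_distrib_left)
      finally show ?thesis .
    qed
    show ?thesis
    proof (cases "j = p")
      case True
      then have "(\<Sum>l<Suc ?k. A' j l * (\<Sum>i\<in>?J. W' l i * x i))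
          = (\<Sum>l<?k. c l * (\<Sum>i\<in>J. W l i * x i)) + s * (1 / s * (x p - (\<Sum>l<?k. c l * (\<Sum>i\<in>J. W l i * x i))))"
        by (simp only: sum.lessThan_Suc zk) (simp add: A'_def zl)
      then show ?thesis using s(1) True by simp
    next
      case False
      then have "(\<Sum>l<Suc ?k. A' j l * (\<Sum>i\<in>?J. W' l i * x i)) = (\<Sum>l<?k. A j l * (\<Sum>i\<in>J. W l i * x i))"
        by (simp only: sum.lessThan_Suc zk) (simp add: A'_def zl)
      then show ?thesis using A[of j x] j False by simp
    qed
  qed
  ultimately show ?case unfolding card by blast
qed

text \<open>The assumption says that \<open>A\<close> undoes \<open>W\<close>; the opposite
  composition follows by testing it on the sequence \<open>B\<close> applied to \<open>W b\<close>,
  whose whitened coordinates form the \<open>b\<close>-th unit vector.\<close>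

lemma whitening_inverse:
  assumes "\<forall>a<k. \<forall>b<k. bilin J B (W a) (W b) = of_bool (a = b)"
    and A: "\<forall>x. \<forall>j\<in>J. x j = (\<Sum>l<k. A j l * (\<Sum>i\<in>J. W l i * x i))"
    and "a < k" "b < (k::nat)"
  shows "(\<Sum>j\<in>J. W a j * A j b) = of_bool (a = b)"
proof -
  let ?x = "\<lambda>i. \<Sum>j\<in>J. B i j * W b j"
  have z: "(\<Sum>i\<in>J. W l i * ?x i) = of_bool (l = b)" if "l < k" for l
    using assms(1) that assms(4) by (auto simp: bilin_def sum_distrib_left mult.assoc)
  have x: "?x j = A j b" if "j \<in> J" for j
  proof -
    have "?x j = (\<Sum>l<k. A j l * (\<Sum>i\<in>J. W l i * ?x i))"
      by (rule A[rule_format, of j ?x, OF that])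
    also have "\<dots> = (\<Sum>l<k. A j l * of_bool (l = b))" by (intro sum.cong refl) (simp add: z)
    finally show ?thesis using assms(4) by (simp add: sum_lessThan_of_bool)
  qed
  have "(\<Sum>j\<in>J. W a j * A j b) = (\<Sum>j\<in>J. W a j * ?x j)" by (intro sum.cong refl) (simp add: x)
  then show ?thesis using z[OF assms(3)] by simp
qed

section \<open>Centred Gaussian variables and the law of one observation\<close>

lemma (in prob_space) gaussian_rv_integrable:
  assumes "gaussian_rv M Z"
  shows "integrable M Z" "integrable M (\<lambda>\<omega>. (Z \<omega>)\<^sup>2)"
proof -
  have Z: "Z \<in> borel_measurable M" using assms by (simp add: gaussian_rv_def)
  have "integrable M Z \<and> integrable M (\<lambda>\<omega>. (Z \<omega>)\<^sup>2)"
  proof (cases "\<exists>\<mu> s. 0 < s \<and> distributed M lborel Z (\<lambda>t. ennreal (normal_density \<mu> s t))")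
    case True
    then obtain \<mu> s where s: "0 < s" and d: "distributed M lborel Z (\<lambda>t. ennreal (normal_density \<mu> s t))" by blast
    have 1: "integrable M Z"
      using distributed_integrable[OF d, of "\<lambda>x. x"] integrable_normal_moment_nz_1[OF s] by simp
    have "integrable M (\<lambda>\<omega>. (Z \<omega> - \<mu>)\<^sup>2)"
      using distributed_integrable[OF d, of "\<lambda>x. (x - \<mu>)\<^sup>2"] integrable_normal_moment[OF s, of \<mu> 2] by simp
    then have "integrable M (\<lambda>\<omega>. (Z \<omega> - \<mu>)\<^sup>2 + 2 * \<mu> * Z \<omega> - \<mu>\<^sup>2)" using 1 by simp
    then show ?thesis using 1 by (simp add: power2_diff algebra_simps)
  next
    case False
    then obtain \<mu> where \<mu>: "AE \<omega> in M. Z \<omega> = \<mu>" using assms by (auto simp: gaussian_rv_def)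
    have "integrable M Z" by (subst integrable_cong_AE[OF Z _ \<mu>]) auto
    moreover have "integrable M (\<lambda>\<omega>. (Z \<omega>)\<^sup>2)"
      using \<mu> Z by (subst integrable_cong_AE[of _ _ "\<lambda>_. \<mu>\<^sup>2"]) (auto elim: eventually_mono)
    ultimately show ?thesis by simp
  qed
  then show "integrable M Z" "integrable M (\<lambda>\<omega>. (Z \<omega>)\<^sup>2)" by simp_all
qed

lemma (in prob_space) gaussian_rv_cf:
  assumes G: "gaussian_rv M Z" and mean: "expectation Z = 0"
  shows "(\<integral>\<omega>. iexp (Z \<omega>) \<partial>M) = complex_of_real (exp (- expectation (\<lambda>\<omega>. (Z \<omega>)\<^sup>2) / 2))"
proof (cases "\<exists>\<mu> s. 0 < s \<and> distributed M lborel Z (\<lambda>t. ennreal (normal_density \<mu> s t))")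
  case True
  then obtain \<mu> s where s: "0 < s" and d: "distributed M lborel Z (\<lambda>t. ennreal (normal_density \<mu> s t))" by blast
  have \<mu>: "\<mu> = 0" using normal_distributed_expectation[OF s d] mean by simp
  have v: "expectation (\<lambda>\<omega>. (Z \<omega>)\<^sup>2) = s\<^sup>2"
    using normal_distributed_variance[OF s d] mean by simp
  have d': "distributed M lborel (\<lambda>\<omega>. Z \<omega> / s) (\<lambda>t. ennreal (std_normal_density t))"
    using d normal_standard_normal_convert[OF s, of Z \<mu>] \<mu> by simp
  have Zm[measurable]: "Z \<in> borel_measurable M" using G by (simp add: gaussian_rv_def)
  have law: "distr M borel (\<lambda>\<omega>. Z \<omega> / s) = std_normal"
  proof -
    have "distr M borel (\<lambda>\<omega>. Z \<omega> / s) = distr M lborel (\<lambda>\<omega>. Z \<omega> / s)" by (rule distr_cong) auto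
    then show ?thesis using distributed_distr_eq_density[OF d'] by simp
  qed
  have "(\<integral>\<omega>. iexp (Z \<omega>) \<partial>M) = (\<integral>\<omega>. iexp (s * (Z \<omega> / s)) \<partial>M)" using s by simp
  also have "\<dots> = char (distr M borel (\<lambda>\<omega>. Z \<omega> / s)) s"
    unfolding char_def by (subst integral_distr) auto
  finally show ?thesis unfolding law char_std_normal_distribution v .
next
  case False
  then obtain \<mu> where \<mu>: "AE \<omega> in M. Z \<omega> = \<mu>" using G by (auto simp: gaussian_rv_def)
  have Zm[measurable]: "Z \<in> borel_measurable M" using G by (simp add: gaussian_rv_def)
  have "expectation Z = expectation (\<lambda>_. \<mu>)" by (rule integral_cong_AE) (use \<mu> in auto)
  then have ae: "AE \<omega> in M. Z \<omega> = 0" using \<mu> mean by (simp add: prob_space)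
  have "(\<integral>\<omega>. iexp (Z \<omega>) \<partial>M) = (\<integral>\<omega>. 1 \<partial>M)" by (rule integral_cong_AE) (use ae in auto)
  moreover have "expectation (\<lambda>\<omega>. (Z \<omega>)\<^sup>2) = expectation (\<lambda>_. 0)"
    by (rule integral_cong_AE) (use ae in auto)
  ultimately show ?thesis by (simp add: prob_space)
qed

lemma integrable_mult_of_squares:
  fixes f g :: "'a \<Rightarrow> real"
  assumes "f \<in> borel_measurable M" "g \<in> borel_measurable M"
    "integrable M (\<lambda>x. (f x)\<^sup>2)" "integrable M (\<lambda>x. (g x)\<^sup>2)"
  shows "integrable M (\<lambda>x. f x * g x)"
proof (rule Bochner_Integration.integrable_bound[of M "\<lambda>x. (f x)\<^sup>2 + (g x)\<^sup>2"])
  show "AE x in M. norm (f x * g x) \<le> norm ((f x)\<^sup>2 + (g x)\<^sup>2)"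
  proof (rule AE_I2)
    fix x
    have "2 * \<bar>f x * g x\<bar> \<le> (f x)\<^sup>2 + (g x)\<^sup>2"
      using sum_squares_bound[of "\<bar>f x\<bar>" "\<bar>g x\<bar>"] by (simp add: abs_mult)
    then show "norm (f x * g x) \<le> norm ((f x)\<^sup>2 + (g x)\<^sup>2)" by simp
  qed
qed (use assms in auto)

lemma integral_square_sum:
  fixes X :: "'i \<Rightarrow> 'a \<Rightarrow> real"
  assumes "\<And>a b. a \<in> I \<Longrightarrow> b \<in> I \<Longrightarrow> integrable M (\<lambda>\<omega>. X a \<omega> * X b \<omega>)"
    and o: "\<And>a b. a \<in> I \<Longrightarrow> b \<in> I \<Longrightarrow> a \<noteq> b \<Longrightarrow> (\<integral>\<omega>. X a \<omega> * X b \<omega> \<partial>M) = 0" and I: "finite I"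
  shows "(\<integral>\<omega>. (\<Sum>a\<in>I. t a * X a \<omega>)\<^sup>2 \<partial>M) = (\<Sum>a\<in>I. (t a)\<^sup>2 * (\<integral>\<omega>. (X a \<omega>)\<^sup>2 \<partial>M))"
proof -
  have "(\<integral>\<omega>. (\<Sum>a\<in>I. t a * X a \<omega>)\<^sup>2 \<partial>M) = (\<integral>\<omega>. (\<Sum>a\<in>I. \<Sum>b\<in>I. t a * t b * (X a \<omega> * X b \<omega>)) \<partial>M)"
    unfolding power2_eq_square sum_product by (simp add: mult_ac)
  also have "\<dots> = (\<Sum>a\<in>I. \<Sum>b\<in>I. t a * t b * (\<integral>\<omega>. X a \<omega> * X b \<omega> \<partial>M))"
    using assms(1) by simp
  also have "\<dots> = (\<Sum>a\<in>I. \<Sum>b\<in>I. if b = a then t a * t b * (\<integral>\<omega>. X a \<omega> * X b \<omega> \<partial>M) else 0)"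
    by (intro sum.cong refl) (auto simp: o)
  also have "\<dots> = (\<Sum>a\<in>I. (t a)\<^sup>2 * (\<integral>\<omega>. (X a \<omega>)\<^sup>2 \<partial>M))"
    using I by (simp add: power2_eq_square cong: sum.cong_simp)
  finally show ?thesis .
qed

text \<open>The characteristic function of a centred Gaussian combination is fixed by its second
  moment, and orthonormality turns that moment into the squared length of \<open>t\<close>.\<close>

lemma std_gaussian_of_gaussian_rv:
  assumes "prob_space M" and I: "finite I"
    and G: "\<And>t. gaussian_rv M (\<lambda>\<omega>. \<Sum>i\<in>I. t i * X i \<omega>)"
    and X: "\<And>i. i \<in> I \<Longrightarrow> X i \<in> borel_measurable M"
    and sq: "\<And>i. i \<in> I \<Longrightarrow> integrable M (\<lambda>\<omega>. (X i \<omega>)\<^sup>2)"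
    and int: "\<And>i. i \<in> I \<Longrightarrow> integrable M (X i)"
    and mean: "\<And>i. i \<in> I \<Longrightarrow> (\<integral>\<omega>. X i \<omega> \<partial>M) = 0"
    and cov: "\<And>a b. a \<in> I \<Longrightarrow> b \<in> I \<Longrightarrow> (\<integral>\<omega>. X a \<omega> * X b \<omega> \<partial>M) = of_bool (a = b)"
  shows "std_gaussian M I X"
proof -
  interpret prob_space M by fact
  have "(\<integral>\<omega>. iexp (\<Sum>i\<in>I. t i * X i \<omega>) \<partial>M) = complex_of_real (exp (- (\<Sum>i\<in>I. (t i)\<^sup>2) / 2))" for t
  proof -
    have "expectation (\<lambda>\<omega>. \<Sum>i\<in>I. t i * X i \<omega>) = 0" using int mean by simp
    from gaussian_rv_cf[OF G this]
    have "(\<integral>\<omega>. iexp (\<Sum>i\<in>I. t i * X i \<omega>) \<partial>M)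
        = complex_of_real (exp (- (\<integral>\<omega>. (\<Sum>i\<in>I. t i * X i \<omega>)\<^sup>2 \<partial>M) / 2))" .
    also have "(\<integral>\<omega>. (\<Sum>i\<in>I. t i * X i \<omega>)\<^sup>2 \<partial>M) = (\<Sum>a\<in>I. (t a)\<^sup>2 * (\<integral>\<omega>. (X a \<omega>)\<^sup>2 \<partial>M))"
      by (rule integral_square_sum) (use I X sq cov in \<open>auto intro: integrable_mult_of_squares\<close>)
    also have "\<dots> = (\<Sum>a\<in>I. (t a)\<^sup>2)"
      by (intro sum.cong refl) (use cov in \<open>simp add: power2_eq_square\<close>)
    finally show ?thesis .
  qed
  then show ?thesis using assms(1) I X by (simp add: std_gaussian_def)
qed

text \<open>What the analysis retains of the model: a property of the law of \<open>(y, x)\<close>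
  alone, from which \<open>\<beta>\<close>, \<open>\<sigma>\<close> and the unobserved error have
  disappeared.\<close>

definition centered_gaussian_law :: "obs measure \<Rightarrow> bool" where
  "centered_gaussian_law D \<longleftrightarrow> prob_space D \<and> sets D = sets obs_space \<and>
     (\<forall>a d k. gaussian_rv D (\<lambda>z. a * fst z + (\<Sum>j<k. d j * snd z j))) \<and>
     (\<integral>z. fst z \<partial>D) = 0 \<and> (\<forall>j. (\<integral>z. snd z j \<partial>D) = 0) \<and>
     (\<forall>J v. finite J \<longrightarrow> (\<exists>j\<in>J. v j \<noteq> 0) \<longrightarrow> 0 < bilin J (\<lambda>i j. \<integral>z. snd z i * snd z j \<partial>D) v v)"

lemma gaussian_rv_distr:
  assumes f: "f \<in> M \<rightarrow>\<^sub>M N" and g: "g \<in> borel_measurable N" and G: "gaussian_rv M (\<lambda>\<omega>. g (f \<omega>))"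
  shows "gaussian_rv (distr M N f) g"
proof -
  have d: "distr (distr M N f) lborel g = distr M lborel (\<lambda>\<omega>. g (f \<omega>))"
    using f g by (subst distr_distr) (auto simp: comp_def)
  have ae: "(AE z in distr M N f. g z = \<mu>) \<longleftrightarrow> (AE \<omega> in M. g (f \<omega>) = \<mu>)" for \<mu>
    using f g by (intro AE_distr_iff) auto
  show ?thesis using G f g unfolding gaussian_rv_def distributed_def d ae by auto
qed

lemma obs_space_measurable [measurable]:
  "fst \<in> borel_measurable obs_space" "(\<lambda>z. snd z j) \<in> borel_measurable obs_space"
  unfolding obs_space_def by measurable

lemma data_law_centered_gaussian:
  assumes "is_data_law \<theta> D"
  shows "centered_gaussian_law D"
proof -
  obtain \<beta> \<sigma> Cov where \<theta>: "\<theta> = (\<beta>, \<sigma>, Cov)" by (cases \<theta>) auto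
  obtain M :: "(real \<times> real \<times> (nat \<Rightarrow> real)) measure" and y u x where
    L: "gaussian_linear_model M y u x \<beta> \<sigma> Cov" and D: "D = distr M obs_space (\<lambda>\<omega>. (y \<omega>, x \<omega>))"
    using assms by (auto simp: is_data_law_def \<theta>)
  interpret gaussian_linear_model M y u x \<beta> \<sigma> Cov by (rule L)
  note [measurable] = y_rv x_rv u_rv
  have "(\<lambda>\<omega>. x \<omega>) \<in> M \<rightarrow>\<^sub>M PiM UNIV (\<lambda>_. borel)"
    by (rule measurable_PiM_single') (auto simp: x_rv)
  then have f[measurable]: "(\<lambda>\<omega>. (y \<omega>, x \<omega>)) \<in> M \<rightarrow>\<^sub>M obs_space"
    unfolding obs_space_def by measurable
  have iy: "integrable M y" using gaussian_rv_integrable(1)[OF jointly_gaussian[of 1 0 "\<lambda>_. 0" 0]] by simp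
  have iu: "integrable M u" using gaussian_rv_integrable(1)[OF jointly_gaussian[of 0 1 "\<lambda>_. 0" 0]] by simp
  have ix: "integrable M (\<lambda>\<omega>. x \<omega> j)" for j
  proof -
    have "(\<Sum>i<Suc j. of_bool (i = j) * x \<omega> i) = x \<omega> j" for \<omega>
      using sum_lessThan_of_bool[of "x \<omega>" j "Suc j"] by (simp add: mult.commute)
    then show ?thesis using gaussian_rv_integrable(1)[OF jointly_gaussian[of 0 0 "\<lambda>i. of_bool (i = j)" "Suc j"]]
      by (simp del: sum.lessThan_Suc)
  qed
  \<comment> \<open>The truncated sums and \<open>u\<close> are centred, so the remainder has the
    same mean as \<open>y\<close>. The square of that mean is at most the second moment of the
    remainder, which tends to zero by \<open>response\<close>.\<close>
  have "(expectation y)\<^sup>2 \<le> expectation (\<lambda>\<omega>. (y \<omega> - ((\<Sum>j<k. x \<omega> j * \<beta> j) + u \<omega>))\<^sup>2)" for k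
  proof -
    let ?Z = "\<lambda>\<omega>. y \<omega> - ((\<Sum>j<k. x \<omega> j * \<beta> j) + u \<omega>)"
    have "?Z = (\<lambda>\<omega>. 1 * y \<omega> + (-1) * u \<omega> + (\<Sum>j<k. (- \<beta> j) * x \<omega> j))"
      by (simp add: fun_eq_iff sum_negf mult.commute)
    then have Z: "gaussian_rv M ?Z" using jointly_gaussian[of 1 "-1" "\<lambda>j. - \<beta> j" k] by simp
    have "expectation ?Z = expectation y" using iy iu ix x_mean u_mean by simp
    moreover have "0 \<le> variance ?Z" by (rule variance_positive)
    then have "0 \<le> expectation (\<lambda>\<omega>. (?Z \<omega>)\<^sup>2) - (expectation ?Z)\<^sup>2"
      by (subst variance_eq[symmetric]) (use gaussian_rv_integrable[OF Z] in auto)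
    ultimately show ?thesis by simp
  qed
  then have "(expectation y)\<^sup>2 \<le> 0"
    by (intro LIMSEQ_le_const[OF response]) auto
  then have y0: "expectation y = 0" by simp
  show ?thesis
    unfolding centered_gaussian_law_def
  proof (intro conjI allI impI)
    show "prob_space D" unfolding D by (rule prob_space_distr[OF f])
    show "sets D = sets obs_space" by (simp add: D)
    show "gaussian_rv D (\<lambda>z. a * fst z + (\<Sum>j<k. d j * snd z j))" for a d k
      unfolding D by (rule gaussian_rv_distr[OF f]) (use jointly_gaussian[of a 0 d k] in \<open>simp_all\<close>)
    show "(\<integral>z. fst z \<partial>D) = 0" unfolding D using y0 by (subst integral_distr[OF f]) auto
    show "(\<integral>z. snd z j \<partial>D) = 0" for j unfolding D using x_mean by (subst integral_distr[OF f]) auto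
    fix J :: "nat set" and v :: "nat \<Rightarrow> real" assume "finite J" "\<exists>j\<in>J. v j \<noteq> 0"
    moreover have "(\<integral>z. snd z i * snd z j \<partial>D) = Cov i j" for i j
      unfolding D using x_cov by (subst integral_distr[OF f]) auto
    ultimately show "0 < bilin J (\<lambda>i j. \<integral>z. snd z i * snd z j \<partial>D) v v"
      using Cov_pos_def by (simp add: bilin_def)
  qed
qed

section \<open>A fitted model\<close>

text \<open>The rows of \<open>W\<close> whiten the regressors selected by \<open>m\<close>, and \<open>A\<close> undoes the whitening.\<close>

locale fitted_model =
  fixes D :: "obs measure" and n :: nat and m :: model and b :: "sample \<Rightarrow> nat \<Rightarrow> real"
    and W A :: "nat \<Rightarrow> nat \<Rightarrow> real"
  assumes D: "centered_gaussian_law D"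
    and fin: "finite {j. m j}" and size: "msize m < n - 1"
    and ls: "restricted_ls_estimator n m b"
    and Wo: "\<forall>l<msize m. \<forall>l'<msize m. bilin {j. m j} (\<lambda>i j. \<integral>z. snd z i * snd z j \<partial>D) (W l) (W l') = of_bool (l = l')"
    and WA: "\<forall>x. \<forall>j\<in>{j. m j}. x j = (\<Sum>l<msize m. A j l * (\<Sum>i\<in>{j. m j}. W l i * x i))"
begin

abbreviation "J \<equiv> {j. m j}"
abbreviation "k \<equiv> msize m"
abbreviation "P \<equiv> PiM {..<n} (\<lambda>_. D)"

sublocale prob_space D using D by (simp add: centered_gaussian_law_def)

lemma sets_D: "sets D = sets obs_space"
  using D by (simp add: centered_gaussian_law_def)

lemma D_measurable [measurable]: "fst \<in> borel_measurable D" "(\<lambda>z. snd z j) \<in> borel_measurable D"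
  using obs_space_measurable by (auto simp: measurable_cong_sets[OF sets_D refl])

lemma kn: "k < n" "Suc k < n" "2 \<le> n" using size by auto

lemma gaussian_linear: "gaussian_rv D (\<lambda>z. a * fst z + (\<Sum>j\<in>J. d j * snd z j))"
proof -
  obtain K where K: "J \<subseteq> {..<K}" using fin finite_nat_iff_bounded by blast
  let ?d = "\<lambda>j. if j \<in> J then d j else 0"
  have e: "(\<Sum>j\<in>J. d j * snd z j) = (\<Sum>j<K. ?d j * snd z j)" for z :: obs
    by (rule sum.mono_neutral_cong_left) (use K in auto)
  have "\<forall>a d k. gaussian_rv D (\<lambda>z. a * fst z + (\<Sum>j<k. d j * snd z j))"
    using D by (simp add: centered_gaussian_law_def)
  from this[rule_format, of a ?d K] show ?thesis unfolding e .
qed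

definition \<zeta> :: "nat \<Rightarrow> obs \<Rightarrow> real" where "\<zeta> l z = (\<Sum>i\<in>J. W l i * snd z i)"

definition c :: "nat \<Rightarrow> real" where "c l = (\<integral>z. fst z * \<zeta> l z \<partial>D)"

text \<open>The population residual of \<open>y\<close> given the selected regressors. It contains
  the error \<open>u\<close> together with whatever the omitted regressors contribute.\<close>

definition e :: "obs \<Rightarrow> real" where "e z = fst z - (\<Sum>l<k. c l * \<zeta> l z)"

definition v :: real where "v = (\<integral>z. (e z)\<^sup>2 \<partial>D)"

lemma \<zeta>_measurable [measurable]: "\<zeta> l \<in> borel_measurable D"
  unfolding \<zeta>_def by measurable

lemma e_measurable [measurable]: "e \<in> borel_measurable D"
  unfolding e_def by measurable

lemma linear_eq:
  "a * e z + (\<Sum>l<k. t l * \<zeta> l z) = a * fst z + (\<Sum>j\<in>J. (\<Sum>l<k. (t l - a * c l) * W l j) * snd z j)"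
proof -
  have "(\<Sum>j\<in>J. (\<Sum>l<k. (t l - a * c l) * W l j) * snd z j) = (\<Sum>l<k. (t l - a * c l) * \<zeta> l z)"
    unfolding \<zeta>_def sum_distrib_left sum_distrib_right by (subst sum.swap) (simp add: mult.assoc)
  then show ?thesis
    by (simp add: e_def left_diff_distrib right_diff_distrib sum_subtractf sum_distrib_left mult.assoc)
qed

lemma gaussian_combination: "gaussian_rv D (\<lambda>z. a * e z + (\<Sum>l<k. t l * \<zeta> l z))"
  unfolding linear_eq by (rule gaussian_linear)

lemma gaussian_\<zeta>: "gaussian_rv D (\<zeta> l)"
  using gaussian_linear[of 0 "W l"] by (simp add: \<zeta>_def[abs_def])

lemma gaussian_e: "gaussian_rv D e"
  using gaussian_combination[of 1 "\<lambda>_. 0"] by simp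

lemma gaussian_y: "gaussian_rv D fst"
  using gaussian_linear[of 1 "\<lambda>_. 0"] by simp

lemma gaussian_x: "j \<in> J \<Longrightarrow> gaussian_rv D (\<lambda>z. snd z j)"
proof -
  assume j: "j \<in> J"
  have "(\<Sum>i\<in>J. of_bool (i = j) * snd z i) = snd z j" for z :: obs
  proof -
    have "(\<Sum>i\<in>J. of_bool (i = j) * snd z i) = (\<Sum>i\<in>{j}. of_bool (i = j) * snd z i)"
      by (rule sum.mono_neutral_right) (use fin j in auto)
    then show ?thesis by simp
  qed
  then show ?thesis using gaussian_linear[of 0 "\<lambda>i. of_bool (i = j)"] by simp
qed

lemmas gaussian_integrable = gaussian_rv_integrable(1)[OF gaussian_\<zeta>] gaussian_rv_integrable(1)[OF gaussian_e]
  gaussian_rv_integrable(1)[OF gaussian_y] gaussian_rv_integrable(1)[OF gaussian_x]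

lemmas gaussian_square_integrable = gaussian_rv_integrable(2)[OF gaussian_\<zeta>] gaussian_rv_integrable(2)[OF gaussian_e]
  gaussian_rv_integrable(2)[OF gaussian_y] gaussian_rv_integrable(2)[OF gaussian_x]

lemma \<zeta>_cov: "l < k \<Longrightarrow> l' < k \<Longrightarrow> (\<integral>z. \<zeta> l z * \<zeta> l' z \<partial>D) = of_bool (l = l')"
proof -
  assume l: "l < k" "l' < k"
  have ii: "integrable D (\<lambda>z. snd z i * snd z j)" if "i \<in> J" "j \<in> J" for i j
    by (rule integrable_mult_of_squares) (use gaussian_square_integrable(4) that in auto)
  have "(\<integral>z. \<zeta> l z * \<zeta> l' z \<partial>D) = (\<integral>z. (\<Sum>i\<in>J. \<Sum>j\<in>J. W l i * W l' j * (snd z i * snd z j)) \<partial>D)"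
    unfolding \<zeta>_def sum_product by (simp add: mult_ac)
  also have "\<dots> = (\<Sum>i\<in>J. \<integral>z. (\<Sum>j\<in>J. W l i * W l' j * (snd z i * snd z j)) \<partial>D)"
    by (intro Bochner_Integration.integral_sum Bochner_Integration.integrable_sum integrable_mult_right ii) auto
  also have "\<dots> = (\<Sum>i\<in>J. \<Sum>j\<in>J. \<integral>z. W l i * W l' j * (snd z i * snd z j) \<partial>D)"
    by (intro sum.cong refl Bochner_Integration.integral_sum integrable_mult_right ii) auto
  also have "\<dots> = bilin J (\<lambda>i j. \<integral>z. snd z i * snd z j \<partial>D) (W l) (W l')"
    unfolding bilin_def by (intro sum.cong refl, subst integral_mult_right_zero) (simp add: mult_ac)
  finally show ?thesis using Wo l by simp
qed

lemma \<zeta>_mean: "(\<integral>z. \<zeta> l z \<partial>D) = 0"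
  using gaussian_integrable(4) D unfolding \<zeta>_def centered_gaussian_law_def by simp

lemma y_mean: "(\<integral>z. fst z \<partial>D) = 0"
  using D by (simp add: centered_gaussian_law_def)

lemma e_mean: "(\<integral>z. e z \<partial>D) = 0"
  using gaussian_integrable(1,3) y_mean \<zeta>_mean unfolding e_def by simp

lemma e_\<zeta>_cov: "l < k \<Longrightarrow> (\<integral>z. e z * \<zeta> l z \<partial>D) = 0"
proof -
  assume l: "l < k"
  have i1: "integrable D (\<lambda>z. fst z * \<zeta> l z)" by (rule integrable_mult_of_squares) (use gaussian_square_integrable in auto)
  have i2: "integrable D (\<lambda>z. c l' * (\<zeta> l' z * \<zeta> l z))" for l'
    by (intro integrable_mult_right integrable_mult_of_squares) (use gaussian_square_integrable in auto)
  have "(\<integral>z. e z * \<zeta> l z \<partial>D) = (\<integral>z. fst z * \<zeta> l z - (\<Sum>l'<k. c l' * (\<zeta> l' z * \<zeta> l z)) \<partial>D)"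
    by (simp add: e_def left_diff_distrib sum_distrib_right mult.assoc)
  also have "\<dots> = (\<integral>z. fst z * \<zeta> l z \<partial>D) - (\<Sum>l'<k. \<integral>z. c l' * (\<zeta> l' z * \<zeta> l z) \<partial>D)"
    using i1 i2 by (subst Bochner_Integration.integral_diff) (auto intro!: Bochner_Integration.integral_sum)
  also have "(\<Sum>l'<k. \<integral>z. c l' * (\<zeta> l' z * \<zeta> l z) \<partial>D) = (\<Sum>l'<k. c l' * of_bool (l' = l))"
    using l by (intro sum.cong refl) (simp add: \<zeta>_cov)
  finally show ?thesis using l by (simp add: sum_lessThan_of_bool c_def)
qed

lemma v_nonneg: "0 \<le> v" unfolding v_def by simp

lemma combination_square: "(\<integral>z. (a * e z + (\<Sum>l<k. t l * \<zeta> l z))\<^sup>2 \<partial>D) = a\<^sup>2 * v + (\<Sum>l<k. (t l)\<^sup>2)"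
proof -
  define F where "F l z = (if l < k then \<zeta> l z else e z)" for l z
  define T where "T l = (if l < k then t l else a)" for l
  have Fm: "F l \<in> borel_measurable D" "integrable D (\<lambda>z. (F l z)\<^sup>2)" for l
  proof -
    have "F l = (if l < k then \<zeta> l else e)" by (simp add: F_def fun_eq_iff)
    then show "F l \<in> borel_measurable D" "integrable D (\<lambda>z. (F l z)\<^sup>2)"
      using gaussian_square_integrable(1)[of l] gaussian_square_integrable(2) by simp_all
  qed
  have "(\<Sum>l<Suc k. T l * F l z) = a * e z + (\<Sum>l<k. t l * \<zeta> l z)" for z
    by (simp add: T_def F_def)
  then have "(\<integral>z. (a * e z + (\<Sum>l<k. t l * \<zeta> l z))\<^sup>2 \<partial>D) = (\<integral>z. (\<Sum>l<Suc k. T l * F l z)\<^sup>2 \<partial>D)" by simp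
  also have "\<dots> = (\<Sum>l<Suc k. (T l)\<^sup>2 * (\<integral>z. (F l z)\<^sup>2 \<partial>D))"
  proof (rule integral_square_sum)
    show "integrable D (\<lambda>z. F l z * F l' z)" for l l'
      by (rule integrable_mult_of_squares) (use Fm in auto)
    fix l l' assume "l \<in> {..<Suc k}" "l' \<in> {..<Suc k}" "l \<noteq> l'"
    then show "(\<integral>z. F l z * F l' z \<partial>D) = 0"
      using e_\<zeta>_cov[of l] e_\<zeta>_cov[of l'] \<zeta>_cov[of l l']
      by (cases "l < k"; cases "l' < k") (simp_all add: F_def mult.commute)
  qed simp
  also have "\<dots> = a\<^sup>2 * v + (\<Sum>l<k. (t l)\<^sup>2)"
  proof -
    have "(\<integral>z. (\<zeta> l z)\<^sup>2 \<partial>D) = 1" if "l < k" for l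
      using \<zeta>_cov[OF that that] by (simp add: power2_eq_square)
    then show ?thesis by (simp add: T_def F_def v_def)
  qed
  finally show ?thesis .
qed

text \<open>Since \<open>y\<close> is \<open>e\<close> plus its projection, Pythagoras applies. This
  is how the bound on the variance of \<open>y\<close> controls every candidate model at
  once.\<close>

lemma v_le: "v \<le> (\<integral>z. (fst z)\<^sup>2 \<partial>D)"
  using combination_square[of 1 c] by (simp add: e_def sum_nonneg)

lemma std_gaussian_\<zeta>: "std_gaussian D {..<k} \<zeta>"
proof (rule std_gaussian_of_gaussian_rv[OF prob_space_axioms])
  show "gaussian_rv D (\<lambda>z. \<Sum>l<k. t l * \<zeta> l z)" for t using gaussian_combination[of 0 t] by simp
qed (use gaussian_integrable gaussian_square_integrable \<zeta>_mean \<zeta>_cov in auto)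

lemma std_gaussian_\<zeta>_e:
  assumes v: "0 < v"
  shows "std_gaussian D {..<Suc k} (\<lambda>l z. if l < k then \<zeta> l z else e z / sqrt v)" (is "std_gaussian D _ ?F")
proof (rule std_gaussian_of_gaussian_rv[OF prob_space_axioms])
  have s: "sqrt v * sqrt v = v" "0 < sqrt v" using v by auto
  show "gaussian_rv D (\<lambda>z. \<Sum>l<Suc k. t l * ?F l z)" for t
    using gaussian_combination[of "t k / sqrt v" t] by (simp add: add.commute)
  show "?F l \<in> borel_measurable D" for l by (cases "l < k") auto
  show "integrable D (\<lambda>z. (?F l z)\<^sup>2)" for l using gaussian_square_integrable by (cases "l < k") (auto simp: power_divide)
  show "integrable D (?F l)" for l using gaussian_integrable by (cases "l < k") auto
  show "(\<integral>z. ?F l z \<partial>D) = 0" for l using \<zeta>_mean e_mean by (cases "l < k") auto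
  fix l l' assume l: "l \<in> {..<Suc k}" "l' \<in> {..<Suc k}"
  have "(\<integral>z. e z / sqrt v * (e z / sqrt v) \<partial>D) = 1"
    using s v by (simp add: v_def[symmetric] power2_eq_square[symmetric] power_divide)
  moreover have "(\<integral>z. e z / sqrt v * \<zeta> l z \<partial>D) = 0" "(\<integral>z. \<zeta> l z * (e z / sqrt v) \<partial>D) = 0" if "l < k" for l
    using e_\<zeta>_cov[OF that] by (simp_all add: mult.commute[of _ "e _"])
  ultimately show "(\<integral>z. ?F l z * ?F l' z \<partial>D) = of_bool (l = l')"
    using l \<zeta>_cov[of l l'] by (cases "l < k"; cases "l' < k") (auto simp: less_Suc_eq)
qed simp

lemma predict_eq:
  assumes "\<forall>j. \<not> m j \<longrightarrow> b' j = 0"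
  shows "predict x b' = (\<Sum>j\<in>J. x j * b' j)"
  unfolding predict_def by (rule suminf_finite[OF fin]) (use assms in auto)

text \<open>The estimation error in whitened coordinates: the fitted coefficients of the
  \<open>\<zeta> l\<close> minus the population coefficients.\<close>

definition coeff :: "(nat \<Rightarrow> real) \<Rightarrow> nat \<Rightarrow> real" where
  "coeff b' l = (\<Sum>j\<in>J. A j l * b' j) - c l"

lemma prediction_error_eq:
  assumes "\<forall>j. \<not> m j \<longrightarrow> b' j = 0"
  shows "fst z - predict (snd z) b' = e z - (\<Sum>l<k. coeff b' l * \<zeta> l z)"
proof -
  have "predict (snd z) b' = (\<Sum>j\<in>J. (\<Sum>l<k. A j l * \<zeta> l z) * b' j)"
    unfolding predict_eq[OF assms] \<zeta>_def using WA by (intro sum.cong refl) simp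
  also have "\<dots> = (\<Sum>l<k. (\<Sum>j\<in>J. A j l * b' j) * \<zeta> l z)"
    unfolding sum_distrib_right by (subst sum.swap) (simp add: mult_ac)
  finally show ?thesis by (simp add: e_def coeff_def left_diff_distrib sum_subtractf)
qed

text \<open>Restricted coefficient vectors reach every whitened one, so minimality of
  \<open>b s\<close> among the former becomes minimality among all whitened coefficient
  vectors.\<close>

lemma coeff_surj: "\<exists>b'. (\<forall>j. \<not> m j \<longrightarrow> b' j = 0) \<and> (\<forall>l<k. coeff b' l = t l)"
proof -
  define b' where "b' j = (if m j then \<Sum>a<k. W a j * (c a + t a) else 0)" for j
  have "coeff b' l = t l" if l: "l < k" for l
  proof -
    have "(\<Sum>j\<in>J. A j l * b' j) = (\<Sum>j\<in>J. \<Sum>a<k. (c a + t a) * (W a j * A j l))"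
      by (intro sum.cong refl) (simp add: b'_def sum_distrib_left mult_ac)
    also have "\<dots> = (\<Sum>a<k. (c a + t a) * (\<Sum>j\<in>J. W a j * A j l))"
      unfolding sum_distrib_left by (rule sum.swap)
    also have "\<dots> = (\<Sum>a<k. (c a + t a) * of_bool (a = l))"
      using l by (intro sum.cong refl) (simp add: whitening_inverse[OF Wo WA])
    finally show ?thesis using l by (simp add: coeff_def sum_lessThan_of_bool)
  qed
  then show ?thesis by (intro exI[of _ b']) (simp add: b'_def)
qed

section \<open>The sample and its regression in whitened coordinates\<close>

sublocale sample: product_prob_space "\<lambda>_. D" "{..<n}" by unfold_locales

lemma sets_P: "sets P = sets (sample_space n)"
  unfolding sample_space_def by (rule sets_PiM_cong) (auto simp: sets_D)

lemma space_P: "space P = space (sample_space n)"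
  by (rule sets_eq_imp_space_eq[OF sets_P])

lemma b_measurable: "(\<lambda>s. b s j) \<in> borel_measurable P"
  using ls by (auto simp: restricted_ls_estimator_def measurable_cong_sets[OF sets_P refl])

lemma b_support: "s \<in> space P \<Longrightarrow> \<forall>j. \<not> m j \<longrightarrow> b s j = 0"
  using ls by (auto simp: restricted_ls_estimator_def space_P)

lemma b_min: "s \<in> space P \<Longrightarrow> \<forall>j. \<not> m j \<longrightarrow> b' j = 0 \<Longrightarrow> sum_sq n s (b s) \<le> sum_sq n s b'"
  using ls by (auto simp: restricted_ls_estimator_def space_P)

lemma coeff_measurable: "(\<lambda>s. coeff (b s) l) \<in> borel_measurable P"
  unfolding coeff_def using b_measurable by measurable

lemma component_measurable: "i < n \<Longrightarrow> f \<in> borel_measurable D \<Longrightarrow> (\<lambda>s. f (s i)) \<in> borel_measurable P"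
  by (rule measurable_compose[OF measurable_component_singleton]) auto

lemma sum_sq_eq:
  assumes "\<forall>j. \<not> m j \<longrightarrow> b' j = 0"
  shows "sum_sq n s b' = (\<Sum>i<n. (e (s i) - (\<Sum>l<k. coeff b' l * \<zeta> l (s i)))\<^sup>2)"
  unfolding sum_sq_def prediction_error_eq[OF assms] ..

lemma sum_sq_measurable: "(\<lambda>s. sum_sq n s (b s)) \<in> borel_measurable P"
proof -
  have "(\<lambda>s. \<Sum>i<n. (e (s i) - (\<Sum>l<k. coeff (b s) l * \<zeta> l (s i)))\<^sup>2) \<in> borel_measurable P"
    by (intro borel_measurable_sum borel_measurable_power borel_measurable_diff borel_measurable_times
        coeff_measurable component_measurable) auto
  then show ?thesis
    by (rule measurable_cong[THEN iffD1, rotated]) (simp add: sum_sq_eq b_support)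
qed

definition pred_error :: "sample \<Rightarrow> real" where
  "pred_error s = v + (\<Sum>l<k. (coeff (b s) l)\<^sup>2)"

lemma pred_error_eq:
  assumes "s \<in> space P"
  shows "(\<integral>z. (fst z - predict (snd z) (b s))\<^sup>2 \<partial>D) = pred_error s"
    and "integrable D (\<lambda>z. (fst z - predict (snd z) (b s))\<^sup>2)"
proof -
  have eq: "fst z - predict (snd z) (b s) = 1 * e z + (\<Sum>l<k. (- coeff (b s) l) * \<zeta> l z)" for z
    unfolding prediction_error_eq[OF b_support[OF assms]] by (simp add: sum_negf)
  show "(\<integral>z. (fst z - predict (snd z) (b s))\<^sup>2 \<partial>D) = pred_error s"
    unfolding eq combination_square pred_error_def by simp
  show "integrable D (\<lambda>z. (fst z - predict (snd z) (b s))\<^sup>2)"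
    unfolding eq by (rule gaussian_rv_integrable(2)[OF gaussian_combination])
qed

lemma pred_error_measurable: "pred_error \<in> borel_measurable P"
  unfolding pred_error_def[abs_def] using coeff_measurable by measurable

lemma std_gaussian_sample:
  assumes "std_gaussian D {..<q} F"
  shows "std_gaussian P ({..<q} \<times> {..<n}) (\<lambda>p s. F (fst p) (s (snd p)))"
proof -
  have "std_gaussian P ({..<q} \<times> {..<n}) (\<lambda>p s. F (snd (prod.swap p)) (s (fst (prod.swap p))))"
    by (rule std_gaussian_reindex[OF std_gaussian_iid[OF assms finite_lessThan]]) (auto simp: inj_on_def)
  then show ?thesis by simp
qed

text \<open>Dividing errors and coefficients by \<open>sqrt v\<close> removes the parameters: what
  remains is the canonical Gaussian regression, and \<open>v\<close> survives only as an overall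
  factor.\<close>

lemma least_squares_sample:
  assumes v: "0 < v"
  shows "gaussian_least_squares P n k (\<lambda>p s. if fst p < k then \<zeta> (fst p) (s (snd p)) else e (s (snd p)) / sqrt v)
     (\<lambda>s l. coeff (b s) l / sqrt v)"
    and "s \<in> space P \<Longrightarrow> sum_sq n s (b s) = v * ip n
       (ls_residual (\<lambda>j i. if j < k then \<zeta> j (s i) else e (s i) / sqrt v) k (\<lambda>l. coeff (b s) l / sqrt v))
       (ls_residual (\<lambda>j i. if j < k then \<zeta> j (s i) else e (s i) / sqrt v) k (\<lambda>l. coeff (b s) l / sqrt v))"
proof -
  let ?X = "\<lambda>s j i. if j < k then \<zeta> j (s i) else e (s i) / sqrt v"
  have sv: "sqrt v * sqrt v = v" "0 < sqrt v" using v by auto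
  have eq: "sum_sq n s b' = v * ls_rss n (?X s) k T"
    if "\<forall>j. \<not> m j \<longrightarrow> b' j = 0" "\<forall>l<k. coeff b' l = sqrt v * T l" for s b' T
  proof -
    have "e (s i) - (\<Sum>l<k. coeff b' l * \<zeta> l (s i)) = sqrt v * ls_residual (?X s) k T i" for i
      using that(2) sv(2) by (simp add: ls_residual_def right_diff_distrib sum_distrib_left mult.assoc)
    then show ?thesis
      unfolding sum_sq_eq[OF that(1)] ip_def sum_distrib_left
      by (intro sum.cong refl) (simp only: power_mult_distrib real_sqrt_pow2[OF less_imp_le[OF v]] power2_eq_square[of "ls_residual _ _ _ _"])
  qed
  have eqb: "sum_sq n s (b s) = v * ls_rss n (?X s) k (\<lambda>l. coeff (b s) l / sqrt v)" if "s \<in> space P" for s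
    by (rule eq[OF b_support[OF that]]) (use sv in auto)
  then show "s \<in> space P \<Longrightarrow> sum_sq n s (b s) = v * ls_rss n (?X s) k (\<lambda>l. coeff (b s) l / sqrt v)" .
  show "gaussian_least_squares P n k (\<lambda>p s. if fst p < k then \<zeta> (fst p) (s (snd p)) else e (s (snd p)) / sqrt v)
     (\<lambda>s l. coeff (b s) l / sqrt v)"
  proof
    show "std_gaussian P ({..<Suc k} \<times> {..<n}) (\<lambda>p s. if fst p < k then \<zeta> (fst p) (s (snd p)) else e (s (snd p)) / sqrt v)"
      using std_gaussian_sample[OF std_gaussian_\<zeta>_e[OF v]] by simp
    show "k < n" by (rule kn)
    show "(\<lambda>s. coeff (b s) j / sqrt v) \<in> borel_measurable P" for j
      using coeff_measurable by measurable
    fix s t assume s: "s \<in> space P"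
    obtain b' where b': "\<forall>j. \<not> m j \<longrightarrow> b' j = 0" "\<forall>l<k. coeff b' l = sqrt v * t l"
      using coeff_surj[of "\<lambda>l. sqrt v * t l"] by blast
    have "v * ls_rss n (?X s) k (\<lambda>l. coeff (b s) l / sqrt v)
        \<le> v * ls_rss n (?X s) k t"
      using b_min[OF s b'(1)] eqb[OF s] eq[OF b', of s] by simp
    then show "ls_rss n (\<lambda>j i. if fst (j, i) < k then \<zeta> (fst (j, i)) (s (snd (j, i))) else e (s (snd (j, i))) / sqrt v) k (\<lambda>l. coeff (b s) l / sqrt v)
       \<le> ls_rss n (\<lambda>j i. if fst (j, i) < k then \<zeta> (fst (j, i)) (s (snd (j, i))) else e (s (snd (j, i))) / sqrt v) k t"
      unfolding fst_conv snd_conv using v by simp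
  qed
qed

text \<open>The design almost surely has full rank, so the minimizer is unique.\<close>

lemma noiseless:
  assumes v: "v = 0"
  shows "AE s in P. sum_sq n s (b s) = 0 \<and> (\<forall>l<k. coeff (b s) l = 0)"
proof -
  have "AE z in D. (e z)\<^sup>2 = 0"
    using integral_nonneg_eq_0_iff_AE[OF gaussian_square_integrable(2)] v by (simp add: v_def)
  then have e0: "AE z in D. e z = 0" by (auto elim: eventually_mono)
  have e0s: "AE s in P. \<forall>i\<in>{..<n}. e (s i) = 0"
  proof (rule AE_finite_allI)
    fix i assume i: "i \<in> {..<n}"
    show "AE s in P. e (s i) = 0"
      by (rule AE_PiM_component[OF _ i e0]) (rule prob_space_axioms)
  qed simp
  have G: "std_gaussian P ({..<k} \<times> {..<n}) (\<lambda>p s. \<zeta> (fst p) (s (snd p)))"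
    by (rule std_gaussian_sample[OF std_gaussian_\<zeta>])
  have rank: "AE s in P. \<forall>l\<in>{..<k}. 0 < gs_sqnorm n l (\<lambda>j i. \<zeta> j (s i))"
    by (rule AE_finite_allI) (use gs_sqnorm_pos[OF G] kn in auto)
  show ?thesis
    using e0s rank AE_space
  proof eventually_elim
    case (elim s)
    let ?Z = "\<lambda>j i. \<zeta> j (s i)"
    obtain b' where b': "\<forall>j. \<not> m j \<longrightarrow> b' j = 0" "\<forall>l<k. coeff b' l = 0"
      using coeff_surj[of "\<lambda>_. 0"] by blast
    have "sum_sq n s b' = 0" unfolding sum_sq_eq[OF b'(1)] using elim(1) b'(2) by simp
    then have z: "sum_sq n s (b s) = 0"
      using b_min[OF elim(3) b'(1)] by (auto simp: sum_sq_def intro!: antisym sum_nonneg)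
    then have lin: "(\<Sum>l<k. coeff (b s) l * ?Z l i) = 0" if "i < n" for i
      using that elim(1) unfolding sum_sq_eq[OF b_support[OF elim(3)]]
      by (subst (asm) sum_nonneg_eq_0_iff) auto
    have "coeff (b s) l = 0" if "l < k" for l
    proof (rule ccontr)
      assume nz: "coeff (b s) l \<noteq> 0"
      \<comment> \<open>Consider the largest index \<open>L\<close> with a nonzero coefficient.
        Pairing the vanishing fit with the residual of column \<open>L\<close> kills all lower
        columns, and the higher coefficients are zero; so the coefficient at \<open>L\<close> times
        a positive norm would be zero.\<close>
      define S where "S = {l. l < k \<and> coeff (b s) l \<noteq> 0}"
      have S: "finite S" "S \<noteq> {}" using nz that by (auto simp: S_def)
      define L where "L = Max S"
      have L: "L < k" "coeff (b s) L \<noteq> 0" using Max_in[OF S] by (auto simp: S_def L_def)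
      have above: "coeff (b s) a = 0" if "L < a" "a < k" for a
      proof (rule ccontr)
        assume "coeff (b s) a \<noteq> 0"
        then have "a \<le> L" unfolding L_def using S(1) that by (intro Max_ge) (auto simp: S_def)
        then show False using that by simp
      qed
      let ?g = "gram_schmidt n ?Z L"
      have "0 = ip n ?g (\<lambda>i. \<Sum>l<k. coeff (b s) l * ?Z l i)"
        using lin by (simp add: ip_def)
      also have "\<dots> = (\<Sum>l<k. coeff (b s) l * ip n ?g (?Z l))" by (rule ip_sum)
      also have "\<dots> = (\<Sum>l\<in>{L}. coeff (b s) l * ip n ?g (?Z l))"
      proof (rule sum.mono_neutral_right)
        show "\<forall>l\<in>{..<k} - {L}. coeff (b s) l * ip n ?g (?Z l) = 0"
        proof
          fix a assume a: "a \<in> {..<k} - {L}"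
          show "coeff (b s) a * ip n ?g (?Z a) = 0"
            using a above[of a] gram_schmidt_ip_column(1)[of a L n ?Z] by (cases "a < L") auto
        qed
      qed (use L in auto)
      also have "\<dots> = coeff (b s) L * gs_sqnorm n L ?Z"
        using gram_schmidt_ip_column(2)[of n ?Z L] by (simp add: gs_sqnorm_def)
      finally show False using L elim(2)[rule_format, of L] by simp
    qed
    then show ?case using z by simp
  qed
qed

lemma rss_tail:
  assumes "0 < \<delta>" "\<delta> \<le> 1 / 2"
  shows "emeasure P {s\<in>space P. v * real (n - k) * \<delta> < \<bar>sum_sq n s (b s) - v * real (n - k)\<bar>}
    \<le> ennreal (2 * exp (- (real (n - k) * \<delta>\<^sup>2) / 16))" (is "emeasure P ?S \<le> _")
proof (cases "v = 0")
  case True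
  have "emeasure P ?S = 0"
    by (rule emeasure_eq_0_AE) (use noiseless[OF True] True in \<open>auto elim: eventually_mono\<close>)
  then show ?thesis by simp
next
  case False
  then have v: "0 < v" using v_nonneg by simp
  interpret L: gaussian_least_squares P n k "\<lambda>p s. if fst p < k then \<zeta> (fst p) (s (snd p)) else e (s (snd p)) / sqrt v"
    "\<lambda>s l. coeff (b s) l / sqrt v" by (rule least_squares_sample(1)[OF v])
  let ?r = "\<lambda>s. ls_rss n (\<lambda>j i. if j < k then \<zeta> j (s i) else e (s i) / sqrt v) k (\<lambda>l. coeff (b s) l / sqrt v)"
  have "emeasure P ?S \<le> emeasure P {s\<in>space P. real (n - k) * \<delta> \<le> \<bar>?r s - real (n - k)\<bar>}"
  proof (rule emeasure_mono)
    show "?S \<subseteq> {s\<in>space P. real (n - k) * \<delta> \<le> \<bar>?r s - real (n - k)\<bar>}"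
    proof safe
      fix s assume s: "s \<in> space P" and lt: "v * real (n - k) * \<delta> < \<bar>sum_sq n s (b s) - v * real (n - k)\<bar>"
      have "\<bar>sum_sq n s (b s) - v * real (n - k)\<bar> = v * \<bar>?r s - real (n - k)\<bar>"
        unfolding least_squares_sample(2)[OF v s] using v by (simp add: abs_mult flip: right_diff_distrib)
      then show "real (n - k) * \<delta> \<le> \<bar>?r s - real (n - k)\<bar>" using lt v by (simp add: mult.assoc)
    qed
    have "?r \<in> borel_measurable P"
      using sum_sq_measurable
      by (subst measurable_cong[of _ _ "\<lambda>s. sum_sq n s (b s) / v"]) (use v least_squares_sample(2)[OF v] in auto)
    then show "{s\<in>space P. real (n - k) * \<delta> \<le> \<bar>?r s - real (n - k)\<bar>} \<in> sets P" by measurable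
  qed
  also have "\<dots> \<le> ennreal (2 * exp (- (real (n - k) * \<delta>\<^sup>2) / 16))"
    using L.residual_tail[of \<delta>, unfolded fst_conv snd_conv] assms by simp
  finally show ?thesis .
qed

lemma pred_error_scaled:
  assumes "0 < v"
  shows "pred_error s = v * (1 + (\<Sum>l<k. (coeff (b s) l / sqrt v)\<^sup>2))"
  using assms by (simp add: pred_error_def power_divide distrib_left sum_distrib_left)

lemma pred_error_tail:
  assumes "0 < \<delta>" "\<delta> \<le> 1 / 2"
  shows "emeasure P {s\<in>space P. v * (4 * real n * \<delta> / real (n - k + 1))
       < \<bar>pred_error s - v * (1 + real k / real (n - k + 1))\<bar>}
    \<le> ennreal (4 * exp (- (real (n - k) * \<delta>\<^sup>2) / 16))" (is "emeasure P ?S \<le> _")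
proof (cases "v = 0")
  case True
  have "AE s in P. pred_error s = 0"
    using noiseless[OF True] by eventually_elim (simp add: pred_error_def True)
  then have "emeasure P ?S = 0"
    by (intro emeasure_eq_0_AE) (use True in \<open>auto elim: eventually_mono\<close>)
  then show ?thesis by simp
next
  case False
  then have v: "0 < v" using v_nonneg by simp
  interpret L: gaussian_least_squares P n k "\<lambda>p s. if fst p < k then \<zeta> (fst p) (s (snd p)) else e (s (snd p)) / sqrt v"
    "\<lambda>s l. coeff (b s) l / sqrt v" by (rule least_squares_sample(1)[OF v])
  have "\<bar>pred_error s - v * (1 + real k / real (n - k + 1))\<bar>
      = v * \<bar>(\<Sum>l<k. (coeff (b s) l / sqrt v)\<^sup>2) - real k / real (n - k + 1)\<bar>" for s
    unfolding pred_error_scaled[OF v] using v by (simp add: abs_mult flip: right_diff_distrib)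
  then have "?S = {s\<in>space P. 4 * real n * \<delta> / real (n - k + 1)
      < \<bar>(\<Sum>l<k. (coeff (b s) l / sqrt v)\<^sup>2) - real k / real (n - k + 1)\<bar>}"
    using v by (simp only: mult_less_cancel_left_pos)
  then show ?thesis using L.error_tail[OF assms] by simp
qed

lemma pred_error_mean:
  "(\<integral>\<^sup>+s. ennreal (pred_error s) \<partial>P) = ennreal (v * (1 + real k / (real n - real k - 1)))"
proof (cases "v = 0")
  case True
  have "AE s in P. ennreal (pred_error s) = 0"
    using noiseless[OF True] by eventually_elim (simp add: pred_error_def True)
  then have "(\<integral>\<^sup>+s. ennreal (pred_error s) \<partial>P) = (\<integral>\<^sup>+s. 0 \<partial>P)" by (rule nn_integral_cong_AE)
  then show ?thesis using True by simp
next
  case False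
  then have v: "0 < v" using v_nonneg by simp
  interpret L: gaussian_least_squares P n k "\<lambda>p s. if fst p < k then \<zeta> (fst p) (s (snd p)) else e (s (snd p)) / sqrt v"
    "\<lambda>s l. coeff (b s) l / sqrt v" by (rule least_squares_sample(1)[OF v])
  have "(\<integral>\<^sup>+s. ennreal (pred_error s) \<partial>P)
      = (\<integral>\<^sup>+s. ennreal v + ennreal v * ennreal (\<Sum>l<k. (coeff (b s) l / sqrt v)\<^sup>2) \<partial>P)"
    unfolding pred_error_scaled[OF v] using v
    by (intro nn_integral_cong) (simp add: ennreal_mult[symmetric] sum_nonneg distrib_left flip: ennreal_plus)
  also have "\<dots> = ennreal v + ennreal v * ennreal (real k / (real n - real k - 1))"
    using coeff_measurable
    by (subst nn_integral_add; simp add: nn_integral_cmult L.error_mean[OF kn(2)] prob_space.emeasure_space_1[OF prob_space_PiM[OF prob_space_axioms]])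
  also have "\<dots> = ennreal (v * (1 + real k / (real n - real k - 1)))"
    using v kn(2) by (simp add: ennreal_mult[symmetric] distrib_left flip: ennreal_plus)
  finally show ?thesis .
qed

end

section \<open>Prediction errors\<close>

text \<open>Freezing the first component and integrating out the independent second one gives a
  function of the first component with the right integrals over all cylinder sets, which
  characterises the conditional expectation.\<close>

lemma nn_cond_exp_fst:
  assumes "prob_space P" "prob_space D" and S: "sets S = sets P"
    and f[measurable]: "f \<in> borel_measurable (P \<Otimes>\<^sub>M D)"
  shows "AE \<omega> in P \<Otimes>\<^sub>M D. nn_cond_exp (P \<Otimes>\<^sub>M D) (vimage_algebra (space (P \<Otimes>\<^sub>M D)) fst S) f \<omega>
           = (\<integral>\<^sup>+z. f (fst \<omega>, z) \<partial>D)"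
proof -
  interpret P: prob_space P by fact
  interpret D: prob_space D by fact
  interpret PD: pair_prob_space P D by unfold_locales
  let ?J = "P \<Otimes>\<^sub>M D"
  let ?F = "vimage_algebra (space ?J) fst S"
  have sp: "space S = space P" by (rule sets_eq_imp_space_eq[OF S])
  have fstS: "fst \<in> space ?J \<rightarrow> space S" by (auto simp: space_pair_measure sp)
  have setsF: "sets ?F = {fst -` A \<inter> space ?J | A. A \<in> sets P}"
    using sets_vimage_algebra2[OF fstS] by (simp add: S)
  have sub: "subalgebra ?J ?F"
    unfolding subalgebra_def setsF by (auto intro: measurable_sets[OF measurable_fst])
  interpret finite_measure_subalgebra ?J ?F
    by unfold_locales (rule sub)
  define g where "g s = (\<integral>\<^sup>+z. f (s, z) \<partial>D)" for s
  have g[measurable]: "g \<in> borel_measurable P" unfolding g_def[abs_def] by measurable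
  have gF: "(\<lambda>\<omega>. g (fst \<omega>)) \<in> borel_measurable ?F"
    using measurable_compose[OF measurable_vimage_algebra1[OF fstS], of g borel] g S
    by (simp add: measurable_cong_sets[OF S refl])
  have "AE \<omega> in ?J. g (fst \<omega>) = nn_cond_exp ?J ?F f \<omega>"
  proof (rule nn_cond_exp_charact[OF _ f gF])
    fix A assume "A \<in> sets ?F"
    then obtain B where B[measurable]: "B \<in> sets P" and A: "A = fst -` B \<inter> space ?J" by (auto simp: setsF)
    have ind: "\<omega> \<in> space ?J \<Longrightarrow> (indicator A \<omega> :: ennreal) = indicator B (fst \<omega>)" for \<omega>
      by (auto simp: A indicator_def)
    have "(\<integral>\<^sup>+\<omega>\<in>A. f \<omega> \<partial>?J) = (\<integral>\<^sup>+\<omega>. f \<omega> * indicator B (fst \<omega>) \<partial>?J)"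
      by (intro nn_integral_cong) (simp add: ind)
    also have "\<dots> = (\<integral>\<^sup>+s. \<integral>\<^sup>+z. f (s, z) * indicator B s \<partial>D \<partial>P)"
      by (subst D.nn_integral_fst[symmetric]) simp_all
    also have "\<dots> = (\<integral>\<^sup>+s. g s * indicator B s \<partial>P)"
      unfolding g_def by (intro nn_integral_cong nn_integral_multc) measurable
    also have "\<dots> = (\<integral>\<^sup>+s. \<integral>\<^sup>+z. g s * indicator B s \<partial>D \<partial>P)"
      by (simp add: D.emeasure_space_1)
    also have "\<dots> = (\<integral>\<^sup>+\<omega>. g (fst \<omega>) * indicator B (fst \<omega>) \<partial>?J)"
      by (subst D.nn_integral_fst[symmetric]) simp_all
    also have "\<dots> = (\<integral>\<^sup>+\<omega>\<in>A. g (fst \<omega>) \<partial>?J)"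
      by (intro nn_integral_cong) (simp add: ind)
    finally show "(\<integral>\<^sup>+\<omega>\<in>A. f \<omega> \<partial>?J) = (\<integral>\<^sup>+\<omega>\<in>A. g (fst \<omega>) \<partial>?J)" .
  qed
  then show ?thesis by eventually_elim (simp add: g_def)
qed

text \<open>Outside \<open>B\<close> both fluctuations are controlled relative to \<open>v\<close>.
  The factor 6 adds the 2 of \<open>rss_tail\<close> and the 4 of
  \<open>pred_error_tail\<close>.\<close>

definition exceptional_event ::
    "nat \<Rightarrow> obs measure \<Rightarrow> estimator \<Rightarrow> model \<Rightarrow> real \<Rightarrow> real \<Rightarrow> (sample \<times> obs) set \<Rightarrow> bool" where
  "exceptional_event n D est m v \<delta> B \<longleftrightarrow> B \<in> sets (joint_law n D) \<and>
         emeasure (joint_law n D) B \<le> ennreal (6 * exp (- (real (n - msize m) * \<delta>\<^sup>2) / 16)) \<and>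
         (\<forall>\<omega>\<in>space (joint_law n D) - B. \<bar>RSS n est m (fst \<omega>) / real (n - msize m) - v\<bar> \<le> v * \<delta> \<and>
            \<bar>rho2 n D est m \<omega> - v * (1 + real (msize m) / real (n - msize m + 1))\<bar>
              \<le> v * (4 * real n * \<delta> / real (n - msize m + 1)))"

context fitted_model
begin

abbreviation "Q \<equiv> joint_law n D"

lemma Q_eq: "Q = P \<Otimes>\<^sub>M D" by (simp add: joint_law_def)

lemma prob_P: "prob_space P" by (rule prob_space_PiM) (rule prob_space_axioms)

lemma sq_pred_error_measurable:
  assumes "est m = b"
  shows "sq_pred_error est m \<in> borel_measurable (P \<Otimes>\<^sub>M D)"
proof -
  have "(\<lambda>\<omega>. (fst (snd \<omega>) - (\<Sum>j\<in>J. snd (snd \<omega>) j * b (fst \<omega>) j))\<^sup>2) \<in> borel_measurable (P \<Otimes>\<^sub>M D)"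
    by (intro borel_measurable_power borel_measurable_diff borel_measurable_sum borel_measurable_times
        measurable_compose[OF measurable_snd] measurable_compose[OF measurable_fst b_measurable] D_measurable)
  then show ?thesis
    by (rule measurable_cong[THEN iffD1, rotated])
       (auto simp: sq_pred_error_def assms predict_eq b_support space_pair_measure)
qed

lemma nn_pred_error:
  assumes "s \<in> space P"
  shows "(\<integral>\<^sup>+z. ennreal ((fst z - predict (snd z) (b s))\<^sup>2) \<partial>D) = ennreal (pred_error s)"
  using pred_error_eq[OF assms] by (subst nn_integral_eq_integral) auto

lemma pred_error_nonneg: "0 \<le> pred_error s"
  using v_nonneg by (simp add: pred_error_def sum_nonneg)

lemma rho2_eq:
  assumes est: "est m = b"
  shows "AE \<omega> in Q. rho2 n D est m \<omega> = pred_error (fst \<omega>)"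
proof -
  interpret P: prob_space P by (rule prob_P)
  interpret PD: pair_prob_space P D by unfold_locales
  have m: "sq_pred_error est m \<in> borel_measurable (P \<Otimes>\<^sub>M D)" by (rule sq_pred_error_measurable[of est, OF est])
  have F: "sample_sigma n D = vimage_algebra (space (P \<Otimes>\<^sub>M D)) fst (sample_space n)"
    by (simp add: sample_sigma_def Q_eq)
  note ce = nn_cond_exp_fst[OF prob_P prob_space_axioms sets_P[symmetric]]
  have "AE \<omega> in P \<Otimes>\<^sub>M D. nn_cond_exp (P \<Otimes>\<^sub>M D) (sample_sigma n D) (\<lambda>\<omega>. ennreal (sq_pred_error est m \<omega>)) \<omega>
      = (\<integral>\<^sup>+z. ennreal (sq_pred_error est m (fst \<omega>, z)) \<partial>D)"
    unfolding F by (rule ce) (use m in measurable)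
  \<comment> \<open>\<open>real_cond_exp\<close> is a difference of two nonnegative conditional
    expectations; the second one vanishes for a squared error.\<close>
  moreover have "AE \<omega> in P \<Otimes>\<^sub>M D. nn_cond_exp (P \<Otimes>\<^sub>M D) (sample_sigma n D) (\<lambda>\<omega>. ennreal (- sq_pred_error est m \<omega>)) \<omega>
      = (\<integral>\<^sup>+z. ennreal (- sq_pred_error est m (fst \<omega>, z)) \<partial>D)"
    unfolding F by (rule ce) (use m in measurable)
  ultimately have "AE \<omega> in P \<Otimes>\<^sub>M D. rho2 n D est m \<omega> = pred_error (fst \<omega>)"
    using AE_space
  proof eventually_elim
    case (elim \<omega>)
    have s: "fst \<omega> \<in> space P" using elim(3) by (auto simp: space_pair_measure)
    have "(\<integral>\<^sup>+z. ennreal (- sq_pred_error est m (fst \<omega>, z)) \<partial>D) = 0"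
      by (simp add: sq_pred_error_def ennreal_neg)
    then show ?case
      using elim(1,2) nn_pred_error[OF s] pred_error_nonneg[of "fst \<omega>"]
      by (simp add: rho2_def real_cond_exp_def Q_eq sq_pred_error_def est)
  qed
  then show ?thesis by (simp only: Q_eq)
qed

lemma R2_eq:
  assumes est: "est m = b"
  shows "R2 n D est m \<omega> = v * (1 + real k / (real n - real k - 1))"
proof -
  interpret P: prob_space P by (rule prob_P)
  interpret PD: pair_prob_space P D by unfold_locales
  have m[measurable]: "sq_pred_error est m \<in> borel_measurable (P \<Otimes>\<^sub>M D)" by (rule sq_pred_error_measurable[of est, OF est])
  have "(\<integral>\<^sup>+\<omega>. ennreal (sq_pred_error est m \<omega>) \<partial>(P \<Otimes>\<^sub>M D)) = (\<integral>\<^sup>+s. \<integral>\<^sup>+z. ennreal (sq_pred_error est m (s, z)) \<partial>D \<partial>P)"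
    by (rule nn_integral_fst[symmetric]) measurable
  also have "\<dots> = (\<integral>\<^sup>+s. ennreal (pred_error s) \<partial>P)"
    by (intro nn_integral_cong) (simp add: sq_pred_error_def est nn_pred_error)
  also have "\<dots> = ennreal (v * (1 + real k / (real n - real k - 1)))" by (rule pred_error_mean)
  finally have "(\<integral>\<omega>. sq_pred_error est m \<omega> \<partial>(P \<Otimes>\<^sub>M D)) = enn2real (ennreal (v * (1 + real k / (real n - real k - 1))))"
    using m by (subst integral_eq_nn_integral) (auto simp: sq_pred_error_def)
  also have "\<dots> = v * (1 + real k / (real n - real k - 1))"
    using v_nonneg kn by (intro enn2real_ennreal mult_nonneg_nonneg add_nonneg_nonneg divide_nonneg_nonneg) auto
  finally show ?thesis by (simp add: R2_def Q_eq)
qed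

lemma emeasure_Q_fst:
  assumes "S \<in> sets P"
  shows "emeasure Q (S \<times> space D) = emeasure P S"
proof -
  interpret P: prob_space P by (rule prob_P)
  show ?thesis unfolding Q_eq using assms by (subst emeasure_pair_measure_Times) (auto simp: emeasure_space_1)
qed

lemma model_bounds:
  assumes est: "est m = b" and \<delta>: "0 < \<delta>" "\<delta> \<le> 1 / 2"
  shows "\<exists>B. exceptional_event n D est m v \<delta> B"
proof -
  let ?E = "exp (- (real (n - k) * \<delta>\<^sup>2) / 16)"
  define S1 where "S1 = {s\<in>space P. v * real (n - k) * \<delta> < \<bar>sum_sq n s (b s) - v * real (n - k)\<bar>}"
  define S2 where "S2 = {s\<in>space P. v * (4 * real n * \<delta> / real (n - k + 1))
       < \<bar>pred_error s - v * (1 + real k / real (n - k + 1))\<bar>}"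
  note [measurable] = sum_sq_measurable pred_error_measurable
  have S1: "S1 \<in> sets P" unfolding S1_def by measurable
  have S2: "S2 \<in> sets P" unfolding S2_def by measurable
  \<comment> \<open>\<open>rho2\<close> is one version of a conditional expectation; the null set
    where it differs from \<open>pred_error\<close> is absorbed into the exceptional event.\<close>
  obtain N where N: "N \<in> null_sets Q" "{\<omega>\<in>space Q. rho2 n D est m \<omega> \<noteq> pred_error (fst \<omega>)} \<subseteq> N"
    using rho2_eq[of est, OF est] by (auto elim!: AE_E simp: null_sets_def)
  define B where "B = (S1 \<times> space D) \<union> (S2 \<times> space D) \<union> N"
  have s12: "S1 \<times> space D \<in> sets Q" "S2 \<times> space D \<in> sets Q"
    unfolding Q_eq using S1 S2 by auto
  have B: "B \<in> sets Q" unfolding B_def using s12 N(1) by auto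
  have "emeasure Q B = emeasure Q ((S1 \<times> space D) \<union> (S2 \<times> space D))"
    unfolding B_def using s12 N(1) by (intro emeasure_Un_null_set) auto
  also have "\<dots> \<le> emeasure Q (S1 \<times> space D) + emeasure Q (S2 \<times> space D)"
    by (rule emeasure_subadditive[OF s12])
  also have "\<dots> \<le> ennreal (2 * ?E) + ennreal (4 * ?E)"
    unfolding emeasure_Q_fst[OF S1] emeasure_Q_fst[OF S2] unfolding S1_def S2_def
    by (rule add_mono[OF rss_tail[OF \<delta>] pred_error_tail[OF \<delta>]])
  also have "\<dots> = ennreal (6 * ?E)" by (simp flip: ennreal_plus)
  finally have EB: "emeasure Q B \<le> ennreal (6 * ?E)" .
  show ?thesis
    unfolding exceptional_event_def
  proof (intro exI[of _ B] conjI B EB ballI)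
    fix \<omega> assume w: "\<omega> \<in> space Q - B"
    then have s: "fst \<omega> \<in> space P" "snd \<omega> \<in> space D" by (auto simp: Q_eq space_pair_measure)
    have 1: "\<bar>sum_sq n (fst \<omega>) (b (fst \<omega>)) - v * real (n - k)\<bar> \<le> v * real (n - k) * \<delta>"
      using w s by (cases \<omega>) (auto simp: B_def S1_def not_less)
    have d: "0 < real (n - k)" using kn by simp
    have "RSS n est m (fst \<omega>) / real (n - k) - v = (sum_sq n (fst \<omega>) (b (fst \<omega>)) - v * real (n - k)) / real (n - k)"
      using d by (simp add: RSS_def est diff_divide_distrib del: of_nat_diff)
    then have "\<bar>RSS n est m (fst \<omega>) / real (n - k) - v\<bar> = \<bar>sum_sq n (fst \<omega>) (b (fst \<omega>)) - v * real (n - k)\<bar> / real (n - k)"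
      by (simp only: abs_divide abs_of_nat)
    also have "\<dots> \<le> v * real (n - k) * \<delta> / real (n - k)" using 1 by (intro divide_right_mono) auto
    finally show "\<bar>RSS n est m (fst \<omega>) / real (n - k) - v\<bar> \<le> v * \<delta>" using d by simp
    have "rho2 n D est m \<omega> = pred_error (fst \<omega>)" using w N(2) by (auto simp: B_def)
    then show "\<bar>rho2 n D est m \<omega> - v * (1 + real k / real (n - k + 1))\<bar> \<le> v * (4 * real n * \<delta> / real (n - k + 1))"
      using w s by (cases \<omega>) (auto simp: B_def S2_def not_less)
  qed
qed

end

lemma response_variance_eq:
  assumes "centered_gaussian_law D"
  shows "response_variance D = (\<integral>z. (fst z)\<^sup>2 \<partial>D)"
  using assms by (simp add: response_variance_def centered_gaussian_law_def)

text \<open>Hides the whitening. The order of quantifiers matters: \<open>v\<close> is fixed by the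
  law and the model, and only the event varies with \<open>\<delta>\<close>.\<close>

lemma model_bounds_law:
  assumes D: "is_data_law \<theta> D" and c: "response_variance D \<le> c"
    and fin: "finite {j. m j}" and size: "msize m < n - 1" and ls: "restricted_ls_estimator n m (est m)"
  shows "\<exists>v. 0 \<le> v \<and> v \<le> c \<and>
    (\<forall>\<omega>. R2 n D est m \<omega> = v * (1 + real (msize m) / (real n - real (msize m) - 1))) \<and>
    (\<forall>\<delta>. 0 < \<delta> \<longrightarrow> \<delta> \<le> 1 / 2 \<longrightarrow>
      (\<exists>B. exceptional_event n D est m v \<delta> B))"
proof -
  let ?B = "\<lambda>i j. \<integral>z. snd z i * snd z j \<partial>D"
  have L: "centered_gaussian_law D" by (rule data_law_centered_gaussian[OF D])
  have sym: "?B i j = ?B j i" for i j by (simp add: mult.commute)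
  have pd: "\<exists>j\<in>{j. m j}. v j \<noteq> 0 \<Longrightarrow> 0 < bilin {j. m j} ?B v v" for v
    using L fin by (simp add: centered_gaussian_law_def)
  obtain W A where
    "\<forall>l<msize m. \<forall>l'<msize m. bilin {j. m j} ?B (W l) (W l') = of_bool (l = l')"
    "\<forall>x. \<forall>j\<in>{j. m j}. x j = (\<Sum>l<msize m. A j l * (\<Sum>i\<in>{j. m j}. W l i * x i))"
    using whitening_exists[of ?B "{j. m j}", OF sym fin pd] unfolding msize_def by blast
  then interpret fitted_model D n m "est m" W A
    using L fin size ls by unfold_locales auto
  show ?thesis
    using v_nonneg v_le c R2_eq[of est] model_bounds[of est]
    by (intro exI[of _ v]) (auto simp: response_variance_eq[OF L])
qed

section \<open>Uniform rates\<close>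

text \<open>Reparametrises the threshold as \<open>K = c1 * \<kappa> + c2\<close>. The bound depends
  on neither \<open>n\<close> nor the parameter, so it survives supremum and limsup, and it tends to
  zero as \<open>K\<close> grows.\<close>

lemma uniformly_OpI:
  assumes c1: "0 < c1"
    and tail: "\<And>\<kappa>. 4 \<le> \<kappa> \<Longrightarrow> \<forall>\<^sub>F n in sequentially. \<forall>\<theta>\<in>\<Theta>.
      emeasure (Q n \<theta>) {\<omega>\<in>space (Q n \<theta>). \<bar>T n \<theta> \<omega>\<bar> > (c1 * \<kappa> + c2) * a n}
        \<le> ennreal (6 * 2 powr (1 - \<kappa>\<^sup>2 / 16))"
  shows "uniformly_Op \<Theta> Q T a"
proof -
  let ?k = "\<lambda>K. (K - c2) / c1"
  let ?g = "\<lambda>K. ennreal (6 * 2 powr (1 - (?k K)\<^sup>2 / 16))"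
  have "((\<lambda>K. 6 * 2 powr (1 - (?k K)\<^sup>2 / 16)) \<longlongrightarrow> 0) at_top"
    using c1 by real_asymp
  from tendsto_ennrealI[OF this] have g: "(?g \<longlongrightarrow> 0) at_top" by simp
  have ev: "\<forall>\<^sub>F K in at_top. limsup (\<lambda>n. SUP \<theta>\<in>\<Theta>.
        emeasure (Q n \<theta>) {\<omega>\<in>space (Q n \<theta>). \<bar>T n \<theta> \<omega>\<bar> > K * a n}) \<le> ?g K"
    using eventually_ge_at_top[of "4 * c1 + c2"]
  proof eventually_elim
    case (elim K)
    have "4 \<le> ?k K" using elim c1 by (simp add: field_simps)
    moreover have "c1 * ?k K + c2 = K" using c1 by simp
    ultimately have "\<forall>\<^sub>F n in sequentially. \<forall>\<theta>\<in>\<Theta>.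
        emeasure (Q n \<theta>) {\<omega>\<in>space (Q n \<theta>). \<bar>T n \<theta> \<omega>\<bar> > K * a n} \<le> ?g K"
      using tail[of "?k K"] by simp
    then show ?case by (intro Limsup_bounded) (auto elim!: eventually_mono intro!: SUP_least)
  qed
  show ?thesis unfolding uniformly_Op_def
    by (rule tendsto_sandwich[OF _ ev tendsto_const g]) simp
qed

text \<open>All criteria and targets share the form \<open>1 + k / (N + j)\<close> with
  \<open>N = n - k\<close>. The difference splits into the error of \<open>x\<close>, inflated by at
  most \<open>2 / q\<close>, which cancels the \<open>q\<close> in its bound, and the effect of
  changing \<open>j\<close>, which is of order \<open>1 / (n * q\<^sup>2)\<close> and hence of order
  \<open>a\<close>.\<close>

lemma criterion_target_gap:
  fixes N k q a \<kappa> L v c x j j' :: real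
  assumes k: "0 \<le> k" and N: "2 \<le> N" and q: "0 < q" "q \<le> 1" "(N + k) * q \<le> N"
    and a: "0 \<le> a" "a \<le> 1" "a\<^sup>2 * ((N + k) * q ^ 3) = L" and L: "1 / 2 \<le> L" and \<kappa>: "0 \<le> \<kappa>"
    and v: "0 \<le> v" "v \<le> c" and x: "\<bar>x - v\<bar> \<le> v * (\<kappa> * a * q)"
    and j: "\<bar>j\<bar> \<le> 1" "\<bar>j'\<bar> \<le> 1"
  shows "\<bar>x * (1 + k / (N + j)) - v * (1 + k / (N + j'))\<bar> \<le> c * (2 * \<kappa> + 16) * a"
proof -
  have t: "N / 2 \<le> N + j" "0 < N + j" "N / 2 \<le> N + j'" "0 < N + j'" using N j by (auto simp: abs_le_iff)
  have c: "0 \<le> c" using v by simp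
  have f: "1 + k / (N + j) \<le> 2 / q"
  proof -
    have "k / (N + j) \<le> k / (N / 2)" using t k N by (intro divide_left_mono) auto
    then have "1 + k / (N + j) \<le> (N + 2 * k) / N" using N by (simp add: field_simps)
    also have "\<dots> \<le> 2 * (N + k) / N" using N k by (intro divide_right_mono) auto
    also have "\<dots> \<le> 2 / q" using N q by (simp add: field_simps)
    finally show ?thesis .
  qed
  have "\<bar>(x - v) * (1 + k / (N + j))\<bar> = \<bar>x - v\<bar> * (1 + k / (N + j))"
    using k t by (simp add: abs_mult)
  also have "\<dots> \<le> v * (\<kappa> * a * q) * (2 / q)"
    using x f v \<kappa> a q k t by (intro mult_mono) auto
  also have "\<dots> = v * (2 * \<kappa> * a)" using q by simp
  also have "\<dots> \<le> c * (2 * \<kappa> * a)" using v \<kappa> a by (intro mult_right_mono) auto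
  finally have 1: "\<bar>(x - v) * (1 + k / (N + j))\<bar> \<le> c * (2 * \<kappa> * a)" .
  \<comment> \<open>Passing to \<open>q ^ 3\<close> and using \<open>L \<ge> 1 / 2\<close> gives the
    bound \<open>2 * a\<^sup>2\<close>; then \<open>a \<le> 1\<close> lowers the power.\<close>
  have inv: "1 / ((N + k) * q\<^sup>2) \<le> 2 * a"
  proof -
    have p: "0 < (N + k) * q ^ 3" "0 < (N + k) * q\<^sup>2" using N k q by auto
    have "q ^ 3 \<le> q\<^sup>2" using q by (intro power_decreasing) auto
    then have "1 / ((N + k) * q\<^sup>2) \<le> 1 / ((N + k) * q ^ 3)"
      using p N k q by (intro divide_left_mono mult_left_mono) auto
    also have "\<dots> \<le> 2 * L / ((N + k) * q ^ 3)" using L p by (intro divide_right_mono) auto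
    also have "\<dots> = 2 * a\<^sup>2" unfolding a(3)[symmetric] using N k q by simp
    also have "a\<^sup>2 \<le> a" using a by (simp add: power2_eq_square mult_left_le)
    finally show ?thesis by simp
  qed
  have "\<bar>k / (N + j) - k / (N + j')\<bar> = k * \<bar>j' - j\<bar> / ((N + j) * (N + j'))"
  proof -
    have "k / (N + j) - k / (N + j') = k * (j' - j) / ((N + j) * (N + j'))"
      using t by (simp add: field_simps)
    then show ?thesis using k t by (simp add: abs_mult)
  qed
  also have "\<dots> \<le> k * 2 / ((N / 2) * (N / 2))"
    using k t j N by (intro frac_le mult_left_mono mult_mono) (auto simp: abs_le_iff)
  also have "\<dots> = 8 * k / (N * N)" by simp
  \<comment> \<open>The numerator grows to the sample size \<open>N + k\<close>, and
    \<open>N\<close> is replaced by its lower bound \<open>(N + k) * q\<close>.\<close>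
  also have "\<dots> \<le> 8 * (N + k) / (((N + k) * q) * ((N + k) * q))"
    using k N q by (intro frac_le mult_mono) auto
  also have "\<dots> = 8 * (1 / ((N + k) * q\<^sup>2))"
  proof -
    have S: "8 * S / ((S * q) * (S * q)) = 8 * (1 / (S * q\<^sup>2))" if "0 < S" for S
      using that by (simp add: power2_eq_square)
    show ?thesis by (rule S) (use k N in simp)
  qed
  also have "\<dots> \<le> 8 * (2 * a)" using inv by simp
  finally have d: "\<bar>k / (N + j) - k / (N + j')\<bar> \<le> 16 * a" by simp
  have "\<bar>v * (k / (N + j) - k / (N + j'))\<bar> = v * \<bar>k / (N + j) - k / (N + j')\<bar>" using v by (simp only: abs_mult abs_of_nonneg)
  also have "\<dots> \<le> c * (16 * a)" using d v by (intro mult_mono) auto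
  finally have 2: "\<bar>v * (k / (N + j) - k / (N + j'))\<bar> \<le> c * (16 * a)" .
  have "x * (1 + p) - v * (1 + p') = (x - v) * (1 + p) + v * (p - p')" for p p'
    by (simp add: algebra_simps)
  then have "\<bar>x * (1 + k / (N + j)) - v * (1 + k / (N + j'))\<bar>
      = \<bar>(x - v) * (1 + k / (N + j)) + v * (k / (N + j) - k / (N + j'))\<bar>" by (rule arg_cong)
  also have "\<dots> \<le> c * (2 * \<kappa> * a) + c * (16 * a)"
    by (rule order_trans[OF abs_triangle_ineq add_mono[OF 1 2]])
  also have "\<dots> = c * (2 * \<kappa> + 16) * a" by (simp add: algebra_simps)
  finally show ?thesis .
qed

text \<open>One event serves all models, criteria and targets simultaneously, so data-dependent
  models can be inserted afterwards. The factor \<open>6 * \<kappa> + 16\<close> adds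
  \<open>2 * \<kappa> + 16\<close> from \<open>criterion_target_gap\<close> and
  \<open>4 * \<kappa>\<close> from the fluctuation of \<open>rho2\<close>.\<close>

lemma criteria_deviation:
  fixes Ms :: "nat \<Rightarrow> model set"
  assumes D: "is_data_law \<theta> D" and c: "response_variance D \<le> c" and n: "2 \<le> n"
    and Mfin: "finite (Ms n)" "Ms n \<noteq> {}"
    and size: "\<And>m. m \<in> Ms n \<Longrightarrow> finite {j. m j} \<and> msize m < n - 1"
    and ls: "\<And>m. m \<in> Ms n \<Longrightarrow> restricted_ls_estimator n m (est m)"
    and \<kappa>: "4 \<le> \<kappa>" "\<kappa> * rate Ms n \<le> 1 / 2"
  shows "\<exists>B\<in>sets (joint_law n D). emeasure (joint_law n D) B \<le> ennreal (6 * 2 powr (1 - \<kappa>\<^sup>2 / 16)) \<and>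
    (\<forall>\<omega>\<in>space (joint_law n D) - B. \<forall>m\<in>Ms n. \<forall>C\<in>{GCV, Sp, rho2_hat}. \<forall>L\<in>{rho2, R2}.
       \<bar>C n est m (fst \<omega>) - L n D est m \<omega>\<bar> \<le> c * (6 * \<kappa> + 16) * rate Ms n)"
proof -
  define a where "a = rate Ms n"
  define q where "q = 1 - max_ratio Ms n"
  define l where "l = ln (real (card (Ms n)) + 1)"
  have card: "1 \<le> card (Ms n)" using Mfin by (simp add: Suc_le_eq card_gt_0_iff)
  have ratio_le: "real (msize m) / real n \<le> max_ratio Ms n" if "m \<in> Ms n" for m
    unfolding max_ratio_def by (rule cSUP_upper[OF that]) (use Mfin in auto)
  \<comment> \<open>The supremum over a finite family is attained, so \<open>q > 0\<close> follows
    from the size bound of a single model.\<close>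
  have "max_ratio Ms n \<in> (\<lambda>m. real (msize m) / real n) ` Ms n"
    unfolding max_ratio_def using Mfin by (subst cSup_eq_Max) (auto intro!: Max_in)
  then obtain m0 where m0: "m0 \<in> Ms n" "max_ratio Ms n = real (msize m0) / real n" by blast
  have q: "0 < q" "q \<le> 1" using m0(2) size[OF m0(1)] n by (auto simp: q_def)
  have Nq: "real n * q \<le> real n - real (msize m)" if "m \<in> Ms n" for m
    using ratio_le[OF that] n by (simp add: q_def field_simps)
  have l: "1 / 2 \<le> l"
  proof -
    have "1 / 2 \<le> ln (2 :: real)" using ln_le_minus_one[of "1 / 2 :: real"] by (simp add: ln_div)
    also have "\<dots> \<le> l" unfolding l_def using card by simp
    finally show ?thesis .
  qed
  have nq3: "0 < real n * q ^ 3" using n q by simp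
  have a: "a = sqrt (l / (real n * q ^ 3))" by (simp add: a_def rate_def l_def q_def)
  have a0: "0 \<le> a" unfolding a using l nq3 by simp
  have a2: "a\<^sup>2 * (real n * q ^ 3) = l" unfolding a using l nq3 n q by (simp add: divide_nonneg_pos)
  have apos: "0 < a" using a2 l a0 by (cases "a = 0") auto
  have a1: "a \<le> 1"
  proof -
    have "4 * a \<le> \<kappa> * a" using \<kappa>(1) a0 by (intro mult_right_mono)
    then show ?thesis using \<kappa>(2) by (simp add: a_def)
  qed
  \<comment> \<open>With this choice every exponent \<open>(n - |m|) * \<delta>\<^sup>2\<close> dominates \<open>\<kappa>\<^sup>2 * ln (card (Ms n) + 1)\<close>, which pays
      for the union bound.\<close>
  define \<delta> where "\<delta> = \<kappa> * a * q"
  have \<delta>: "0 < \<delta>" "\<delta> \<le> 1 / 2"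
  proof -
    show "0 < \<delta>" using \<kappa>(1) apos q by (simp add: \<delta>_def)
    have "\<delta> \<le> \<kappa> * a * 1" unfolding \<delta>_def using q \<kappa>(1) a0 by (intro mult_left_mono) auto
    then show "\<delta> \<le> 1 / 2" using \<kappa>(2) by (simp add: a_def)
  qed
  define bounds where "bounds m v B \<longleftrightarrow> 0 \<le> v \<and> v \<le> c \<and>
      (\<forall>\<omega>. R2 n D est m \<omega> = v * (1 + real (msize m) / (real n - real (msize m) - 1))) \<and>
      exceptional_event n D est m v \<delta> B" for m v B
  have "\<exists>v B. bounds m v B" if m: "m \<in> Ms n" for m
  proof -
    obtain v where v: "0 \<le> v" "v \<le> c"
      "\<forall>\<omega>. R2 n D est m \<omega> = v * (1 + real (msize m) / (real n - real (msize m) - 1))"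
      and tails: "\<forall>\<delta>. 0 < \<delta> \<longrightarrow> \<delta> \<le> 1 / 2 \<longrightarrow>
      (\<exists>B. exceptional_event n D est m v \<delta> B)"
      using model_bounds_law[of \<theta> D c m n est] D c size[OF m] ls[OF m] by blast
    from tails[rule_format, OF \<delta>] obtain B where "exceptional_event n D est m v \<delta> B" ..
    with v show ?thesis unfolding bounds_def by blast
  qed
  then obtain v B where vB: "\<And>m. m \<in> Ms n \<Longrightarrow> bounds m (v m) (B m)" by metis
  have v: "\<And>m. m \<in> Ms n \<Longrightarrow> 0 \<le> v m \<and> v m \<le> c"
    and R2: "\<And>m \<omega>. m \<in> Ms n \<Longrightarrow> R2 n D est m \<omega> = v m * (1 + real (msize m) / (real n - real (msize m) - 1))"
    and B: "\<And>m. m \<in> Ms n \<Longrightarrow> B m \<in> sets (joint_law n D)"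
    and EB: "\<And>m. m \<in> Ms n \<Longrightarrow> emeasure (joint_law n D) (B m) \<le> ennreal (6 * exp (- (real (n - msize m) * \<delta>\<^sup>2) / 16))"
    and good: "\<And>m \<omega>. m \<in> Ms n \<Longrightarrow> \<omega> \<in> space (joint_law n D) - B m \<Longrightarrow>
         \<bar>RSS n est m (fst \<omega>) / real (n - msize m) - v m\<bar> \<le> v m * \<delta> \<and>
         \<bar>rho2 n D est m \<omega> - v m * (1 + real (msize m) / real (n - msize m + 1))\<bar>
           \<le> v m * (4 * real n * \<delta> / real (n - msize m + 1))"
    by (use vB in \<open>auto simp: bounds_def exceptional_event_def\<close>)
  let ?B = "\<Union>m\<in>Ms n. B m"
  have "emeasure (joint_law n D) ?B \<le> (\<Sum>m\<in>Ms n. emeasure (joint_law n D) (B m))"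
    by (rule emeasure_subadditive_finite) (use Mfin B in auto)
  also have "\<dots> \<le> (\<Sum>m\<in>Ms n. ennreal (6 * (real (card (Ms n)) + 1) powr (- \<kappa>\<^sup>2 / 16)))"
  proof (rule sum_mono, rule order_trans[OF EB], assumption, rule ennreal_leI)
    fix m assume m: "m \<in> Ms n"
    have "\<kappa>\<^sup>2 * l = real n * q * \<delta>\<^sup>2"
      unfolding a2[symmetric] \<delta>_def by (simp add: power_mult_distrib power2_eq_square power3_eq_cube mult_ac)
    also have "\<dots> \<le> real (n - msize m) * \<delta>\<^sup>2"
      using Nq[OF m] size[OF m] by (intro mult_right_mono) auto
    finally have "exp (- (real (n - msize m) * \<delta>\<^sup>2) / 16) \<le> exp (- \<kappa>\<^sup>2 / 16 * l)" by simp
    also have "\<dots> = (real (card (Ms n)) + 1) powr (- \<kappa>\<^sup>2 / 16)" by (simp add: powr_def l_def)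
    finally show "6 * exp (- (real (n - msize m) * \<delta>\<^sup>2) / 16) \<le> 6 * (real (card (Ms n)) + 1) powr (- \<kappa>\<^sup>2 / 16)" by simp
  qed
  also have "\<dots> = ennreal (6 * (real (card (Ms n)) * (real (card (Ms n)) + 1) powr (- \<kappa>\<^sup>2 / 16)))"
    by (simp add: ennreal_of_nat_eq_real_of_nat ennreal_mult[symmetric] mult_ac)
  also have "\<dots> \<le> ennreal (6 * 2 powr (1 - \<kappa>\<^sup>2 / 16))"
  proof (intro ennreal_leI mult_left_mono)
    \<comment> \<open>The union bound costs one power of the cardinality. For
      \<open>\<kappa> \<ge> 4\<close> the remaining exponent is nonpositive, so the base can be
      lowered to its smallest value 2 and the bound becomes free of \<open>n\<close>.\<close>
    have "real (card (Ms n)) * (real (card (Ms n)) + 1) powr (- \<kappa>\<^sup>2 / 16)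
        \<le> (real (card (Ms n)) + 1) * (real (card (Ms n)) + 1) powr (- \<kappa>\<^sup>2 / 16)"
      by (intro mult_right_mono) auto
    also have "\<dots> = (real (card (Ms n)) + 1) powr (1 - \<kappa>\<^sup>2 / 16)"
      using powr_add[of "real (card (Ms n)) + 1" 1 "- \<kappa>\<^sup>2 / 16"] by simp
    also have "\<dots> \<le> 2 powr (1 - \<kappa>\<^sup>2 / 16)"
    proof (rule powr_mono2')
      have "4\<^sup>2 \<le> \<kappa>\<^sup>2" using \<kappa>(1) by (intro power_mono) auto
      then show "1 - \<kappa>\<^sup>2 / 16 \<le> 0" by simp
    qed (use card in auto)
    finally show "real (card (Ms n)) * (real (card (Ms n)) + 1) powr (- \<kappa>\<^sup>2 / 16) \<le> 2 powr (1 - \<kappa>\<^sup>2 / 16)" .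
  qed simp
  finally have total: "emeasure (joint_law n D) ?B \<le> ennreal (6 * 2 powr (1 - \<kappa>\<^sup>2 / 16))" .
  have gap: "\<bar>C n est m (fst \<omega>) - L n D est m \<omega>\<bar> \<le> c * (6 * \<kappa> + 16) * a"
    if w: "\<omega> \<in> space (joint_law n D) - ?B" and m: "m \<in> Ms n"
      and C: "C \<in> {GCV, Sp, rho2_hat}" and L: "L \<in> {rho2, R2}" for \<omega> m C L
  proof -
    define k where "k = real (msize m)"
    define N where "N = real n - k"
    define x where "x = RSS n est m (fst \<omega>) / N"
    have sz: "msize m < n - 1" using size[OF m] by simp
    have kN: "0 \<le> k" "2 \<le> N" "real (n - msize m) = N" "N + k = real n"
      using sz by (auto simp: k_def N_def)
    have vm: "0 \<le> v m" "v m \<le> c" using v[OF m] by auto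
    have xb: "\<bar>x - v m\<bar> \<le> v m * (\<kappa> * a * q)"
      and rb: "\<bar>rho2 n D est m \<omega> - v m * (1 + k / (N + 1))\<bar> \<le> v m * (4 * real n * \<delta> / (N + 1))"
      using good[OF m, of \<omega>] w m kN by (auto simp: x_def k_def \<delta>_def add.commute)
    \<comment> \<open>The shifts are \<open>0\<close> for \<open>GCV\<close>, \<open>-1\<close> for
      \<open>Sp\<close> and \<open>1\<close> for \<open>rho2_hat\<close>.\<close>
    have Cx: "\<exists>j. \<bar>j\<bar> \<le> 1 \<and> C n est m (fst \<omega>) = x * (1 + k / (N + j))"
    proof -
      have "C = GCV \<or> C = Sp \<or> C = rho2_hat" using C by auto
      then show ?thesis
      proof (elim disjE)
        assume "C = GCV"
        moreover have "real n / (real n - k) = 1 + k / (N + 0)" using kN by (simp add: N_def field_simps)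
        ultimately show ?thesis by (intro exI[of _ 0]) (simp add: GCV_def x_def N_def k_def)
      next
        assume "C = Sp"
        moreover have "(real n - 1) / (real n - 1 - k) = 1 + k / (N + (-1))" using kN by (simp add: N_def field_simps)
        ultimately show ?thesis by (intro exI[of _ "-1"]) (simp add: Sp_def x_def N_def k_def)
      next
        assume "C = rho2_hat"
        moreover have "(real n + 1) / (real n + 1 - k) = 1 + k / (N + 1)" using kN by (simp add: N_def field_simps)
        ultimately show ?thesis by (intro exI[of _ 1]) (simp add: rho2_hat_def x_def N_def k_def)
      qed
    qed
    then obtain j where j: "\<bar>j\<bar> \<le> 1" "C n est m (fst \<omega>) = x * (1 + k / (N + j))" by blast
    have Lx: "\<exists>j'. \<bar>j'\<bar> \<le> 1 \<and> \<bar>L n D est m \<omega> - v m * (1 + k / (N + j'))\<bar> \<le> c * (4 * \<kappa>) * a"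
    proof (cases "L = rho2")
      case True
      have "4 * real n * \<delta> / (N + 1) \<le> 4 * \<kappa> * a"
      proof -
        have "real n * q \<le> N + 1" using Nq[OF m] by (simp add: N_def k_def)
        then have "(4 * \<kappa> * a) * (real n * q) \<le> (4 * \<kappa> * a) * (N + 1)"
          using \<kappa>(1) a0 by (intro mult_left_mono) auto
        then show ?thesis using kN by (simp add: \<delta>_def field_simps)
      qed
      then have "v m * (4 * real n * \<delta> / (N + 1)) \<le> c * (4 * \<kappa> * a)"
        using vm \<delta>(1) kN by (intro mult_mono) auto
      then show ?thesis using rb True by (intro exI[of _ 1]) (auto simp: mult.assoc)
    next
      case False
      \<comment> \<open>\<open>R2\<close> has shift \<open>-1\<close> and no fluctuation, whereas
        \<open>rho2\<close> fluctuates around the value with shift \<open>1\<close>.\<close>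
      then have "L n D est m \<omega> = v m * (1 + k / (N + (-1)))"
        using L R2[OF m] by (auto simp: k_def N_def)
      moreover have "0 \<le> c * (4 * \<kappa>) * a" using vm \<kappa>(1) a0 by simp
      ultimately show ?thesis by (intro exI[of _ "-1"]) simp
    qed
    then obtain j' where j': "\<bar>j'\<bar> \<le> 1" "\<bar>L n D est m \<omega> - v m * (1 + k / (N + j'))\<bar> \<le> c * (4 * \<kappa>) * a" by blast
    have "\<bar>x * (1 + k / (N + j)) - v m * (1 + k / (N + j'))\<bar> \<le> c * (2 * \<kappa> + 16) * a"
      by (rule criterion_target_gap[where q = q and L = l])
         (use kN q Nq[OF m] a0 a1 a2 l \<kappa>(1) vm xb j(1) j'(1) in \<open>auto simp: N_def k_def\<close>)
    then have "\<bar>C n est m (fst \<omega>) - L n D est m \<omega>\<bar> \<le> c * (2 * \<kappa> + 16) * a + c * (4 * \<kappa>) * a"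
      using j'(2) unfolding j(2) by linarith
    then show ?thesis by (simp add: algebra_simps)
  qed
  have "?B \<in> sets (joint_law n D)" using B Mfin by auto
  then show ?thesis using total gap unfolding a_def by blast
qed

lemma space_joint_law:
  assumes "is_data_law \<theta> D"
  shows "\<omega> \<in> space (joint_law n D) \<Longrightarrow> fst \<omega> \<in> space (sample_space n)"
proof -
  have "sets D = sets obs_space"
    using data_law_centered_gaussian[OF assms] by (simp add: centered_gaussian_law_def)
  then have "space D = space obs_space" by (rule sets_eq_imp_space_eq)
  then show "\<omega> \<in> space (joint_law n D) \<Longrightarrow> fst \<omega> \<in> space (sample_space n)"
    by (auto simp: joint_law_def space_pair_measure sample_space_def space_PiM)
qed

text \<open>If two functions differ by at most \<open>d\<close> on a set, the value of either at a
  minimizer of the other is within \<open>2 * d\<close> of its own minimum. Here the functions are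
  the criterion and the target on the family of models.\<close>

lemma minimizers_uniformly_Op:
  fixes Ms :: "nat \<Rightarrow> model set"
    and c :: real
    and law :: "param \<Rightarrow> obs measure"
    and b :: "nat \<Rightarrow> estimator"
  assumes models: "\<And>n. 2 \<le> n \<Longrightarrow> finite (Ms n) \<and> Ms n \<noteq> {}"
    and model_size: "\<And>n m. 2 \<le> n \<Longrightarrow> m \<in> Ms n \<Longrightarrow> finite {j. m j} \<and> msize m < n - 1"
    and rate_lim: "rate Ms \<longlonglongrightarrow> 0"
    and c_pos: "0 < c"
    and law: "\<And>\<theta>. \<theta> \<in> \<Theta> \<Longrightarrow> is_data_law \<theta> (law \<theta>) \<and> response_variance (law \<theta>) \<le> c"
    and least_squares: "\<And>n m. 2 \<le> n \<Longrightarrow> m \<in> Ms n \<Longrightarrow> restricted_ls_estimator n m (b n m)"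
    and C: "C \<in> {GCV, Sp, rho2_hat}" and L: "L \<in> {rho2, R2}"
    and mh: "\<forall>n\<ge>2. criterion_minimizer n (Ms n) (C n (b n)) (mh n)"
    and mt: "\<forall>n\<ge>2. \<forall>\<theta>\<in>\<Theta>. target_minimizer n (law \<theta>) (Ms n) (L n (law \<theta>) (b n)) (mt n \<theta>)"
  shows "uniformly_Op \<Theta> (\<lambda>n \<theta>. joint_law n (law \<theta>))
        (\<lambda>n \<theta> \<omega>. \<bar>L n (law \<theta>) (b n) (mh n (fst \<omega>)) \<omega>
                  - L n (law \<theta>) (b n) (mt n \<theta> (fst \<omega>)) \<omega>\<bar>) (rate Ms)"
    and "uniformly_Op \<Theta> (\<lambda>n \<theta>. joint_law n (law \<theta>))
        (\<lambda>n \<theta> \<omega>. \<bar>C n (b n) (mh n (fst \<omega>)) (fst \<omega>)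
                  - L n (law \<theta>) (b n) (mh n (fst \<omega>)) \<omega>\<bar>) (rate Ms)"
proof -
  have ev: "\<forall>\<^sub>F n in sequentially. 2 \<le> n \<and> \<kappa> * rate Ms n \<le> 1 / 2" for \<kappa>
  proof -
    have "(\<lambda>n. \<kappa> * rate Ms n) \<longlonglongrightarrow> \<kappa> * 0" by (intro tendsto_intros rate_lim)
    then have "\<forall>\<^sub>F n in sequentially. \<kappa> * rate Ms n < 1 / 2" by (rule order_tendstoD(2)) simp
    then show ?thesis using eventually_ge_at_top[of 2] by eventually_elim simp
  qed
  \<comment> \<open>The threshold is twice the uniform deviation, as the comparison of minimizers
    requires; the second statement satisfies it with room to spare, so one argument covers
    both.\<close>
  have key: "emeasure (joint_law n (law \<theta>)) {\<omega>\<in>space (joint_law n (law \<theta>)). T \<omega> > (12 * c * \<kappa> + 32 * c) * rate Ms n}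
      \<le> ennreal (6 * 2 powr (1 - \<kappa>\<^sup>2 / 16))"
    if \<kappa>: "4 \<le> \<kappa>" and n: "2 \<le> n \<and> \<kappa> * rate Ms n \<le> 1 / 2" and \<theta>: "\<theta> \<in> \<Theta>"
      and T: "T = (\<lambda>\<omega>. \<bar>L n (law \<theta>) (b n) (mh n (fst \<omega>)) \<omega> - L n (law \<theta>) (b n) (mt n \<theta> (fst \<omega>)) \<omega>\<bar>)
        \<or> T = (\<lambda>\<omega>. \<bar>C n (b n) (mh n (fst \<omega>)) (fst \<omega>) - L n (law \<theta>) (b n) (mh n (fst \<omega>)) \<omega>\<bar>)"
    for \<kappa> n \<theta> T
  proof -
    have n2: "2 \<le> n" using n by simp
    let ?J = "joint_law n (law \<theta>)" and ?K = "c * (6 * \<kappa> + 16) * rate Ms n"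
    obtain B where B: "B \<in> sets ?J" "emeasure ?J B \<le> ennreal (6 * 2 powr (1 - \<kappa>\<^sup>2 / 16))"
      and good: "\<And>\<omega> m. \<omega> \<in> space ?J - B \<Longrightarrow> m \<in> Ms n \<Longrightarrow> \<bar>C n (b n) m (fst \<omega>) - L n (law \<theta>) (b n) m \<omega>\<bar> \<le> ?K"
      using criteria_deviation[of \<theta> "law \<theta>" c n Ms "b n" \<kappa>] law[OF \<theta>] models[OF n2] model_size[OF n2]
        least_squares[OF n2] \<kappa> n C L by blast
    have mhs: "mh n s \<in> Ms n" "\<And>m. m \<in> Ms n \<Longrightarrow> C n (b n) (mh n s) s \<le> C n (b n) m s"
      if "s \<in> space (sample_space n)" for s
    proof -
      have "criterion_minimizer n (Ms n) (C n (b n)) (mh n)" using mh n2 by blast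
      then have "mh n \<in> sample_space n \<rightarrow>\<^sub>M count_space (Ms n)"
        and min: "\<forall>s\<in>space (sample_space n). \<forall>m\<in>Ms n. C n (b n) (mh n s) s \<le> C n (b n) m s"
        by (simp_all add: criterion_minimizer_def)
      from measurable_space[OF this(1) that] show "mh n s \<in> Ms n" by simp
      show "C n (b n) (mh n s) s \<le> C n (b n) m s" if "m \<in> Ms n" for m
        using min \<open>s \<in> space (sample_space n)\<close> that by blast
    qed
    have mts: "mt n \<theta> s \<in> Ms n" if "s \<in> space (sample_space n)" for s
    proof -
      have "target_minimizer n (law \<theta>) (Ms n) (L n (law \<theta>) (b n)) (mt n \<theta>)" using mt n2 \<theta> by blast
      then have "mt n \<theta> \<in> sample_space n \<rightarrow>\<^sub>M count_space (Ms n)" by (simp add: target_minimizer_def)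
      from measurable_space[OF this that] show ?thesis by simp
    qed
    have mtL: "AE \<omega> in ?J. \<forall>m\<in>Ms n. L n (law \<theta>) (b n) (mt n \<theta> (fst \<omega>)) \<omega> \<le> L n (law \<theta>) (b n) m \<omega>"
      using mt n2 \<theta> by (auto simp: target_minimizer_def)
    have "emeasure ?J {\<omega>\<in>space ?J. T \<omega> > (12 * c * \<kappa> + 32 * c) * rate Ms n} \<le> emeasure ?J B"
    \<comment> \<open>Inclusion in \<open>B\<close> holds only almost everywhere, since minimizing
      the target is itself an almost sure property.\<close>
    proof (rule emeasure_mono_AE[OF _ B(1)])
      show "AE \<omega> in ?J. \<omega> \<in> {\<omega>\<in>space ?J. T \<omega> > (12 * c * \<kappa> + 32 * c) * rate Ms n} \<longrightarrow> \<omega> \<in> B"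
        using mtL
      proof eventually_elim
        case (elim \<omega>)
        show ?case
        proof (rule impI, rule ccontr)
          assume w: "\<omega> \<in> {\<omega>\<in>space ?J. T \<omega> > (12 * c * \<kappa> + 32 * c) * rate Ms n}" "\<omega> \<notin> B"
          then have w': "\<omega> \<in> space ?J - B" by simp
          have s: "fst \<omega> \<in> space (sample_space n)"
            using space_joint_law[of \<theta> "law \<theta>" \<omega> n] law[OF \<theta>] w by simp
          note h = mhs(1)[OF s] and t = mts[OF s]
          have "L n (law \<theta>) (b n) (mt n \<theta> (fst \<omega>)) \<omega> \<le> L n (law \<theta>) (b n) (mh n (fst \<omega>)) \<omega>"
            using elim h by blast
          moreover have "C n (b n) (mh n (fst \<omega>)) (fst \<omega>) \<le> C n (b n) (mt n \<theta> (fst \<omega>)) (fst \<omega>)"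
            by (rule mhs(2)[OF s t])
          moreover have "T \<omega> = \<bar>L n (law \<theta>) (b n) (mh n (fst \<omega>)) \<omega> - L n (law \<theta>) (b n) (mt n \<theta> (fst \<omega>)) \<omega>\<bar>
              \<or> T \<omega> = \<bar>C n (b n) (mh n (fst \<omega>)) (fst \<omega>) - L n (law \<theta>) (b n) (mh n (fst \<omega>)) \<omega>\<bar>"
            using T by auto
          ultimately have "T \<omega> \<le> 2 * ?K"
            using good[OF w' h] good[OF w' t] by linarith
          then show False using w by (simp add: algebra_simps)
        qed
      qed
    qed
    then show ?thesis using B(2) by (rule order_trans)
  qed
  have c1: "0 < 12 * c" using c_pos by simp
  show "uniformly_Op \<Theta> (\<lambda>n \<theta>. joint_law n (law \<theta>))
        (\<lambda>n \<theta> \<omega>. \<bar>L n (law \<theta>) (b n) (mh n (fst \<omega>)) \<omega>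
                  - L n (law \<theta>) (b n) (mt n \<theta> (fst \<omega>)) \<omega>\<bar>) (rate Ms)"
    by (rule uniformly_OpI[OF c1, where ?c2.0 = "32 * c"], rule eventually_mono[OF ev], rule ballI)
       (simp only: abs_idempotent, rule key, auto)
  show "uniformly_Op \<Theta> (\<lambda>n \<theta>. joint_law n (law \<theta>))
        (\<lambda>n \<theta> \<omega>. \<bar>C n (b n) (mh n (fst \<omega>)) (fst \<omega>)
                  - L n (law \<theta>) (b n) (mh n (fst \<omega>)) \<omega>\<bar>) (rate Ms)"
    by (rule uniformly_OpI[OF c1, where ?c2.0 = "32 * c"], rule eventually_mono[OF ev], rule ballI)
       (simp only: abs_idempotent, rule key, auto)
qed

theorem corollary3p5:
  fixes Ms :: "nat \<Rightarrow> model set"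
    and c :: real
    and law :: "param \<Rightarrow> obs measure"
    and b :: "nat \<Rightarrow> estimator"
  assumes models: "\<And>n. 2 \<le> n \<Longrightarrow> finite (Ms n) \<and> Ms n \<noteq> {}"
    and model_size: "\<And>n m. 2 \<le> n \<Longrightarrow> m \<in> Ms n \<Longrightarrow> finite {j. m j} \<and> msize m < n - 1"
    and rate_lim: "rate Ms \<longlonglongrightarrow> 0"
    and c_pos: "0 < c"
    and law: "\<And>\<theta>. \<theta> \<in> param_space \<Longrightarrow> is_data_law \<theta> (law \<theta>)"
    and least_squares: "\<And>n m. 2 \<le> n \<Longrightarrow> m \<in> Ms n \<Longrightarrow> restricted_ls_estimator n m (b n m)"
  defines "\<Theta> \<equiv> {\<theta> \<in> param_space. response_variance (law \<theta>) \<le> c}"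
  shows "(\<forall>mh mt.
      (\<forall>n\<ge>2. criterion_minimizer n (Ms n) (GCV n (b n)) (mh n)) \<longrightarrow>
      (\<forall>n\<ge>2. \<forall>\<theta>\<in>\<Theta>. target_minimizer n (law \<theta>) (Ms n) (rho2 n (law \<theta>) (b n)) (mt n \<theta>)) \<longrightarrow>
      uniformly_Op \<Theta> (\<lambda>n \<theta>. joint_law n (law \<theta>))
        (\<lambda>n \<theta> \<omega>. \<bar>rho2 n (law \<theta>) (b n) (mh n (fst \<omega>)) \<omega>
                  - rho2 n (law \<theta>) (b n) (mt n \<theta> (fst \<omega>)) \<omega>\<bar>) (rate Ms) \<and>
      uniformly_Op \<Theta> (\<lambda>n \<theta>. joint_law n (law \<theta>))
        (\<lambda>n \<theta> \<omega>. \<bar>GCV n (b n) (mh n (fst \<omega>)) (fst \<omega>)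
                  - rho2 n (law \<theta>) (b n) (mh n (fst \<omega>)) \<omega>\<bar>) (rate Ms)) \<and>
    (\<forall>C\<in>{GCV, Sp, rho2_hat}. \<forall>L\<in>{rho2, R2}. \<forall>mh mt.
      (\<forall>n\<ge>2. criterion_minimizer n (Ms n) (C n (b n)) (mh n)) \<longrightarrow>
      (\<forall>n\<ge>2. \<forall>\<theta>\<in>\<Theta>. target_minimizer n (law \<theta>) (Ms n) (L n (law \<theta>) (b n)) (mt n \<theta>)) \<longrightarrow>
      uniformly_Op \<Theta> (\<lambda>n \<theta>. joint_law n (law \<theta>))
        (\<lambda>n \<theta> \<omega>. \<bar>L n (law \<theta>) (b n) (mh n (fst \<omega>)) \<omega>
                  - L n (law \<theta>) (b n) (mt n \<theta> (fst \<omega>)) \<omega>\<bar>) (rate Ms) \<and>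
      uniformly_Op \<Theta> (\<lambda>n \<theta>. joint_law n (law \<theta>))
        (\<lambda>n \<theta> \<omega>. \<bar>C n (b n) (mh n (fst \<omega>)) (fst \<omega>)
                  - L n (law \<theta>) (b n) (mh n (fst \<omega>)) \<omega>\<bar>) (rate Ms))"
proof -
  have law': "is_data_law \<theta> (law \<theta>) \<and> response_variance (law \<theta>) \<le> c" if "\<theta> \<in> \<Theta>" for \<theta>
    using that law by (simp add: \<Theta>_def)
  note Op = minimizers_uniformly_Op[OF models model_size rate_lim c_pos law' least_squares]
  \<comment> \<open>The first conjunct is the case \<open>C = GCV\<close>, \<open>L = rho2\<close>
    of the general statement.\<close>
  show ?thesis
    by (intro conjI allI ballI impI; (rule Op; (assumption | simp)))
qed

end
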